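(* For all $x>0$ and $\nu>0$ we have $$Z(x,\nu)=16x^2\log x^2+16x^2\log(Qe^4\nu)+R_0(x,\nu),$$ $$R_0(x,\nu)=\frac1{2\pi i}\int_{\Re(s)=c}(2s)^4\bigl[(\nu^{-1}x^2)^s-\nu^{-1}(\nu x^2)^s\bigr]\widehat\zeta(s)^2\,ds\qquad(c>1),$$ and $$Z(x,\nu)=\frac{16}{\nu}x^2\log x^2+\frac{16}{\nu}x^2\log\frac{Qe^4}{\nu}+R_\infty(x,\nu),$$ $$R_\infty(x,\nu)=\frac1{2\pi i}\int_{\Re(s)=c}(2s)^4\bigl[(\nu^{-1}x^2)^s-\nu^{-1}(\nu x^2)^s\bigr]\widehat\zeta(s)^2\,ds\qquad(c<0).$$ Moreover, for every $\delta>0$, $$R_0(x,\nu)=O\bigl((\nu^{-1-\delta}+\nu^{\delta})\,x^{2(1+\delta)}\bigr)\quad\text{for }0<x\le1,$$ $$R_\infty(x,\nu)=O\bigl((\nu^{-1-\delta}+\nu^{\delta})\,x^{-2\delta}\bigr)\quad\text{for }x\ge1,$$ where the implied constants depend only on $\delta$. In particular, for each $\nu>0$ there exist $x_\nu>0$ and $x'_\nu>0$ such that $Z(x,\nu)$ is negative for $0<x<x_\nu$ and $Z(x,\nu)$ is positive for every $x>x'_\nu$.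
   Context: Let $\theta(x)=\sum_{k\in\mathbb{Z}}e^{-\pi k^2x}$ and, for $a,b>0$, $$w_{a,b}(x)=(\theta(a^2x^{-2})-1)(\theta(b^2x^{-2})-1)-x^2(\theta(a^2x^2)-1)(\theta(b^2x^2)-1).$$ For $\nu>0$ and $x>0$ put $$V(x,\nu)=\int_0^\infty w_{a,\nu a^{-1}}(x)\frac{da}{a},\qquad Z(x,\nu)=\Bigl(-x\frac{d}{dx}\Bigr)^4V(x,\nu).$$ $\widehat\zeta(s)=\pi^{-s/2}\Gamma(s/2)\zeta(s)$ is the completed Riemann zeta function, and $Q=(4\pi)^{-1}e^{\gamma}$, where $\gamma=0.57721\ldots$ is Euler's constant. *)

theory Defs
  imports "HOL-Complex_Analysis.Complex_Analysis"
begin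

definition theta :: "real \<Rightarrow> real" where
  "theta x = (\<Sum>\<^sub>\<infinity>k::int. exp (- pi * (of_int k)\<^sup>2 * x))"

definition w_fun :: "real \<Rightarrow> real \<Rightarrow> real \<Rightarrow> real" where
  "w_fun a b x =
     (theta (a\<^sup>2 * x powi (-2)) - 1) * (theta (b\<^sup>2 * x powi (-2)) - 1)
     - x\<^sup>2 * (theta (a\<^sup>2 * x\<^sup>2) - 1) * (theta (b\<^sup>2 * x\<^sup>2) - 1)"

definition V_integrand :: "real \<Rightarrow> real \<Rightarrow> real \<Rightarrow> real" where
  "V_integrand x \<nu> a = w_fun a (\<nu> * inverse a) x / a"

definition V_fun :: "real \<Rightarrow> real \<Rightarrow> real" where
  "V_fun x \<nu> = (LINT a:{0<..}|lborel. V_integrand x \<nu> a)"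

definition euler_op :: "(real \<Rightarrow> real) \<Rightarrow> real \<Rightarrow> real" where
  "euler_op f = (\<lambda>x. - x * deriv f x)"

definition Z_fun :: "real \<Rightarrow> real \<Rightarrow> real" where
  "Z_fun x \<nu> = (euler_op ^^ 4) (\<lambda>y. V_fun y \<nu>) x"

text \<open>
  The Riemann zeta function as the analytic continuation of its Dirichlet series to
  the plane punctured at 1. The continuation is unique on the punctured plane; the
  value 0 at the pole is a convention that makes the function as a whole unique.
\<close>
definition riemann_zeta :: "complex \<Rightarrow> complex" where
  "riemann_zeta = (THE f. f holomorphic_on (- {1}) \<and>
     (\<forall>s. Re s > 1 \<longrightarrow> f s = (\<Sum>n. 1 / of_nat (Suc n) powr s)) \<and> f 1 = 0)"

text \<open>
  At the negative even integers the pole of the Gamma factor cancels against a zero of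
  the zeta function, but pointwise the product would be 0 there because \<^const>\<open>Gamma\<close> is 0
  at its poles; \<^const>\<open>remove_sings\<close> restores the value of the meromorphic function.
\<close>
definition completed_zeta :: "complex \<Rightarrow> complex" where
  "completed_zeta = remove_sings
     (\<lambda>s. of_real pi powr (- s / 2) * Gamma (s / 2) * riemann_zeta s)"

definition Q_const :: real where
  "Q_const = inverse (4 * pi) * exp euler_mascheroni"

definition R_integrand :: "real \<Rightarrow> real \<Rightarrow> complex \<Rightarrow> complex" where
  "R_integrand x \<nu> s =
     (2 * s) ^ 4 *
     (of_real (inverse \<nu> * x\<^sup>2) powr s - of_real (inverse \<nu>) * of_real (\<nu> * x\<^sup>2) powr s) *
     (completed_zeta s)\<^sup>2"

text \<open>
  Integration over the upward vertical line at abscissa \<^term>\<open>c\<close>, parametrised by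
  \<open>s = c + it\<close>, so that \<open>ds = i dt\<close>.
\<close>
definition vline_integrable :: "real \<Rightarrow> (complex \<Rightarrow> complex) \<Rightarrow> bool" where
  "vline_integrable c g \<longleftrightarrow> integrable lborel (\<lambda>t. g (Complex c t) * \<i>)"

definition vline_integral :: "real \<Rightarrow> (complex \<Rightarrow> complex) \<Rightarrow> complex" where
  "vline_integral c g = (LINT t|lborel. g (Complex c t) * \<i>)"

text \<open>
  The remainders \<open>R\<^sub>0\<close> and \<open>R\<^sub>\<infinity>\<close> are given by the same integral, over a line with
  \<open>c > 1\<close> and with \<open>c < 0\<close> respectively.
\<close>
definition R_line :: "real \<Rightarrow> real \<Rightarrow> real \<Rightarrow> complex" where
  "R_line c x \<nu> = 1 / (2 * of_real pi * \<i>) * vline_integral c (R_integrand x \<nu>)"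

end

theory Submission
  imports Defs "HOL-Probability.Characteristic_Functions" "HOL-Probability.Sinc_Integral"
    "HOL-Real_Asymp.Real_Asymp"
begin

text \<open>
  In the variable \<open>u = ln a\<close> the function \<open>theta (a\<^sup>2) - 1\<close> becomes \<open>Omega u\<close>, and \<open>V_fun x \<nu>\<close> is the difference
  \<open>F (\<nu> / x\<^sup>2) - x\<^sup>2 * F (\<nu> * x\<^sup>2)\<close>, where \<open>F\<close> is the multiplicative convolution of \<open>theta (a\<^sup>2) - 1\<close> with itself. The Mellin
  transform of \<open>theta (a\<^sup>2) - 1\<close> is the completed zeta function, so that of \<open>F\<close> is its square, and Mellin inversion
  writes \<open>V_fun\<close> as an integral over a line \<open>Re s = c\<close> with \<open>c > 1\<close> of the square of the completed zeta function times
  \<open>(x\<^sup>2 / \<nu>) powr s - x\<^sup>2 * (\<nu> * x\<^sup>2) powr (- s)\<close>. Four applications of the Euler operator multiply the two terms by \<open>(2 * s) ^ 4\<close> and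
  \<open>(2 - 2 * s) ^ 4\<close>. The functional equation moves the second term to the line \<open>Re s = 1 - c\<close>, where it has the same
  kernel as the first; this is \<open>V_stage_4\<close>.

  The two expansions then differ only in which of the terms is carried across the critical strip. The kernel is
  holomorphic at 0, because the fourth power cancels the double pole there, and has a double pole at 1. Moving a
  line past 1 contributes the residue \<open>16 * X * (4 + ln X + euler_mascheroni - ln (4 * pi))\<close> (\<open>line_mean_shift\<close>), which is
  the main term in both cases. The remainder is a difference of line integrals of size \<open>X powr c\<close>, independent of \<open>c\<close> on
  either side of the strip; choosing \<open>c = 1 + \<delta>\<close> or \<open>c = - \<delta>\<close> gives the estimates, and the signs of \<open>Z_fun\<close> follow by
  comparing with the main terms.

  The analytic input is threefold. First, Jacobi's functional equation of theta (\<open>theta_tail_functional_equation\<close>) is derived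
  by testing a Gaussian against the Poisson kernel; it gives the entire function \<open>xi_fun\<close> with its reflection symmetry, and
  thereby the continuation of zeta. Second, \<open>xi_fun\<close> must decay on vertical strips (\<open>xi_fun_decay\<close>): to the right of
  \<open>Re s = 1/2\<close> this follows from the decay of the gamma function and a quadratic bound for \<open>(s - 1) * zeta s\<close>, and
  elsewhere by reflection. Third, Fourier inversion (\<open>fourier_inversion\<close>) recovers \<open>Omega\<close> from its transform. The
  constant in the residue comes from the expansion at 1 of \<open>(s - 1) * zeta s\<close> and of the gamma factor (\<open>xi_fun_at_1\<close>).
\<close>

section \<open>Gaussians and Fourier inversion on the line\<close>

lemma integrable_inverse_one_plus_square:
  "integrable lborel (\<lambda>t::real. 1 / (1 + t\<^sup>2))"
  using integrable_inverse_1_plus_square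
  by (simp add: set_integrable_def einterval_def inverse_eq_divide)

lemma integrable_exp_minus_abs:
  fixes c :: real
  assumes "c > 0"
  shows "integrable lborel (\<lambda>u::real. exp (- c * \<bar>u\<bar>))"
proof (rule Bochner_Integration.integrable_bound)
  show "integrable lborel (\<lambda>t::real. (1 + 2 / c\<^sup>2) * (1 / (1 + t\<^sup>2)))"
    by (intro integrable_mult_right integrable_inverse_one_plus_square)
  show "AE u in lborel. norm (exp (- c * \<bar>u\<bar>)) \<le> norm ((1 + 2 / c\<^sup>2) * (1 / (1 + u\<^sup>2)))"
  proof (rule AE_I2)
    fix u :: real
    have *: "1 + x + x\<^sup>2 / 2 \<le> exp x" if "x \<ge> 0" for x :: real
      using exp_lower_Taylor_quadratic[OF that] by simp
    have "1 + c\<^sup>2 * u\<^sup>2 / 2 \<le> exp (c * \<bar>u\<bar>)"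
      using *[of "c * \<bar>u\<bar>"] assms by (simp add: power_mult_distrib) (smt (verit) mult_nonneg_nonneg)
    moreover have "1 + u\<^sup>2 \<le> (1 + 2 / c\<^sup>2) * (1 + c\<^sup>2 * u\<^sup>2 / 2)"
      using assms by (simp add: field_simps)
    ultimately have "1 + u\<^sup>2 \<le> (1 + 2 / c\<^sup>2) * exp (c * \<bar>u\<bar>)"
      using assms by (smt (verit, ccfv_SIG) divide_nonneg_nonneg mult_left_mono zero_le_power2)
    moreover have "0 < 1 + u\<^sup>2" by (simp add: add_pos_nonneg)
    ultimately show "norm (exp (- c * \<bar>u\<bar>)) \<le> norm ((1 + 2 / c\<^sup>2) * (1 / (1 + u\<^sup>2)))"
      by (simp add: exp_minus field_simps)
  qed
qed measurable

text \<open>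
  This is the characteristic function of the normal distribution with the variance and the normalisation put back.
\<close>
lemma gaussian_fourier:
  fixes a \<xi> :: real
  assumes "a > 0"
  shows "has_bochner_integral lborel (\<lambda>t. exp (- a * t\<^sup>2) * iexp (\<xi> * t))
           (complex_of_real (sqrt (pi / a) * exp (- \<xi>\<^sup>2 / (4 * a))))"
proof -
  define q where "q = sqrt (2 * a)"
  have q: "q > 0" "q\<^sup>2 = 2 * a" using assms by (auto simp: q_def)
  have int: "integrable lborel (\<lambda>x. std_normal_density x *\<^sub>R iexp (t * x))" for t :: real
    by (rule Bochner_Integration.integrable_bound[OF integrable_normal_density[of 1 0]])
       (auto simp: norm_mult)
  have "(LINT x|lborel. std_normal_density x *\<^sub>R iexp (t * x)) = exp (- t\<^sup>2 / 2)" for t :: real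
    using fun_cong[OF char_std_normal_distribution, of t]
    by (simp add: char_def integral_density exp_of_real)
  with int have hb: "has_bochner_integral lborel (\<lambda>x. std_normal_density x *\<^sub>R iexp (t * x)) (exp (- t\<^sup>2 / 2))"
    for t :: real
    by (simp add: has_bochner_integral_iff)
  have "has_bochner_integral lborel (\<lambda>x. std_normal_density (0 + q * x) *\<^sub>R iexp ((\<xi> / q) * (0 + q * x)))
      (complex_of_real (exp (- (\<xi>/q)\<^sup>2 / 2)) /\<^sub>R \<bar>q\<bar>)"
    using lborel_has_bochner_integral_real_affine_iff[of q "\<lambda>x. std_normal_density x *\<^sub>R iexp (\<xi> / q * x)" _ 0]
      q(1) hb[of "\<xi> / q"] by (simp add: scaleR_conv_of_real)
  then have "has_bochner_integral lborel
      (\<lambda>x. sqrt (2 * pi) * (std_normal_density (0 + q * x) *\<^sub>R iexp ((\<xi> / q) * (0 + q * x))))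
      (complex_of_real (sqrt (2 * pi)) * (complex_of_real (exp (- (\<xi>/q)\<^sup>2 / 2)) /\<^sub>R \<bar>q\<bar>))"
    by (intro has_bochner_integral_mult_right)
  also have "(\<lambda>x. sqrt (2 * pi) * (std_normal_density (0 + q * x) *\<^sub>R iexp ((\<xi> / q) * (0 + q * x))))
     = (\<lambda>t. exp (- a * t\<^sup>2) * iexp (\<xi> * t))"
    using q by (auto simp: std_normal_density_def scaleR_conv_of_real power_mult_distrib exp_of_real[symmetric])
  also have "complex_of_real (sqrt (2 * pi)) * (complex_of_real (exp (- (\<xi>/q)\<^sup>2 / 2)) /\<^sub>R \<bar>q\<bar>) = complex_of_real (sqrt (pi / a) * exp (- \<xi>\<^sup>2 / (4 * a)))"
  proof -
    have "sqrt (2 * pi) / q = sqrt (pi / a)"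
      by (simp add: q_def real_sqrt_divide[symmetric])
    moreover have "- (\<xi>/q)\<^sup>2 / 2 = - \<xi>\<^sup>2 / (4 * a)"
      using q by (simp add: power_divide)
    moreover have "complex_of_real (sqrt (2 * pi)) * (complex_of_real (exp (- (\<xi>/q)\<^sup>2 / 2)) /\<^sub>R \<bar>q\<bar>) =
        complex_of_real (sqrt (2 * pi) / q * exp (- (\<xi>/q)\<^sup>2 / 2))"
      using q by (simp add: scaleR_conv_of_real field_simps)
    ultimately show ?thesis by simp
  qed
  finally show ?thesis .
qed

lemma integrable_product:
  fixes f g :: "real \<Rightarrow> complex"
  assumes f: "integrable lborel f" and g: "integrable lborel g"
  shows "integrable (lborel \<Otimes>\<^sub>M lborel) (\<lambda>(x, y). f x * g y)"
proof (rule lborel_pair.Fubini_integrable)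
  note [measurable] = borel_measurable_integrable[OF f] borel_measurable_integrable[OF g]
  show "(\<lambda>(x, y). f x * g y) \<in> borel_measurable (lborel \<Otimes>\<^sub>M lborel)" by measurable
  show "integrable lborel (\<lambda>x. LINT y|lborel. norm (case (x, y) of (x, y) \<Rightarrow> f x * g y))"
    using f by (simp add: norm_mult integrable_norm)
  show "AE x in lborel. integrable lborel (\<lambda>y. case (x, y) of (x, y) \<Rightarrow> f x * g y)"
    using g by simp
qed

text \<open>
  Gaussian regularisation. Inserting \<open>exp (- \<tau>\<^sup>2 / (2 N\<^sup>2))\<close> under the outer integral makes
  the double integral absolutely convergent, and Fubini turns it into an average of \<open>g\<close> around \<open>x\<close>
  against a Gaussian of width \<open>1 / N\<close>. As \<open>N\<close> grows, the regularised integral converges to the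
  inversion integral because \<open>g\<close> has an integrable transform, and the average converges to \<open>g x\<close>
  because \<open>g\<close> is bounded and continuous.
\<close>
lemma fourier_inversion:
  fixes g :: "real \<Rightarrow> complex"
  assumes cont: "continuous_on UNIV g" and int: "integrable lborel g"
    and bdd: "\<And>u. norm (g u) \<le> B"
    and int_hat: "integrable lborel (\<lambda>\<tau>. LINT u|lborel. g u * iexp (\<tau> * u))"
  shows "(LINT \<tau>|lborel. (LINT u|lborel. g u * iexp (\<tau> * u)) * iexp (- \<tau> * x)) = 2 * pi * g x"
proof -
  define gh where "gh = (\<lambda>\<tau>. LINT u|lborel. g u * iexp (\<tau> * u))"
  define K where "K = (\<lambda>n::nat. \<lambda>\<tau>::real. exp (- (1 / (2 * (Suc n)\<^sup>2)) * \<tau>\<^sup>2))"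
  have [measurable]: "gh \<in> borel_measurable borel"
    using borel_measurable_integrable[OF int_hat] by (simp add: gh_def)
  have [measurable]: "g \<in> borel_measurable borel"
    using cont by (rule borel_measurable_continuous_onI)
  have [measurable]: "K n \<in> borel_measurable borel" for n unfolding K_def by measurable
  have K1: "\<bar>K n \<tau>\<bar> \<le> 1" for n \<tau> by (simp add: K_def)
  have lim1: "(\<lambda>n. LINT \<tau>|lborel. gh \<tau> * iexp (- \<tau> * x) * K n \<tau>) \<longlonglongrightarrow>
     (LINT \<tau>|lborel. gh \<tau> * iexp (- \<tau> * x))"
  proof (rule integral_dominated_convergence)
    show "integrable lborel (\<lambda>\<tau>. norm (gh \<tau>))" using int_hat by (simp add: gh_def integrable_norm)
    show "AE \<tau> in lborel. (\<lambda>n. gh \<tau> * iexp (- \<tau> * x) * K n \<tau>) \<longlonglongrightarrow> gh \<tau> * iexp (- \<tau> * x)"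
    proof (rule AE_I2)
      fix \<tau>
      have "(\<lambda>n::nat. 1 / (2 * real (Suc n) ^ 2)) \<longlonglongrightarrow> 0" by real_asymp
      from tendsto_mult[OF tendsto_minus[OF this] tendsto_const[of "\<tau>\<^sup>2"]]
      have "(\<lambda>n. K n \<tau>) \<longlonglongrightarrow> exp (0)" unfolding K_def by (intro tendsto_exp) auto
      from tendsto_mult[OF tendsto_const[of "gh \<tau> * iexp (- \<tau> * x)"] tendsto_of_real[OF this]]
      show "(\<lambda>n. gh \<tau> * iexp (- \<tau> * x) * K n \<tau>) \<longlonglongrightarrow> gh \<tau> * iexp (- \<tau> * x)"
        by simp
    qed
    show "AE \<tau> in lborel. norm (gh \<tau> * iexp (- \<tau> * x) * K n \<tau>) \<le> norm (gh \<tau>)" for n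
      using K1[of n] by (auto simp: norm_mult mult_left_le)
  qed measurable
  have Kint: "has_bochner_integral lborel (\<lambda>\<tau>. complex_of_real (K n \<tau>) * iexp (y * \<tau>))
      (complex_of_real (sqrt (2 * pi) * Suc n * exp (- (Suc n * y)\<^sup>2 / 2)))"
    for n :: nat and y :: real
  proof -
    have "pi / (1 / (2 * (real (Suc n))\<^sup>2)) = (2 * pi) * (Suc n)\<^sup>2" by (simp add: field_simps)
    then have "sqrt (pi / (1 / (2 * (real (Suc n))\<^sup>2))) = sqrt (2 * pi) * Suc n"
      by (simp add: real_sqrt_mult)
    moreover have "- y\<^sup>2 / (4 * (1 / (2 * (real (Suc n))\<^sup>2))) = - (Suc n * y)\<^sup>2 / 2"
      by (simp add: power_mult_distrib)
    ultimately show ?thesis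
      using gaussian_fourier[of "1 / (2 * (real (Suc n))\<^sup>2)" y] by (simp add: K_def)
  qed
  have eq: "(LINT \<tau>|lborel. gh \<tau> * iexp (- \<tau> * x) * K n \<tau>) =
     (LINT v|lborel. g (x + v / Suc n) * (sqrt (2 * pi) * exp (- v\<^sup>2 / 2)))" for n
  proof -
    have Kn: "integrable lborel (\<lambda>\<tau>. complex_of_real (K n \<tau>))"
      using Kint[of n 0]
      by (auto simp: has_bochner_integral_iff)
    have "(LINT \<tau>|lborel. gh \<tau> * iexp (- \<tau> * x) * K n \<tau>) =
       (LINT \<tau>|lborel. LINT u|lborel. g u * (K n \<tau> * iexp ((u - x) * \<tau>)))"
    proof (rule Bochner_Integration.integral_cong[OF refl])
      fix \<tau>
      have "gh \<tau> * iexp (- \<tau> * x) * K n \<tau> = gh \<tau> * (iexp (- \<tau> * x) * K n \<tau>)" by simp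
      also have "\<dots> = (LINT u|lborel. g u * iexp (\<tau> * u) * (iexp (- \<tau> * x) * K n \<tau>))"
        unfolding gh_def by simp
      also have "\<dots> = (LINT u|lborel. g u * (K n \<tau> * iexp ((u - x) * \<tau>)))"
        by (rule Bochner_Integration.integral_cong[OF refl])
           (simp add: algebra_simps flip: exp_add)
      finally show "gh \<tau> * iexp (- \<tau> * x) * K n \<tau> = \<dots>" .
    qed
    also have "\<dots> = (LINT u|lborel. LINT \<tau>|lborel. g u * (K n \<tau> * iexp ((u - x) * \<tau>)))"
    proof (rule lborel_pair.Fubini_integral)
      show "integrable (lborel \<Otimes>\<^sub>M lborel) (\<lambda>(u, \<tau>). g u * (K n \<tau> * iexp ((u - x) * \<tau>)))"
      proof (rule Bochner_Integration.integrable_bound[OF integrable_product[OF int Kn]])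
        show "AE z in lborel \<Otimes>\<^sub>M lborel. norm (case z of (u, \<tau>) \<Rightarrow> g u * (K n \<tau> * iexp ((u - x) * \<tau>)))
           \<le> norm (case z of (u, \<tau>) \<Rightarrow> g u * complex_of_real (K n \<tau>))"
          by (rule AE_I2) (auto simp: norm_mult)
      qed measurable
    qed
    also have "\<dots> = (LINT u|lborel. g u * (sqrt (2 * pi) * Suc n * exp (- (Suc n * (u - x))\<^sup>2 / 2)))"
      by (simp only: integral_mult_right_zero has_bochner_integral_integral_eq[OF Kint])
    also have "\<dots> = (1 / Suc n) *\<^sub>R (LINT v|lborel. g (x + (1 / Suc n) * v) *
        (sqrt (2 * pi) * Suc n * exp (- (Suc n * (x + (1 / Suc n) * v - x))\<^sup>2 / 2)))"
      by (subst lborel_integral_real_affine[where c="1 / Suc n" and t=x]) auto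
    also have "\<dots> = (LINT v|lborel. (1 / Suc n) *\<^sub>R (g (x + (1 / Suc n) * v) *
        (sqrt (2 * pi) * Suc n * exp (- (Suc n * (x + (1 / Suc n) * v - x))\<^sup>2 / 2))))"
      by simp
    also have "\<dots> = (LINT v|lborel. g (x + v / Suc n) * (sqrt (2 * pi) * exp (- v\<^sup>2 / 2)))"
      by (rule Bochner_Integration.integral_cong[OF refl]) (simp add: scaleR_conv_of_real del: of_nat_Suc)
    finally show ?thesis .
  qed
  have gauss: "has_bochner_integral lborel (\<lambda>v. complex_of_real (exp (- v\<^sup>2 / 2))) (sqrt (2 * pi))"
    using gaussian_fourier[of "1/2" 0] by (simp add: real_sqrt_mult field_simps)
  have lim2: "(\<lambda>n. LINT v|lborel. g (x + v / Suc n) * (sqrt (2 * pi) * exp (- v\<^sup>2 / 2))) \<longlonglongrightarrow>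
     (LINT v|lborel. g x * (sqrt (2 * pi) * exp (- v\<^sup>2 / 2)))"
  proof (rule integral_dominated_convergence)
    have "integrable lborel (\<lambda>v. B * sqrt (2 * pi) * norm (complex_of_real (exp (- v\<^sup>2 / 2))))"
      using gauss unfolding has_bochner_integral_iff by (intro integrable_mult_right integrable_norm) auto
    then show "integrable lborel (\<lambda>v. B * sqrt (2 * pi) * (exp (- v\<^sup>2 / 2)))" by simp
    show "AE v in lborel. (\<lambda>n. g (x + v / Suc n) * (sqrt (2 * pi) * exp (- v\<^sup>2 / 2)))
       \<longlonglongrightarrow> g x * (sqrt (2 * pi) * exp (- v\<^sup>2 / 2))"
    proof (rule AE_I2)
      fix v :: real
      have "(\<lambda>n. x + v / Suc n) \<longlonglongrightarrow> x" by real_asymp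
      moreover have "isCont g x" using cont by (simp add: continuous_on_eq_continuous_at)
      ultimately have "(\<lambda>n. g (x + v / Suc n)) \<longlonglongrightarrow> g x" by (rule isCont_tendsto_compose[rotated])
      then show "(\<lambda>n. g (x + v / Suc n) * (sqrt (2 * pi) * exp (- v\<^sup>2 / 2)))
       \<longlonglongrightarrow> g x * (sqrt (2 * pi) * exp (- v\<^sup>2 / 2))" by (intro tendsto_intros)
    qed
    show "AE v in lborel. norm (g (x + v / Suc n) * (sqrt (2 * pi) * exp (- v\<^sup>2 / 2)))
        \<le> B * sqrt (2 * pi) * (exp (- v\<^sup>2 / 2))" for n
      using bdd by (auto simp: norm_mult intro!: mult_right_mono)
  qed measurable
  have "(LINT v|lborel. g x * (sqrt (2 * pi) * exp (- v\<^sup>2 / 2))) =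
      g x * (complex_of_real (sqrt (2 * pi)) * sqrt (2 * pi))"
    using has_bochner_integral_integral_eq[OF gauss] by simp
  also have "complex_of_real (sqrt (2 * pi)) * sqrt (2 * pi) = 2 * pi"
    by (subst of_real_mult[symmetric]) simp
  finally have "(LINT v|lborel. g x * (sqrt (2 * pi) * exp (- v\<^sup>2 / 2))) = 2 * pi * g x"
    by simp
  with lim2 have "(\<lambda>n. LINT \<tau>|lborel. gh \<tau> * iexp (- \<tau> * x) * K n \<tau>) \<longlonglongrightarrow> 2 * pi * g x"
    by (simp only: eq)
  from LIMSEQ_unique[OF lim1 this] show ?thesis unfolding gh_def .
qed


section \<open>The functional equation of the theta function\<close>

text \<open>
  The Poisson kernel of the unit disc at \<open>r\<close> times \<open>cis (2 * pi * t)\<close>. The half-angle form of the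
  denominator makes positivity visible, as well as the concentration at the integers as \<open>r\<close> tends to 1.
\<close>
definition poisson_kernel :: "real \<Rightarrow> real \<Rightarrow> real" where
  "poisson_kernel r t = (1 - r\<^sup>2) / ((1 - r)\<^sup>2 + 4 * r * (sin (pi * t))\<^sup>2)"

lemma measurable_poisson_kernel [measurable]: "poisson_kernel r \<in> borel_measurable borel"
  unfolding poisson_kernel_def by measurable

text \<open>
  With \<open>z = r * cis (2 * pi * t)\<close> this is the real part of \<open>2 * z / (1 - z)\<close>, summed as a geometric series.
\<close>
lemma poisson_kernel_sums:
  assumes r: "0 < r" "r < 1"
  shows "(\<lambda>k. 2 * r ^ Suc k * cos (2 * pi * Suc k * t)) sums (poisson_kernel r t - 1)"
proof -
  define z where "z = of_real r * cis (2 * pi * t)"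
  have nz: "norm z < 1" using r by (simp add: z_def norm_mult)
  have "(\<lambda>k. z * z ^ k) sums (z * (1 / (1 - z)))"
    by (intro sums_mult geometric_sums nz)
  then have "(\<lambda>k. Re (z * z ^ k)) sums Re (z * (1 / (1 - z)))"
    by (rule sums_Re)
  then have "(\<lambda>k. 2 * Re (z * z ^ k)) sums (2 * Re (z * (1 / (1 - z))))"
    by (rule sums_mult)
  moreover have "2 * Re (z * z ^ k) = 2 * r ^ Suc k * cos (2 * pi * Suc k * t)" for k
  proof -
    have "z * z ^ k = z ^ Suc k" by simp
    also have "\<dots> = of_real (r ^ Suc k) * cis (real (Suc k) * (2 * pi * t))"
      unfolding z_def power_mult_distrib Complex.DeMoivre of_real_power ..
    finally have "z * z ^ k = of_real (r ^ Suc k) * cis (real (Suc k) * (2 * pi * t))" .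
    then show ?thesis by (simp add: mult_ac del: power_Suc)
  qed
  moreover have "2 * Re (z * (1 / (1 - z))) = poisson_kernel r t - 1"
  proof -
    define c where "c = cos (2 * pi * t)"
    define s where "s = sin (2 * pi * t)"
    have cs: "c\<^sup>2 + s\<^sup>2 = 1" by (simp add: c_def s_def)
    have re: "Re z = r * c" "Im z = r * s" by (simp_all add: z_def c_def s_def)
    have den: "(1 - r * c)\<^sup>2 + (r * s)\<^sup>2 = 1 - 2 * r * c + r\<^sup>2"
      using cs by algebra
    have c2: "c = 1 - 2 * (sin (pi * t))\<^sup>2"
      using cos_double_sin[of "pi * t"] by (simp add: c_def mult_ac)
    have den2: "(1 - r)\<^sup>2 + 4 * r * (sin (pi * t))\<^sup>2 = 1 - 2 * r * c + r\<^sup>2"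
      unfolding c2 by algebra
    have pos: "1 - 2 * r * c + r\<^sup>2 > 0"
      unfolding den2[symmetric] using r by (intro add_pos_nonneg) auto
    have "Re (z * (1 / (1 - z))) = (r * c * (1 - r * c) - r * s * (r * s)) / ((1 - r * c)\<^sup>2 + (r * s)\<^sup>2)"
      by (simp add: Re_divide re)
    also have "\<dots> = (r * c - r\<^sup>2) / (1 - 2 * r * c + r\<^sup>2)"
    proof -
      have "r * c * (1 - r * c) - r * s * (r * s) = r * c - r\<^sup>2" using cs by algebra
      then show ?thesis by (simp add: den)
    qed
    finally show ?thesis unfolding poisson_kernel_def den2 using pos
      by (simp add: field_simps)
  qed
  ultimately show ?thesis by simp
qed

text \<open>
  Testing a function against the Poisson kernel gives the Abel means of its
  cosine coefficients at the integer frequencies.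
\<close>
lemma integral_poisson_kernel_sums:
  fixes f :: "real \<Rightarrow> real"
  assumes r: "0 < r" "r < 1" and f: "integrable lborel f"
  shows "(\<lambda>k. 2 * r ^ Suc k * (LINT t|lborel. f t * cos (2 * pi * Suc k * t)))
    sums ((LINT t|lborel. f t * poisson_kernel r t) - (LINT t|lborel. f t))"
proof -
  note [measurable] = borel_measurable_integrable[OF f]
  define g where "g = (\<lambda>k t. f t * (2 * r ^ Suc k * cos (2 * pi * Suc k * t)))"
  have ng: "norm (g k t) \<le> 2 * r ^ Suc k * norm (f t)" for k t
  proof -
    have "norm (f t) * (2 * r ^ Suc k * norm (cos (2 * pi * Suc k * t))) \<le> norm (f t) * (2 * r ^ Suc k * 1)"
      using r by (intro mult_left_mono) auto
    then show ?thesis using r by (simp add: g_def abs_mult mult_ac)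
  qed
  have ig: "integrable lborel (g k)" for k
    by (rule Bochner_Integration.integrable_bound[where f = "\<lambda>t. 2 * r ^ Suc k * norm (f t)"])
       (use r f ng[of k] in \<open>auto simp: g_def abs_mult\<close>)
  have sr: "summable (\<lambda>k. 2 * r ^ Suc k * C)" for C
    using r by (intro summable_mult2 summable_mult summable_Suc_iff[THEN iffD2] summable_geometric) auto
  have "(\<lambda>k. integral\<^sup>L lborel (g k)) sums (LINT t|lborel. (\<Sum>k. g k t))"
  proof (rule sums_integral)
    show "AE t in lborel. summable (\<lambda>k. norm (g k t))"
      by (intro AE_I2 summable_comparison_test[OF _ sr]) (use ng in auto)
    have "norm (LINT t|lborel. norm (g k t)) \<le> 2 * r ^ Suc k * (LINT t|lborel. norm (f t))" for k
    proof -
      have "(LINT t|lborel. norm (g k t)) \<le> (LINT t|lborel. 2 * r ^ Suc k * norm (f t))"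
        using ig f by (intro integral_mono integrable_mult_right integrable_norm ng) auto
      then show ?thesis by simp
    qed
    then show "summable (\<lambda>k. LINT t|lborel. norm (g k t))"
      by (intro summable_comparison_test[OF _ sr]) blast
  qed (rule ig)
  moreover have "(\<Sum>k. g k t) = f t * poisson_kernel r t - f t" for t
    using sums_mult[OF poisson_kernel_sums[OF r], of "f t" t]
    unfolding g_def by (simp add: sums_iff right_diff_distrib)
  moreover have "(LINT t|lborel. f t * poisson_kernel r t - f t) =
     (LINT t|lborel. f t * poisson_kernel r t) - (LINT t|lborel. f t)"
  proof (rule Bochner_Integration.integral_diff[OF _ f])
    show "integrable lborel (\<lambda>t. f t * poisson_kernel r t)"
    proof (rule Bochner_Integration.integrable_bound[where f = "\<lambda>t. ((1 - r\<^sup>2) / (1 - r)\<^sup>2) * norm (f t)"])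
      show "AE t in lborel. norm (f t * poisson_kernel r t) \<le> norm ((1 - r\<^sup>2) / (1 - r)\<^sup>2 * norm (f t))"
      proof (rule AE_I2)
        fix t
        have "r\<^sup>2 \<le> 1" using r by (simp add: power_le_one)
        then have "\<bar>poisson_kernel r t\<bar> \<le> (1 - r\<^sup>2) / (1 - r)\<^sup>2"
          using r unfolding poisson_kernel_def by (auto simp: abs_mult intro!: divide_left_mono mult_pos_pos add_pos_nonneg)
        then have "\<bar>f t\<bar> * \<bar>poisson_kernel r t\<bar> \<le> \<bar>f t\<bar> * ((1 - r\<^sup>2) / (1 - r)\<^sup>2)"
          by (rule mult_left_mono) simp
        then show "norm (f t * poisson_kernel r t) \<le> norm ((1 - r\<^sup>2) / (1 - r)\<^sup>2 * norm (f t))"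
          using \<open>r\<^sup>2 \<le> 1\<close> by (simp add: abs_mult mult_ac)
      qed
    qed (use f in auto)
  qed
  moreover have "integral\<^sup>L lborel (g k) = 2 * r ^ Suc k * (LINT t|lborel. f t * cos (2 * pi * Suc k * t))" for k
    by (subst integral_mult_right_zero[symmetric], rule Bochner_Integration.integral_cong)
       (simp_all add: g_def mult_ac)
  ultimately show ?thesis by simp
qed

text \<open>
  By the inequality between arithmetic and geometric means, \<open>2 * (1 - r) * \<bar>s\<bar>\<close> is at most
  \<open>(1 - r)\<^sup>2 + s\<^sup>2\<close>. Hence a function that vanishes to first order at the integers has a bounded product
  with the kernel, uniformly in \<open>r\<close>. This supplies the dominating function in the limit \<open>r \<rightarrow> 1\<close>.
\<close>
lemma poisson_kernel_sin_le:
  assumes "1/2 \<le> r" "r < 1"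
  shows "0 \<le> poisson_kernel r t" "poisson_kernel r t * \<bar>sin (pi * t)\<bar> \<le> 1"
proof -
  define s where "s = \<bar>sin (pi * t)\<bar>"
  have s: "0 \<le> s" "(sin (pi * t))\<^sup>2 = s\<^sup>2" by (auto simp: s_def)
  have pos: "(1 - r)\<^sup>2 + 4 * r * s\<^sup>2 > 0" using assms by (intro add_pos_nonneg) auto
  have r2: "r\<^sup>2 \<le> 1" using assms by (simp add: power_le_one)
  then show "0 \<le> poisson_kernel r t" using pos unfolding poisson_kernel_def s by simp
  have "(1 - r\<^sup>2) * s = (1 - r) * s * (1 + r)" by algebra
  also have "\<dots> \<le> (1 - r) * s * 2" using assms s by (intro mult_left_mono) auto
  also have "\<dots> \<le> (1 - r)\<^sup>2 + s\<^sup>2" using sum_squares_bound[of "1 - r" s] by (simp add: mult_ac)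
  also have "\<dots> \<le> (1 - r)\<^sup>2 + 4 * r * s\<^sup>2"
    using assms mult_right_mono[of 1 "4 * r" "s\<^sup>2"] by simp
  finally show "poisson_kernel r t * \<bar>sin (pi * t)\<bar> \<le> 1"
    using pos unfolding poisson_kernel_def s s_def[symmetric] by simp
qed

lemma abs_le_abs_sin_pi:
  fixes s :: real
  assumes "\<bar>s\<bar> \<le> 1/2"
  shows "\<bar>s\<bar> \<le> \<bar>sin (pi * s)\<bar>"
proof -
  have *: "s \<le> sin (pi * s)" if s: "0 \<le> s" "s \<le> 1/2" for s :: real
  proof -
    define y where "y = pi * s"
    have y: "0 \<le> y" "y \<le> 2" using s pi_less_4 by (auto simp: y_def intro: order.trans[OF mult_mono[of pi 4 s "1/2"]])
    have "\<bar>sin y - y\<bar> \<le> y ^ 3 / 6"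
      using Maclaurin_sin_bound[of y 3] y by (simp add: eval_nat_numeral sin_coeff_def fact_numeral)
    then have "y - y ^ 3 / 6 \<le> sin y" by linarith
    moreover have "y ^ 3 \<le> 4 * y"
      using mult_right_mono[OF power_mono[OF y(2,1), of 2] y(1)] by (simp add: eval_nat_numeral)
    ultimately have "y / 3 \<le> sin y" by linarith
    moreover have "s \<le> y / 3" using mult_right_mono[of 3 pi s] s pi_gt3 by (simp add: y_def)
    ultimately show ?thesis by (simp add: y_def)
  qed
  show ?thesis
  proof (cases "s \<ge> 0")
    case True
    then show ?thesis using *[of s] assms by linarith
  next
    case False
    then show ?thesis using *[of "-s"] assms by auto
  qed
qed

text \<open>
  A Lipschitz estimate for the Gaussian with an integrable constant. The derivative at \<open>\<xi>\<close> is
  bounded through \<open>\<xi> \<le> exp \<xi>\<close> and completing the square in \<open>2 * \<xi> - pi * x * \<xi>\<^sup>2\<close>; the factor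
  \<open>exp 1\<close> more than pays for the distance at most \<open>1/2\<close> between \<open>\<xi>\<close> and \<open>t\<close>.
\<close>
lemma exp_minus_square_lipschitz:
  fixes x t n :: real
  assumes x: "x > 0" and tn: "0 \<le> t" "0 \<le> n" "\<bar>t - n\<bar> \<le> 1/2"
  shows "\<bar>exp (- pi * x * t\<^sup>2) - exp (- pi * x * n\<^sup>2)\<bar>
           \<le> 2 * pi * x * exp (1 / (pi * x) + 1) * exp (- t) * \<bar>t - n\<bar>"
proof -
  define f where "f = (\<lambda>t. exp (- pi * x * t\<^sup>2))"
  define f' where "f' = (\<lambda>t. - 2 * pi * x * t * exp (- pi * x * t\<^sup>2))"
  have d: "(f has_real_derivative f' \<xi>) (at \<xi> within A)" for \<xi> A
    unfolding f_def f'_def by (auto intro!: derivative_eq_intros)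
  have bound: "\<bar>f' \<xi>\<bar> \<le> 2 * pi * x * exp (1 / (pi * x) + 1) * exp (- t)"
    if \<xi>: "0 \<le> \<xi>" "t - 1/2 \<le> \<xi>" for \<xi>
  proof -
    have "2 * \<xi> - pi * x * \<xi>\<^sup>2 \<le> 1 / (pi * x)"
    proof -
      have "0 \<le> (pi * x * \<xi> - 1)\<^sup>2" by simp
      then have "2 * (pi * x) * \<xi> - (pi * x)\<^sup>2 * \<xi>\<^sup>2 \<le> 1" by (simp add: power2_diff power_mult_distrib)
      then have "(pi * x) * (2 * \<xi> - pi * x * \<xi>\<^sup>2) \<le> 1" by (simp add: power2_eq_square algebra_simps)
      then show ?thesis using x by (simp add: field_simps)
    qed
    then have "\<xi> - pi * x * \<xi>\<^sup>2 \<le> 1 / (pi * x) + 1 - t" using \<xi> by linarith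
    then have "exp \<xi> * exp (- pi * x * \<xi>\<^sup>2) \<le> exp (1 / (pi * x) + 1) * exp (- t)"
      by (simp flip: exp_add)
    moreover have "\<xi> * exp (- pi * x * \<xi>\<^sup>2) \<le> exp \<xi> * exp (- pi * x * \<xi>\<^sup>2)"
      using exp_ge_add_one_self[of \<xi>] by (intro mult_right_mono) (linarith, simp)
    ultimately have "\<xi> * exp (- pi * x * \<xi>\<^sup>2) \<le> exp (1 / (pi * x) + 1) * exp (- t)" by linarith
    then have "2 * pi * x * (\<xi> * exp (- pi * x * \<xi>\<^sup>2)) \<le> 2 * pi * x * (exp (1 / (pi * x) + 1) * exp (- t))"
      using x by (intro mult_left_mono) auto
    then show ?thesis using \<xi> x by (simp add: f'_def abs_mult mult_ac)
  qed
  have "norm (f t - f n) \<le> (2 * pi * x * exp (1 / (pi * x) + 1) * exp (- t)) * norm (t - n)"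
  proof (rule field_differentiable_bound)
    show "convex {max 0 (t - 1/2)..}" by (rule convex_real_interval)
    show "(f has_field_derivative f' z) (at z within {max 0 (t - 1/2)..})" for z by (rule d)
    show "norm (f' z) \<le> 2 * pi * x * exp (1 / (pi * x) + 1) * exp (- t)"
      if "z \<in> {max 0 (t - 1/2)..}" for z using bound that by simp
    have "t - 1/2 \<le> n" using tn by linarith
    then show "t \<in> {max 0 (t - 1/2)..}" "n \<in> {max 0 (t - 1/2)..}" using tn by auto
  qed
  then show ?thesis by (simp add: f_def)
qed


text \<open>
  Half of \<open>theta x - 1\<close>: the index \<open>n\<close> stands for the integer \<open>Suc n\<close>.
\<close>
definition theta_tail :: "real \<Rightarrow> real" where
  "theta_tail x = (\<Sum>n. exp (- pi * x * (real (Suc n))\<^sup>2))"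

lemma summable_theta_tail:
  assumes "x > 0"
  shows "summable (\<lambda>n. exp (- pi * x * (real (Suc n))\<^sup>2))"
proof (rule summable_comparison_test)
  have "pi * x > 0" using assms by simp
  then show "summable (\<lambda>n. exp (- (pi * x)) ^ n)" by (intro summable_geometric) simp
  have "norm (exp (- pi * x * (real (Suc n))\<^sup>2)) \<le> exp (- (pi * x)) ^ n" for n
  proof -
    have "real n \<le> (real (Suc n))\<^sup>2" by (simp add: power2_eq_square algebra_simps)
    from mult_left_mono[OF this, of "pi * x"] \<open>pi * x > 0\<close> show ?thesis
      by (simp add: mult_ac del: of_nat_Suc flip: exp_of_nat_mult)
  qed
  then show "\<exists>N. \<forall>n\<ge>N. norm (exp (- pi * x * (real (Suc n))\<^sup>2)) \<le> exp (- (pi * x)) ^ n" by blast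
qed

lemma theta_eq_tail:
  assumes "x > 0"
  shows "theta x = 1 + 2 * theta_tail x"
proof -
  define f where "f = (\<lambda>k::int. exp (- pi * (of_int k)\<^sup>2 * x))"
  have s: "((\<lambda>n. exp (- pi * x * (real (Suc n))\<^sup>2)) has_sum theta_tail x) UNIV"
    using summable_theta_tail[OF assms] unfolding theta_tail_def
    by (intro sums_nonneg_imp_has_sum summable_sums) auto
  have "(f has_sum theta_tail x) ((\<lambda>n. int (Suc n)) ` UNIV)"
    by (subst has_sum_reindex) (use s in \<open>auto simp: f_def o_def inj_on_def mult_ac\<close>)
  moreover have "(\<lambda>n. int (Suc n)) ` UNIV = {1..}"
  proof -
    have "k \<in> range (\<lambda>n. int (Suc n))" if "k \<ge> 1" for k :: int
      using that by (intro image_eqI[of _ _ "nat (k - 1)"]) auto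
    then show ?thesis by auto
  qed
  ultimately have 1: "(f has_sum theta_tail x) {1..}" by simp
  have "(f has_sum theta_tail x) ((\<lambda>n. - int (Suc n)) ` UNIV)"
    by (subst has_sum_reindex) (use s in \<open>auto simp: f_def o_def inj_on_def mult_ac power2_eq_square algebra_simps\<close>)
  moreover have "(\<lambda>n. - int (Suc n)) ` UNIV = {..-1}"
  proof -
    have "(\<lambda>n. - int (Suc n)) ` UNIV = uminus ` ((\<lambda>n. int (Suc n)) ` UNIV)"
      by (simp add: image_image)
    then show ?thesis using \<open>(\<lambda>n. int (Suc n)) ` UNIV = {1..}\<close> by simp
  qed
  ultimately have 2: "(f has_sum theta_tail x) {..-1}" by simp
  have 3: "(f has_sum 1) {0}" using has_sum_finite[of "{0}" f] by (simp add: f_def)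
  have "(f has_sum (theta_tail x + theta_tail x)) ({1..} \<union> {..-1})"
    by (rule has_sum_Un_disjoint[OF 1 2]) auto
  then have "(f has_sum (theta_tail x + theta_tail x + 1)) (({1..} \<union> {..-1}) \<union> {0})"
    by (rule has_sum_Un_disjoint[OF _ 3]) auto
  moreover have "({1..} \<union> {..-1}) \<union> {0} = (UNIV :: int set)" by auto
  ultimately show ?thesis
    unfolding theta_def using infsumI by (fastforce simp: f_def)
qed

lemma has_bochner_integral_cos_interval:
  fixes a b c :: real
  assumes "a \<le> b"
  shows "has_bochner_integral lborel (\<lambda>t. indicator {a..<b} t * cos (c * t))
           (if c = 0 then b - a else (sin (c * b) - sin (c * a)) / c)"
proof -
  define F where "F = (\<lambda>t. if c = 0 then t else sin (c * t) / c)"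
  have "has_bochner_integral lborel (\<lambda>t. cos (c * t) * indicator {a..b} t) (F b - F a)"
  proof (rule has_bochner_integral_FTC_Icc_real[OF assms])
    show "(F has_real_derivative cos (c * t)) (at t)" for t
      by (cases "c = 0") (auto simp: F_def intro!: derivative_eq_intros)
  qed (auto intro!: continuous_intros)
  moreover have "AE t in lborel. indicator {a..<b} t * cos (c * t) = cos (c * t) * indicator {a..b} t"
    using AE_lborel_singleton[of b] by eventually_elim (auto split: split_indicator)
  ultimately have "has_bochner_integral lborel (\<lambda>t. indicator {a..<b} t * cos (c * t)) (F b - F a)"
    by (subst has_bochner_integral_cong_AE) auto
  then show ?thesis by (simp add: F_def diff_divide_distrib split: if_splits)
qed

lemma has_bochner_integral_half_line_even:
  fixes f :: "real \<Rightarrow> real"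
  assumes f: "has_bochner_integral lborel f I" and even: "\<And>t. f (- t) = f t"
  shows "has_bochner_integral lborel (\<lambda>t. indicator {0..} t * f t) (I / 2)"
proof -
  have int: "integrable lborel f" using f by (simp add: has_bochner_integral_iff)
  have i: "integrable lborel (\<lambda>t. indicator {0..} t * f t)"
    using integrable_mult_indicator[of "{0..}" lborel f] int by simp
  have i': "integrable lborel (\<lambda>t. indicator {..<0} t * f t)"
    using integrable_mult_indicator[of "{..<0}" lborel f] int by simp
  have "(LINT t|lborel. indicator {..<0} t * f t) = (LINT t|lborel. indicator {0<..} t * f t)"
    by (subst lborel_integral_real_affine[where c="-1" and t=0])
       (auto simp: even intro!: Bochner_Integration.integral_cong split: split_indicator)
  also have "\<dots> = (LINT t|lborel. indicator {0..} t * f t)"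
  proof (rule integral_cong_AE)
    show "AE t in lborel. indicator {0<..} t * f t = indicator {0..} t * f t"
      using AE_lborel_singleton[of 0] by eventually_elim (auto split: split_indicator)
  qed (use int in \<open>auto intro!: borel_measurable_times\<close>)
  finally have "(LINT t|lborel. indicator {..<0} t * f t) = (LINT t|lborel. indicator {0..} t * f t)" .
  moreover have "I = (LINT t|lborel. indicator {..<0} t * f t + indicator {0..} t * f t)"
    unfolding has_bochner_integral_integral_eq[OF f, symmetric]
    by (rule Bochner_Integration.integral_cong) (auto split: split_indicator)
  ultimately show ?thesis using i i' by (simp add: has_bochner_integral_iff)
qed

lemma nearest_nat_iff:
  fixes t :: real
  assumes "t \<ge> 0"
  shows "nat \<lfloor>t + 1/2\<rfloor> = n \<longleftrightarrow> t \<in> {(if n = 0 then 0 else real n - 1/2)..<real n + 1/2}"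
proof -
  have "nat \<lfloor>t + 1/2\<rfloor> = n \<longleftrightarrow> \<lfloor>t + 1/2\<rfloor> = int n" using assms by auto
  also have "\<dots> \<longleftrightarrow> real n \<le> t + 1/2 \<and> t + 1/2 < real n + 1"
    by (simp add: floor_eq_iff)
  also have "\<dots> \<longleftrightarrow> t \<in> {(if n = 0 then 0 else real n - 1/2)..<real n + 1/2}"
    using assms by auto
  finally show ?thesis .
qed

text \<open>
  The step function that takes the value of the Gaussian at the nearest integer has vanishing cosine
  coefficients at all nonzero integer frequencies, since the cosine has mean zero over each unit interval centred at a
  positive integer and over \<open>[0, 1/2]\<close>. Its integral is half of the theta series. On the half-line the
  point 0 owns an interval of length \<open>1/2\<close> only.
\<close>
lemma step_gaussian_cos_integral:
  fixes x :: real and k :: nat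
  assumes x: "x > 0"
  defines "\<phi> \<equiv> (\<lambda>t. exp (- pi * x * t\<^sup>2))"
  shows "has_bochner_integral lborel
     (\<lambda>t. indicator {0..} t * \<phi> (real (nat \<lfloor>t + 1/2\<rfloor>)) * cos (2 * pi * k * t))
     (if k = 0 then 1/2 + theta_tail x else 0)"
proof -
  define S where "S = (\<lambda>n. {(if n = 0 then 0 else real n - 1/2)..<real n + 1/2})"
  define g where "g = (\<lambda>n t. \<phi> (real n) * (indicator (S n) t * cos (2 * pi * k * t)))"
  define w where "w = (\<lambda>n::nat. if n = 0 then 1/2 else 1 :: real)"
  have hS: "has_bochner_integral lborel (\<lambda>t. indicator (S n) t * cos (2 * pi * real k * t))
      (if k = 0 then w n else 0)" for n k
  proof -
    have *: "sin (2 * pi * real k * (real n + 1/2)) = 0"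
      using sin_npi[of "k * (2 * n + 1)"] by (simp add: algebra_simps)
    have **: "sin (2 * pi * real k * (if n = 0 then 0 else real n - 1/2)) = 0"
    proof (cases n)
      case (Suc m)
      then show ?thesis using sin_npi[of "k * (2 * m + 1)"] by (simp add: algebra_simps)
    qed auto
    show ?thesis
      using has_bochner_integral_cos_interval[of "if n = 0 then 0 else real n - 1/2" "real n + 1/2" "2 * pi * real k"]
      unfolding S_def by (cases "k = 0"; cases "n = 0") (use * ** in \<open>auto simp: w_def\<close>)
  qed
  have sums_w: "(\<lambda>n. \<phi> (real n) * w n) sums (1/2 + theta_tail x)"
  proof -
    have "(\<lambda>n. \<phi> (real (Suc n)) * w (Suc n)) sums theta_tail x"
      using summable_sums[OF summable_theta_tail[OF x]] by (simp add: \<phi>_def w_def theta_tail_def)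
    from sums_Suc_imp[OF _ this] sums_Suc[OF this] show ?thesis by (simp add: \<phi>_def w_def add.commute)
  qed
  have g: "has_bochner_integral lborel (g n) (\<phi> (real n) * (if k = 0 then w n else 0))" for n
    unfolding g_def by (intro has_bochner_integral_mult_right hS)
  have near: "nat \<lfloor>t + 1/2\<rfloor> = n \<longleftrightarrow> t \<in> S n" if "t \<ge> 0" for t n
    using nearest_nat_iff[OF that, of n] by (simp only: S_def)
  have gs: "(\<lambda>n. g n t) sums (indicator {0..} t * \<phi> (real (nat \<lfloor>t + 1/2\<rfloor>)) * cos (2 * pi * k * t))" for t
  proof (cases "t \<ge> 0")
    case True
    have "g n t = (if n = nat \<lfloor>t + 1/2\<rfloor> then \<phi> (real n) * cos (2 * pi * k * t) else 0)" for n
      using near[OF True, of n] by (auto simp: g_def)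
    then show ?thesis using True sums_single[of "nat \<lfloor>t + 1/2\<rfloor>" "\<lambda>n. \<phi> (real n) * cos (2 * pi * k * t)"]
      by simp
  next
    case False
    have "g n t = 0" for n using False by (auto simp: g_def S_def indicator_def)
    then show ?thesis using False by simp
  qed
  have ng: "norm (g n t) \<le> \<phi> (real n) * (indicator (S n) t * cos (2 * pi * real 0 * t))" for n t
    by (auto simp: g_def \<phi>_def abs_mult split: split_indicator)
  have A: "AE t in lborel. summable (\<lambda>n. norm (g n t))"
  proof (rule AE_I2)
    fix t :: real
    have "finite {n. g n t \<noteq> 0}"
    proof (rule finite_subset)
      show "{n. g n t \<noteq> 0} \<subseteq> {nat \<lfloor>t + 1/2\<rfloor>}"
      proof (cases "t \<ge> 0")
        case True
        then show ?thesis using near[OF True, symmetric] by (auto simp: g_def indicator_def)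
      qed (auto simp: g_def S_def indicator_def)
    qed simp
    then show "summable (\<lambda>n. norm (g n t))" by (intro summable_finite[of "{n. g n t \<noteq> 0}"]) auto
  qed
  have B: "summable (\<lambda>n. LINT t|lborel. norm (g n t))"
  proof (rule summable_comparison_test)
    show "summable (\<lambda>n. \<phi> (real n) * w n)" using sums_w by (rule sums_summable)
    have "norm (LINT t|lborel. norm (g n t)) \<le> \<phi> (real n) * w n" for n
    proof -
      have "(LINT t|lborel. norm (g n t)) \<le> (LINT t|lborel. \<phi> (real n) * (indicator (S n) t * cos (2 * pi * real 0 * t)))"
        using g[of n] hS[of n 0] ng[of n]
        by (intro integral_mono integrable_norm integrable_mult_right) (auto simp: has_bochner_integral_iff)
      also have "\<dots> = \<phi> (real n) * w n"
        using has_bochner_integral_integral_eq[OF hS[of n 0]] by simp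
      finally show ?thesis by simp
    qed
    then show "\<exists>N. \<forall>n\<ge>N. norm (LINT t|lborel. norm (g n t)) \<le> \<phi> (real n) * w n" by blast
  qed
  have "integrable lborel (g n)" for n using g[of n] by (simp add: has_bochner_integral_iff)
  note * = integrable_suminf[OF this A B] sums_integral[OF this A B]
  have "(\<Sum>n. g n t) = indicator {0..} t * \<phi> (real (nat \<lfloor>t + 1/2\<rfloor>)) * cos (2 * pi * k * t)" for t
    using gs by (simp add: sums_iff)
  note * = *[unfolded this]
  have "(\<lambda>n. integral\<^sup>L lborel (g n)) sums (if k = 0 then 1/2 + theta_tail x else 0)"
    using has_bochner_integral_integral_eq[OF g] sums_w by simp
  with *(2) have "(LINT t|lborel. indicator {0..} t * \<phi> (real (nat \<lfloor>t + 1/2\<rfloor>)) * cos (2 * pi * k * t)) =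
      (if k = 0 then 1/2 + theta_tail x else 0)"
    by (rule sums_unique2)
  with *(1) show ?thesis unfolding has_bochner_integral_iff by blast
qed

text \<open>
  Jacobi's identity \<open>theta (1 / x) = sqrt x * theta x\<close>. Let \<open>f\<close> be the Gaussian minus its
  nearest-integer step function, on the half-line. It vanishes at the integers, so its integral against the Poisson kernel tends
  to 0 as \<open>r \<rightarrow> 1\<close>. The same integral is the Abel mean of the cosine coefficients of \<open>f\<close>. At nonzero frequencies
  only the Gaussian contributes, by terms of the series at \<open>1 / x\<close>; at frequency zero the step function contributes
  the series at \<open>x\<close>.
\<close>
theorem theta_tail_functional_equation:
  assumes x: "x > 0"
  shows "(1 / 2 + theta_tail (1 / x)) / sqrt x = 1 / 2 + theta_tail x"
proof -
  define \<phi> where "\<phi> = (\<lambda>t::real. exp (- pi * x * t\<^sup>2))"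
  define m where "m = (\<lambda>t::real. real (nat \<lfloor>t + 1/2\<rfloor>))"
  define f where "f = (\<lambda>t. indicator {0..} t * \<phi> t - indicator {0..} t * \<phi> (m t))"
  define c where "c = (\<lambda>k::nat. exp (- pi * (1 / x) * (real k)\<^sup>2) / sqrt x / 2)"
  have gauss: "has_bochner_integral lborel (\<lambda>t. indicator {0..} t * (\<phi> t * cos (2 * pi * k * t))) (c k)" for k :: nat
  proof -
    have "has_bochner_integral lborel (\<lambda>t. Re (exp (- (pi * x) * t\<^sup>2) * iexp (2 * pi * k * t)))
       (Re (sqrt (pi / (pi * x)) * exp (- (2 * pi * k)\<^sup>2 / (4 * (pi * x)))))"
      using gaussian_fourier[of "pi * x" "2 * pi * k"] x
        has_bochner_integral_bounded_linear[OF bounded_linear_Re] by fastforce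
    moreover have "Re (exp (- (pi * x) * t\<^sup>2) * iexp (2 * pi * k * t)) = \<phi> t * cos (2 * pi * k * t)" for t
      by (simp add: \<phi>_def Re_exp)
    moreover have "Re (sqrt (pi / (pi * x)) * exp (- (2 * pi * k)\<^sup>2 / (4 * (pi * x)))) = 2 * c k"
      using x by (simp add: c_def real_sqrt_divide power2_eq_square)
    ultimately have "has_bochner_integral lborel (\<lambda>t. \<phi> t * cos (2 * pi * k * t)) (2 * c k)" by simp
    from has_bochner_integral_half_line_even[OF this] show ?thesis by (simp add: \<phi>_def)
  qed
  \<comment> \<open>Starting at \<open>1/2\<close> stays in the range where \<open>poisson_kernel_sin_le\<close> is uniform.\<close>
  define r where "r = (\<lambda>j::nat. 1 - 1 / (real j + 2))"
  let ?P = "\<lambda>j. LINT t|lborel. f t * poisson_kernel (r j) t"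
  let ?D = "c 0 - (1/2 + theta_tail x)"
  have fk: "has_bochner_integral lborel (\<lambda>t. f t * cos (2 * pi * k * t))
      (c k - (if k = 0 then 1/2 + theta_tail x else 0))" for k :: nat
    using has_bochner_integral_diff[OF gauss[of k] step_gaussian_cos_integral[OF x, of k]]
    by (simp add: f_def \<phi>_def m_def algebra_simps)
  have f0: "has_bochner_integral lborel f ?D" using fk[of 0] by simp
  have fi: "integrable lborel f" using f0 by (simp add: has_bochner_integral_iff)
  note [measurable] = borel_measurable_integrable[OF fi]
  have r: "1/2 \<le> r j" "r j < 1" "0 < r j" for j by (auto simp: r_def field_simps)
  have r1: "r \<longlonglongrightarrow> 1" unfolding r_def by real_asymp
  define C where "C = 2 * pi * x * exp (1 / (pi * x) + 1)"
  have C: "C \<ge> 0" using x by (simp add: C_def)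
  have mt: "\<bar>t - m t\<bar> \<le> 1/2" "\<bar>t - m t\<bar> \<le> \<bar>sin (pi * t)\<bar>" if "t \<ge> 0" for t
  proof -
    show 1: "\<bar>t - m t\<bar> \<le> 1/2"
    proof -
      have "m t = of_int \<lfloor>t + 1/2\<rfloor>" using that by (simp add: m_def)
      with floor_correct[of "t + 1/2"] show ?thesis by (simp only: of_int_add of_int_1) linarith
    qed
    have "\<bar>sin (pi * (t - m t))\<bar> = \<bar>sin (pi * t)\<bar>"
      by (simp add: right_diff_distrib sin_diff m_def mult.commute[of pi "real n" for n] abs_mult)
    then show "\<bar>t - m t\<bar> \<le> \<bar>sin (pi * t)\<bar>" using abs_le_abs_sin_pi[OF 1] by simp
  qed
  have lim: "(\<lambda>j. LINT t|lborel. f t * poisson_kernel (r j) t) \<longlonglongrightarrow> (LINT t::real|lborel. 0)"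
  proof (rule integral_dominated_convergence)
    show "integrable lborel (\<lambda>t::real. C * exp (- 1 * \<bar>t\<bar>))"
      by (intro integrable_mult_right integrable_exp_minus_abs) simp
    show "AE t in lborel. norm (f t * poisson_kernel (r j) t) \<le> C * exp (- 1 * \<bar>t\<bar>)" for j
    proof (rule AE_I2)
      fix t :: real
      show "norm (f t * poisson_kernel (r j) t) \<le> C * exp (- 1 * \<bar>t\<bar>)"
      proof (cases "t \<ge> 0")
        case True
        note P = poisson_kernel_sin_le[OF r(1,2), of j t]
        have "\<bar>f t\<bar> \<le> C * exp (- t) * \<bar>t - m t\<bar>"
          using exp_minus_square_lipschitz[OF x True _ mt(1)[OF True]] True
          by (simp add: f_def \<phi>_def C_def m_def)
        then have "norm (f t * poisson_kernel (r j) t) \<le> C * exp (- t) * \<bar>t - m t\<bar> * poisson_kernel (r j) t"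
          using P(1) by (simp add: abs_mult mult_right_mono)
        also have "\<dots> \<le> C * exp (- t) * \<bar>sin (pi * t)\<bar> * poisson_kernel (r j) t"
          using C P(1) mt(2)[OF True] by (intro mult_right_mono mult_left_mono) auto
        also have "\<dots> = C * exp (- t) * (poisson_kernel (r j) t * \<bar>sin (pi * t)\<bar>)" by simp
        also have "\<dots> \<le> C * exp (- t) * 1"
          using C P(2) by (intro mult_left_mono) auto
        finally show ?thesis using True by simp
      qed (use C in \<open>simp add: f_def\<close>)
    qed
    show "AE t in lborel. (\<lambda>j. f t * poisson_kernel (r j) t) \<longlonglongrightarrow> 0"
    proof (rule AE_I2)
      fix t :: real
      show "(\<lambda>j. f t * poisson_kernel (r j) t) \<longlonglongrightarrow> 0"
      proof (cases "t \<ge> 0 \<and> t \<noteq> m t")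
        case True
        then have "sin (pi * t) \<noteq> 0" using mt(2)[of t] by auto
        then have "(\<lambda>j. f t * ((1 - (r j)\<^sup>2) / ((1 - r j)\<^sup>2 + 4 * r j * (sin (pi * t))\<^sup>2)))
           \<longlonglongrightarrow> f t * ((1 - 1\<^sup>2) / ((1 - 1)\<^sup>2 + 4 * 1 * (sin (pi * t))\<^sup>2))"
          by (intro tendsto_intros r1) auto
        then show ?thesis by (simp add: poisson_kernel_def)
      next
        case False
        then have "f t = 0" by (auto simp: f_def indicator_def)
        then show ?thesis by simp
      qed
    qed
  qed measurable
  have sums: "(\<lambda>k. 2 * r j ^ Suc k * c (Suc k)) sums
     (?P j - ?D)" for j
    using integral_poisson_kernel_sums[OF r(3) r(2) fi, of j]
    by (simp only: has_bochner_integral_integral_eq[OF fk] has_bochner_integral_integral_eq[OF f0] nat.simps if_False diff_zero)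
  have sc: "summable (\<lambda>k. 2 * c (Suc k))"
    unfolding c_def using summable_theta_tail[of "1 / x"] x by (intro summable_mult summable_divide) auto
  have "(\<lambda>j. \<Sum>k. 2 * r j ^ Suc k * c (Suc k)) \<longlonglongrightarrow> (\<Sum>k. 2 * c (Suc k))"
  proof (rule tannerys_theorem[THEN conjunct2, THEN conjunct2])
    show "(\<lambda>j. 2 * r j ^ Suc k * c (Suc k)) \<longlonglongrightarrow> 2 * c (Suc k)" for k
    proof -
      have "(\<lambda>j. 2 * r j ^ Suc k * c (Suc k)) \<longlonglongrightarrow> 2 * 1 ^ Suc k * c (Suc k)"
        by (intro tendsto_intros r1)
      then show ?thesis by simp
    qed
    have "norm (2 * r j ^ Suc k * c (Suc k)) \<le> 2 * c (Suc k)" for k j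
    proof -
      have "r j ^ Suc k \<le> 1" "0 \<le> r j ^ Suc k" using r[of j] by (auto intro: power_le_one less_imp_le simp del: power_Suc)
      moreover have "c (Suc k) \<ge> 0" using x by (simp add: c_def)
      ultimately show ?thesis by (simp add: abs_mult mult_left_le_one_le del: power_Suc)
    qed
    then show "\<forall>\<^sub>F (k, j) in sequentially \<times>\<^sub>F sequentially. norm (2 * r j ^ Suc k * c (Suc k)) \<le> 2 * c (Suc k)"
      by (intro always_eventually) auto
  qed (use sc in auto)
  moreover have "(\<lambda>j. \<Sum>k. 2 * r j ^ Suc k * c (Suc k)) \<longlonglongrightarrow> 0 - ?D"
  proof -
    have "(\<Sum>k. 2 * r j ^ Suc k * c (Suc k)) = ?P j - ?D" for j
      using sums[of j] by (simp add: sums_iff)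
    moreover have "(\<lambda>j. ?P j - ?D) \<longlonglongrightarrow> 0 - ?D"
      using lim by (intro tendsto_diff tendsto_const) simp
    ultimately show ?thesis by simp
  qed
  ultimately have "(\<Sum>k. 2 * c (Suc k)) = 0 - ?D" by (rule LIMSEQ_unique)
  moreover have "(\<Sum>k. 2 * c (Suc k)) = theta_tail (1 / x) / sqrt x"
  proof -
    have "(\<Sum>k. 2 * c (Suc k)) = (\<Sum>k. exp (- pi * (1 / x) * (real (Suc k))\<^sup>2) / sqrt x)"
      by (simp add: c_def del: of_nat_Suc)
    also have "\<dots> = theta_tail (1 / x) / sqrt x"
      unfolding theta_tail_def using summable_theta_tail[of "1 / x"] x by (intro suminf_divide) auto
    finally show ?thesis .
  qed
  moreover have "c 0 = 1 / 2 / sqrt x" by (simp add: c_def)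
  ultimately show ?thesis by (simp add: add_divide_distrib)
qed


section \<open>Integrals over the half-line in the variable ln a\<close>

lemma range_exp_real: "range exp = {0 :: real <..}"
  by (auto simp: image_iff) (metis exp_ln)

text \<open>
  The substitution \<open>a = exp u\<close>, which turns the multiplicative measure \<open>da / a\<close> into Lebesgue measure on the line.
\<close>
lemma exp_substitution:
  fixes f :: "real \<Rightarrow> real"
  assumes [measurable]: "f \<in> borel_measurable borel"
    and int: "integrable lborel (\<lambda>u. exp u * f (exp u))"
  shows "set_integrable lborel {0<..} f"
    and "(LINT a:{0<..}|lborel. f a) = (LINT u|lborel. exp u * f (exp u))"
proof -
  have int': "(\<lambda>u. exp u * f (exp u)) absolutely_integrable_on UNIV"
    using int by (simp add: set_integrable_def integrable_completion)
  have "f absolutely_integrable_on (exp ` UNIV) \<and> integral (exp ` UNIV) f = integral UNIV (\<lambda>u. exp u * f (exp u))"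
    using has_absolute_integral_change_of_variables_1'[of UNIV exp exp f "integral UNIV (\<lambda>u. exp u * f (exp u))"] int'
    by (auto intro: DERIV_exp simp: inj_on_def)
  then have f: "f absolutely_integrable_on {0<..}" "integral {0<..} f = integral UNIV (\<lambda>u. exp u * f (exp u))"
    by (simp_all add: range_exp_real)
  then show si: "set_integrable lborel {0<..} f"
    by (simp add: set_integrable_def integrable_completion)
  have "(LINT a:{0<..}|lborel. f a) = integral {0<..} f"
    using set_borel_integral_eq_integral(2)[OF si] by simp
  also have "\<dots> = (LINT u:UNIV|lborel. exp u * f (exp u))"
    unfolding f(2) using int by (subst set_borel_integral_eq_integral(2)) (auto simp: set_integrable_def)
  finally show "(LINT a:{0<..}|lborel. f a) = (LINT u|lborel. exp u * f (exp u))"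
    by (simp add: set_lebesgue_integral_def)
qed

lemma exp_substitution_converse:
  fixes f :: "real \<Rightarrow> real"
  assumes [measurable]: "f \<in> borel_measurable borel"
    and f: "f absolutely_integrable_on {0<..}"
  shows "has_bochner_integral lborel (\<lambda>u. exp u * f (exp u)) (integral {0<..} f)"
proof -
  have "(\<lambda>u. exp u * f (exp u)) absolutely_integrable_on UNIV \<and>
      integral UNIV (\<lambda>u. exp u * f (exp u)) = integral {0<..} f"
    using has_absolute_integral_change_of_variables_1'[of UNIV exp exp f "integral {0<..} f"] f
    by (auto intro: DERIV_exp simp: inj_on_def range_exp_real)
  moreover from this have "set_integrable lborel UNIV (\<lambda>u. exp u * f (exp u))"
    by (simp add: set_integrable_def integrable_completion)
  ultimately show ?thesis
    using set_borel_integral_eq_integral(2)[of UNIV "\<lambda>u. exp u * f (exp u)"]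
    by (simp add: has_bochner_integral_iff set_integrable_def set_lebesgue_integral_def)
qed

lemma Gamma_exp_integral:
  assumes z: "Re z > 0"
  shows "has_bochner_integral lborel (\<lambda>v. exp (z * of_real v - of_real (exp v))) (Gamma z)"
proof -
  define f where "f = (\<lambda>t. complex_of_real t powr (z - 1) / of_real (exp t))"
  have meas[measurable]: "(\<lambda>t. complex_of_real t powr (z - 1)) \<in> borel_measurable borel"
  proof -
    have "(\<lambda>t. if t = 0 then 0 else exp ((z - 1) * Ln (complex_of_real t))) \<in> borel_measurable borel"
      by measurable
    then show ?thesis by (simp add: powr_def if_distrib cong: if_cong)
  qed
  have fm: "f \<in> borel_measurable borel" unfolding f_def by measurable
  have [measurable]: "(\<lambda>t. Re (f t)) \<in> borel_measurable borel" "(\<lambda>t. Im (f t)) \<in> borel_measurable borel"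
    using fm by measurable
  have abs: "f absolutely_integrable_on {0<..}"
    unfolding f_def by (rule absolutely_integrable_Gamma_integral'[OF z])
  have hi: "(f has_integral Gamma z) {0<..}" unfolding f_def by (rule Gamma_integral_complex'[OF z])
  have Re: "((\<lambda>t. Re (f t)) has_integral Re (Gamma z)) {0<..}"
    using has_integral_linear[OF hi bounded_linear_Re] by (simp add: o_def)
  have Im: "((\<lambda>t. Im (f t)) has_integral Im (Gamma z)) {0<..}"
    using has_integral_linear[OF hi bounded_linear_Im] by (simp add: o_def)
  have aR: "(\<lambda>t. Re (f t)) absolutely_integrable_on {0<..}"
    using absolutely_integrable_linear[OF abs bounded_linear_Re] by (simp add: o_def)
  have aI: "(\<lambda>t. Im (f t)) absolutely_integrable_on {0<..}"
    using absolutely_integrable_linear[OF abs bounded_linear_Im] by (simp add: o_def)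
  have 1: "has_bochner_integral lborel (\<lambda>u. of_real (exp u * Re (f (exp u)))) (complex_of_real (Re (Gamma z)))"
    using has_bochner_integral_bounded_linear[OF bounded_linear_of_real exp_substitution_converse[OF _ aR]]
      integral_unique[OF Re] by simp
  have 2: "has_bochner_integral lborel (\<lambda>u. of_real (exp u * Im (f (exp u)))) (complex_of_real (Im (Gamma z)))"
    using has_bochner_integral_bounded_linear[OF bounded_linear_of_real exp_substitution_converse[OF _ aI]]
      integral_unique[OF Im] by simp
  have "has_bochner_integral lborel (\<lambda>u. of_real (exp u * Re (f (exp u))) + \<i> * of_real (exp u * Im (f (exp u))))
      (complex_of_real (Re (Gamma z)) + \<i> * complex_of_real (Im (Gamma z)))"
    by (intro has_bochner_integral_add has_bochner_integral_mult_right 1 2)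
  moreover have "complex_of_real (exp u * Re (f (exp u))) + \<i> * of_real (exp u * Im (f (exp u)))
     = exp (z * of_real u - of_real (exp u))" for u
  proof -
    have "complex_of_real (exp u * Re (f (exp u))) + \<i> * of_real (exp u * Im (f (exp u))) = of_real (exp u) * f (exp u)"
      by (rule complex_eqI) auto
    also have "\<dots> = exp (of_real u) * exp ((z - 1) * of_real u) * exp (- of_real (exp u))"
      by (simp add: f_def powr_def exp_minus exp_of_real Ln_of_real divide_inverse)
    also have "\<dots> = exp (z * of_real u - of_real (exp u))"
      by (simp add: algebra_simps flip: exp_add)
    finally show ?thesis .
  qed
  ultimately show ?thesis using complex_eq by simp
qed

text \<open>
  Expanding \<open>exp (s * u)\<close> and integrating term by term gives a power series in \<open>s\<close>
  that converges everywhere.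
\<close>
lemma entire_exp_transform:
  fixes g :: "real \<Rightarrow> real"
  assumes int: "\<And>R::real. integrable lborel (\<lambda>u. g u * exp (R * \<bar>u\<bar>))"
  shows "(\<lambda>s. LINT u|lborel. complex_of_real (g u) * exp (s * of_real u)) holomorphic_on UNIV"
    and "integrable lborel (\<lambda>u. complex_of_real (g u) * exp (s * of_real u))"
proof -
  have [measurable]: "g \<in> borel_measurable borel"
    using borel_measurable_integrable[OF int[of 0]] by simp
  define a where "a = (\<lambda>k. LINT u|lborel. complex_of_real (g u) * of_real u ^ k / fact k)"
  have *: "(\<lambda>k. a k * (s - 0) ^ k) sums (LINT u|lborel. complex_of_real (g u) * exp (s * of_real u))"
     "integrable lborel (\<lambda>u. complex_of_real (g u) * exp (s * of_real u))" for s
  proof -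
    define f where "f = (\<lambda>k u. complex_of_real (g u) * ((s * of_real u) ^ k / fact k))"
    have nf: "norm (f k u) = \<bar>g u\<bar> * ((norm s * \<bar>u\<bar>) ^ k / fact k)" for k u
      by (simp add: f_def norm_mult norm_divide norm_power)
    have le: "(\<Sum>k<n. norm (f k u)) \<le> norm (g u * exp (norm s * \<bar>u\<bar>))" for n u
    proof -
      have "(\<Sum>k<n. (norm s * \<bar>u\<bar>) ^ k /\<^sub>R fact k) \<le> exp (norm s * \<bar>u\<bar>)"
        unfolding exp_def by (intro sum_le_suminf summable_exp_generic) auto
      from mult_left_mono[OF this, of "\<bar>g u\<bar>"] show ?thesis
        by (simp add: nf sum_distrib_left abs_mult divide_inverse mult_ac)
    qed
    have le1: "norm (f k u) \<le> norm (g u * exp (norm s * \<bar>u\<bar>))" for k u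
      using le[where n="Suc k" and u=u] sum_nonneg[of "{..<k}" "\<lambda>k. norm (f k u)"] by simp
    have fi: "integrable lborel (f k)" for k
      by (rule Bochner_Integration.integrable_bound[OF int[of "norm s"]])
         (use le1 in \<open>auto simp: f_def\<close>)
    have A: "AE u in lborel. summable (\<lambda>k. norm (f k u))"
    proof (rule AE_I2)
      fix u :: real
      show "summable (\<lambda>k. norm (f k u))"
        by (rule bounded_imp_summable[of _ "norm (g u * exp (norm s * \<bar>u\<bar>))"])
           (use le[of u "Suc n" for n] in \<open>auto simp: lessThan_Suc_atMost\<close>)
    qed
    have B: "summable (\<lambda>k. LINT u|lborel. norm (f k u))"
    proof (rule bounded_imp_summable)
      fix n
      have "(\<Sum>k\<le>n. LINT u|lborel. norm (f k u)) = (LINT u|lborel. (\<Sum>k\<le>n. norm (f k u)))"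
        using fi by (subst Bochner_Integration.integral_sum) auto
      also have "\<dots> \<le> (LINT u|lborel. norm (g u * exp (norm s * \<bar>u\<bar>)))"
        using fi int[of "norm s"] le[where n="Suc n"] unfolding lessThan_Suc_atMost
        by (intro integral_mono Bochner_Integration.integrable_sum integrable_norm) auto
      finally show "(\<Sum>k\<le>n. LINT u|lborel. norm (f k u)) \<le> (LINT u|lborel. norm (g u * exp (norm s * \<bar>u\<bar>)))" .
    qed auto
    have s: "(\<Sum>k. f k u) = complex_of_real (g u) * exp (s * of_real u)" for u
    proof -
      have "(\<lambda>k. (s * of_real u) ^ k / fact k) sums exp (s * of_real u)"
        using exp_converges[of "s * of_real u"] by (simp add: scaleR_conv_of_real divide_inverse mult.commute)
      from sums_mult[OF this, of "complex_of_real (g u)"] show ?thesis by (simp add: f_def sums_iff)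
    qed
    show "integrable lborel (\<lambda>u. complex_of_real (g u) * exp (s * of_real u))"
      using integrable_suminf[OF fi A B] by (simp add: s)
    have "integral\<^sup>L lborel (f k) = a k * s ^ k" for k
      unfolding a_def f_def by (subst integral_mult_left_zero[symmetric]) (simp add: power_mult_distrib mult_ac)
    with sums_integral[OF fi A B] show "(\<lambda>k. a k * (s - 0) ^ k) sums (LINT u|lborel. complex_of_real (g u) * exp (s * of_real u))"
      by (simp add: s)
  qed
  show "integrable lborel (\<lambda>u. complex_of_real (g u) * exp (s * of_real u))" by (rule *(2))
  have hol: "(\<lambda>s. LINT u|lborel. complex_of_real (g u) * exp (s * of_real u)) holomorphic_on ball 0 r" for r
    by (rule power_series_holomorphic) (rule *(1))
  show "(\<lambda>s. LINT u|lborel. complex_of_real (g u) * exp (s * of_real u)) holomorphic_on UNIV"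
  proof (unfold holomorphic_on_def, rule ballI)
    fix s :: complex
    have "s \<in> ball 0 (norm s + 1)" by simp
    with hol[of "norm s + 1"] show "(\<lambda>s. LINT u|lborel. complex_of_real (g u) * exp (s * of_real u)) field_differentiable at s"
      by (meson holomorphic_on_imp_differentiable_at open_ball)
  qed
qed


section \<open>The Mellin transform of theta and its continuation\<close>

lemma theta_tail_nonneg: "0 < x \<Longrightarrow> 0 \<le> theta_tail x"
  unfolding theta_tail_def by (intro suminf_nonneg summable_theta_tail) auto

lemma continuous_on_theta_tail: "continuous_on {0<..} theta_tail"
proof (rule continuous_at_imp_continuous_on, rule ballI)
  fix x0 :: real assume "x0 \<in> {0<..}"
  then have x0: "x0 > 0" by simp
  have ul: "uniform_limit {x0/2..} (\<lambda>n x. \<Sum>i<n. exp (- pi * x * (real (Suc i))\<^sup>2)) theta_tail sequentially"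
    unfolding theta_tail_def
  proof (rule Weierstrass_m_test)
    show "summable (\<lambda>i. exp (- pi * (x0 / 2) * (real (Suc i))\<^sup>2))"
      using x0 by (intro summable_theta_tail) simp
    show "norm (exp (- pi * x * (real (Suc i))\<^sup>2)) \<le> exp (- pi * (x0 / 2) * (real (Suc i))\<^sup>2)"
      if "x \<in> {x0/2..}" for i x
      using that by (auto intro!: mult_right_mono)
  qed
  have "continuous_on {x0/2..} theta_tail"
    by (rule uniform_limit_theorem[OF _ ul]) (auto intro!: continuous_intros always_eventually)
  then have "continuous_on {x0/2<..} theta_tail"
    by (rule continuous_on_subset) auto
  then show "isCont theta_tail x0"
    using x0 by (simp add: continuous_on_eq_continuous_at)
qed

text \<open>
  Termwise, since \<open>(x - 1) * (n\<^sup>2 - 1) \<ge> 0\<close> means \<open>x * n\<^sup>2 \<ge> (x - 1) + n\<^sup>2\<close>.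
\<close>
lemma theta_tail_exp_decay:
  assumes "x \<ge> 1"
  shows "theta_tail x \<le> exp (- pi * (x - 1)) * theta_tail 1"
proof -
  have "theta_tail x \<le> (\<Sum>n. exp (- pi * (x - 1)) * exp (- pi * 1 * (real (Suc n))\<^sup>2))"
    unfolding theta_tail_def
  proof (rule suminf_le)
    show "exp (- pi * x * (real (Suc n))\<^sup>2) \<le> exp (- pi * (x - 1)) * exp (- pi * 1 * (real (Suc n))\<^sup>2)" for n
    proof -
      have "0 \<le> (x - 1) * ((real (Suc n))\<^sup>2 - 1)"
        using assms by (intro mult_nonneg_nonneg) auto
      then have "(x - 1) + (real (Suc n))\<^sup>2 \<le> x * (real (Suc n))\<^sup>2" by (simp add: algebra_simps)
      from mult_left_mono[OF this, of pi] show ?thesis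
        by (simp add: algebra_simps flip: exp_add)
    qed
    show "summable (\<lambda>n. exp (- pi * x * (real (Suc n))\<^sup>2))"
      using assms by (intro summable_theta_tail) simp
    show "summable (\<lambda>n. exp (- pi * (x - 1)) * exp (- pi * 1 * (real (Suc n))\<^sup>2))"
      by (intro summable_mult summable_theta_tail) simp
  qed
  also have "\<dots> = exp (- pi * (x - 1)) * theta_tail 1"
    unfolding theta_tail_def by (intro suminf_mult summable_theta_tail) simp
  finally show ?thesis .
qed

text \<open>
  The function \<open>theta (a\<^sup>2) - 1\<close> in the variable \<open>u = ln a\<close>. Mellin transforms become two-sided exponential
  transforms and multiplicative convolutions become ordinary ones.
\<close>
definition Omega :: "real \<Rightarrow> real" where
  "Omega u = 2 * theta_tail (exp (2 * u))"

lemma theta_square_eq_Omega: "a > 0 \<Longrightarrow> theta (a\<^sup>2) - 1 = Omega (ln a)"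
  by (simp add: Omega_def theta_eq_tail exp_double)

lemma Omega_nonneg: "0 \<le> Omega u"
  by (simp add: Omega_def theta_tail_nonneg)

lemma continuous_on_Omega: "continuous_on UNIV Omega"
  unfolding Omega_def
  by (intro continuous_intros continuous_on_compose2[OF continuous_on_theta_tail]) auto

lemma measurable_Omega [measurable]: "Omega \<in> borel_measurable borel"
  by (rule borel_measurable_continuous_onI[OF continuous_on_Omega])

lemma Omega_minus: "Omega (- u) = exp u * Omega u + exp u - 1"
proof -
  have "sqrt (exp (2 * u)) = exp u" by (simp add: exp_double)
  then have "(1 / 2 + theta_tail (exp (- (2 * u)))) = exp u * (1 / 2 + theta_tail (exp (2 * u)))"
    using theta_tail_functional_equation[of "exp (2 * u)"]
    by (simp add: exp_minus inverse_eq_divide field_simps)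
  then show ?thesis by (simp add: Omega_def algebra_simps)
qed

text \<open>
  For \<open>u \<ge> 0\<close> the decay is faster than any exponential. For \<open>u < 0\<close> the
  functional equation gives growth like \<open>exp (- u)\<close>, which is why \<open>p\<close> must be at least 1.
\<close>
lemma Omega_exp_bound:
  assumes p: "p \<ge> 1"
  shows "\<exists>C\<ge>0. \<forall>u. Omega u \<le> C * exp (- p * u)"
proof -
  \<comment> \<open>The constant \<open>p\<^sup>2 / 8\<close> is the maximum of \<open>p * u - 2 * u\<^sup>2\<close>.\<close>
  define C where "C = exp (p\<^sup>2 / 8) * Omega 0"
  have C: "C \<ge> 0" using Omega_nonneg by (simp add: C_def)
  have pos: "Omega u \<le> C * exp (- p * u)" if "u \<ge> 0" for u
  proof -
    have "1 + 2 * u + (2 * u)\<^sup>2 / 2 \<le> exp (2 * u)" using exp_lower_Taylor_quadratic[of "2 * u"] that by simp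
    then have "2 * u\<^sup>2 \<le> exp (2 * u) - 1" using that by (simp add: power2_eq_square)
    moreover have "1 * (exp (2 * u) - 1) \<le> pi * (exp (2 * u) - 1)"
      using that pi_gt3 by (intro mult_right_mono) auto
    moreover have "p * u - 2 * u\<^sup>2 \<le> p\<^sup>2 / 8"
      using zero_le_power2[of "4 * u - p"] by (simp add: power2_eq_square algebra_simps)
    ultimately have "- pi * (exp (2 * u) - 1) \<le> p\<^sup>2 / 8 - p * u" by simp
    then have "exp (- pi * (exp (2 * u) - 1)) \<le> exp (p\<^sup>2 / 8) * exp (- p * u)" by (simp flip: exp_add)
    then have "exp (- pi * (exp (2 * u) - 1)) * theta_tail 1 \<le> exp (p\<^sup>2 / 8) * exp (- p * u) * theta_tail 1"
      by (intro mult_right_mono theta_tail_nonneg) auto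
    with theta_tail_exp_decay[of "exp (2 * u)"] that show ?thesis
      by (simp add: Omega_def C_def mult_ac)
  qed
  have neg: "Omega u \<le> (C + 1) * exp (- p * u)" if "u < 0" for u
  proof -
    have "Omega (- u) \<le> C * exp (- p * - u)" using that by (intro pos) auto
    also have "\<dots> \<le> C * 1" using that p C by (intro mult_left_mono) (auto simp: mult_nonneg_nonpos)
    finally have "Omega (- u) \<le> C" by simp
    then have "exp (- u) * Omega (- u) \<le> exp (- u) * C" by (intro mult_left_mono) auto
    then have "Omega u \<le> exp (- u) * C + exp (- u)"
      using Omega_minus[of "- u"] unfolding minus_minus by linarith
    then have "Omega u \<le> (C + 1) * exp (- u)"
      by (simp add: distrib_right mult.commute)
    also have "\<dots> \<le> (C + 1) * exp (- p * u)"
    proof -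
      have "p * u \<le> 1 * u" using p that by (intro mult_right_mono_neg) auto
      then show ?thesis using C by (intro mult_left_mono) auto
    qed
    finally show ?thesis .
  qed
  have "Omega u \<le> (C + 1) * exp (- p * u)" for u
  proof (cases "u \<ge> 0")
    case True
    then have "Omega u \<le> C * exp (- p * u)" by (rule pos)
    also have "\<dots> \<le> (C + 1) * exp (- p * u)" by (intro mult_right_mono) auto
    finally show ?thesis .
  qed (use neg in auto)
  with C show ?thesis by (intro exI[of _ "C + 1"]) auto
qed

text \<open>
  Both tails follow from the previous bound: the exponent \<open>2 * \<sigma> - 1\<close> serves for \<open>u \<ge> 0\<close> and the exponent 1 for \<open>u < 0\<close>.
\<close>
lemma Omega_weighted_bound:
  assumes \<sigma>: "\<sigma> > 1"
  shows "\<exists>C\<ge>0. \<forall>u. Omega u * exp (\<sigma> * u) \<le> C * exp (- (\<sigma> - 1) * \<bar>u\<bar>)"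
proof -
  obtain C1 where C1: "C1 \<ge> 0" "\<And>u. Omega u \<le> C1 * exp (- 1 * u)"
    using Omega_exp_bound[of 1] by auto
  obtain C2 where C2: "C2 \<ge> 0" "\<And>u. Omega u \<le> C2 * exp (- (2 * \<sigma> - 1) * u)"
    using Omega_exp_bound[of "2 * \<sigma> - 1"] \<sigma> by auto
  have "Omega u * exp (\<sigma> * u) \<le> (C1 + C2) * exp (- (\<sigma> - 1) * \<bar>u\<bar>)" for u
  proof (cases "u \<ge> 0")
    case True
    have "Omega u * exp (\<sigma> * u) \<le> C2 * exp (- (2 * \<sigma> - 1) * u) * exp (\<sigma> * u)"
      by (intro mult_right_mono C2) auto
    also have "\<dots> = C2 * exp (- (\<sigma> - 1) * u)" by (simp add: mult.assoc algebra_simps flip: exp_add)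
    also have "\<dots> \<le> (C1 + C2) * exp (- (\<sigma> - 1) * u)" using C1 by (intro mult_right_mono) auto
    finally show ?thesis using True by simp
  next
    case False
    have "Omega u * exp (\<sigma> * u) \<le> C1 * exp (- 1 * u) * exp (\<sigma> * u)"
      by (intro mult_right_mono C1) auto
    also have "\<dots> = C1 * exp ((\<sigma> - 1) * u)" by (simp add: mult.assoc algebra_simps flip: exp_add)
    also have "\<dots> \<le> (C1 + C2) * exp ((\<sigma> - 1) * u)" using C2 by (intro mult_right_mono) auto
    finally show ?thesis using False by (simp add: algebra_simps)
  qed
  with C1 C2 show ?thesis by (intro exI[of _ "C1 + C2"]) auto
qed

lemma integrable_Omega_exp:
  assumes "Re s > 1"
  shows "integrable lborel (\<lambda>u. complex_of_real (Omega u) * exp (s * of_real u))"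
proof -
  obtain C where C: "C \<ge> 0" "\<And>u. Omega u * exp (Re s * u) \<le> C * exp (- (Re s - 1) * \<bar>u\<bar>)"
    using Omega_weighted_bound[OF assms] by auto
  show ?thesis
  proof (rule Bochner_Integration.integrable_bound)
    show "integrable lborel (\<lambda>u. C * exp (- (Re s - 1) * \<bar>u\<bar>))"
      using assms by (intro integrable_mult_right integrable_exp_minus_abs) auto
    show "AE u in lborel. norm (complex_of_real (Omega u) * exp (s * of_real u))
        \<le> norm (C * exp (- (Re s - 1) * \<bar>u\<bar>))"
      using C Omega_nonneg by (auto simp: norm_mult)
  qed measurable
qed

text \<open>
  The part of the transform of \<open>Omega\<close> over \<open>u \<ge> 0\<close>, where \<open>Omega\<close> decays faster than any
  exponential; hence it exists for every \<open>s\<close>.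
\<close>
definition half_transform :: "complex \<Rightarrow> complex" where
  "half_transform s = (LINT u|lborel. complex_of_real (indicator {0..} u * Omega u) * exp (s * of_real u))"

lemma half_transform_entire:
  shows holomorphic_half_transform: "half_transform holomorphic_on UNIV"
    and integrable_half_transform:
      "integrable lborel (\<lambda>u. complex_of_real (indicator {0..} u * Omega u) * exp (s * of_real u))"
proof -
  have "integrable lborel (\<lambda>u. (indicator {0..} u * Omega u) * exp (R * \<bar>u\<bar>))" for R :: real
  proof -
    obtain C where C: "C \<ge> 0" "\<And>u. Omega u \<le> C * exp (- (\<bar>R\<bar> + 1) * u)"
      using Omega_exp_bound[of "\<bar>R\<bar> + 1"] by auto
    show ?thesis
    proof (rule Bochner_Integration.integrable_bound)
      show "integrable lborel (\<lambda>u::real. C * exp (- 1 * \<bar>u\<bar>))"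
        by (intro integrable_mult_right integrable_exp_minus_abs) auto
      show "AE u in lborel. norm (indicator {0..} u * Omega u * exp (R * \<bar>u\<bar>)) \<le> norm (C * exp (- 1 * \<bar>u\<bar>))"
      proof (rule AE_I2)
        fix u :: real
        show "norm (indicator {0..} u * Omega u * exp (R * \<bar>u\<bar>)) \<le> norm (C * exp (- 1 * \<bar>u\<bar>))"
        proof (cases "u \<ge> 0")
          case True
          have "Omega u * exp (R * u) \<le> C * exp (- (\<bar>R\<bar> + 1) * u) * exp (R * u)"
            by (intro mult_right_mono C) auto
          also have "\<dots> = C * exp ((R - \<bar>R\<bar>) * u - u)" by (simp add: mult.assoc algebra_simps flip: exp_add)
          also have "\<dots> \<le> C * exp (- u)" using C True by (intro mult_left_mono) (auto simp: mult_nonpos_nonneg)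
          finally show ?thesis using True C Omega_nonneg by (simp add: abs_mult)
        qed (use C in \<open>simp\<close>)
      qed
    qed measurable
  qed
  from entire_exp_transform[OF this] show "half_transform holomorphic_on UNIV"
      "integrable lborel (\<lambda>u. complex_of_real (indicator {0..} u * Omega u) * exp (s * of_real u))"
    by (simp_all add: half_transform_def[abs_def])
qed

lemma half_line_exp_integral:
  assumes z: "Re z < 0"
  shows "has_bochner_integral lborel (\<lambda>u. indicator {0..} u * exp (z * of_real u)) (- 1 / z)"
proof -
  have z0: "z \<noteq> 0" using z by auto
  have int: "integrable lborel (\<lambda>u. indicator {0..} u * exp (z * of_real u))"
  proof (rule Bochner_Integration.integrable_bound)
    show "integrable lborel (\<lambda>u::real. exp (- (- Re z) * \<bar>u\<bar>))"
      using z by (intro integrable_exp_minus_abs) auto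
  qed (auto split: split_indicator)
  have "(LBINT u=0..\<infinity>. exp (z * of_real u)) = 0 - 1 / z"
  proof (rule interval_integral_FTC_integrable[where F = "\<lambda>u. exp (z * of_real u) / z"])
    show "((\<lambda>u. exp (z * of_real u) / z) has_vector_derivative exp (z * of_real u)) (at u)" for u
      using z0 by (auto intro!: derivative_eq_intros has_vector_derivative_real_field)
    show "set_integrable lborel (einterval 0 \<infinity>) (\<lambda>u. exp (z * of_real u))"
    proof -
      have "integrable lborel (\<lambda>u. indicator {0<..} u *\<^sub>R (indicator {0..} u * exp (z * of_real u)))"
        by (intro integrable_mult_indicator int) auto
      then show ?thesis
        by (simp add: set_integrable_def einterval_def zero_ereal_def scaleR_conv_of_real)
           (erule Bochner_Integration.integrable_cong[THEN iffD1, rotated -1], auto split: split_indicator)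
    qed
    have "((\<lambda>u. exp (z * of_real u) / z) \<longlongrightarrow> exp (z * of_real 0) / z) (at_right 0)"
      by (intro tendsto_intros z0)
    then show "(((\<lambda>u. exp (z * of_real u) / z) \<circ> real_of_ereal) \<longlongrightarrow> 1 / z) (at_right 0)"
      by (simp add: zero_ereal_def ereal_tendsto_simps)
    have "((\<lambda>u. exp (z * of_real u) / z) \<longlongrightarrow> 0 / z) at_top"
    proof (intro tendsto_divide tendsto_const z0, rule tendsto_norm_zero_cancel)
      have "((\<lambda>u. exp (Re z * u)) \<longlongrightarrow> 0) at_top" using z by real_asymp
      then show "((\<lambda>u. norm (exp (z * of_real u))) \<longlongrightarrow> 0) at_top" by simp
    qed
    then show "(((\<lambda>u. exp (z * of_real u) / z) \<circ> real_of_ereal) \<longlongrightarrow> 0) (at_left \<infinity>)"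
      by (simp add: ereal_tendsto_simps)
  qed (auto intro!: continuous_intros)
  moreover have "(LBINT u=0..\<infinity>. exp (z * of_real u)) = (LINT u|lborel. indicator {0..} u * exp (z * of_real u))"
    unfolding interval_lebesgue_integral_def set_lebesgue_integral_def
  proof (simp, rule integral_cong_AE)
    show "AE u in lborel. indicat_real (einterval 0 \<infinity>) u *\<^sub>R exp (z * of_real u) = indicator {0..} u * exp (z * of_real u)"
      using AE_lborel_singleton[of 0]
      by eventually_elim (auto simp: einterval_def zero_ereal_def split: split_indicator)
  qed auto
  ultimately show ?thesis using int by (simp add: has_bochner_integral_iff)
qed

text \<open>
  The completed zeta function without its polar part \<open>1 / (s - 1) - 1 / s\<close>.
\<close>
definition Lambda_entire :: "complex \<Rightarrow> complex" where
  "Lambda_entire s = half_transform s + half_transform (1 - s)"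

lemma Lambda_entire_reflect: "Lambda_entire (1 - s) = Lambda_entire s"
  by (simp add: Lambda_entire_def)

lemma holomorphic_Lambda_entire: "Lambda_entire holomorphic_on UNIV"
proof -
  have "half_transform \<circ> (\<lambda>s. 1 - s) holomorphic_on UNIV"
    by (rule holomorphic_on_compose_gen[OF _ holomorphic_half_transform]) (auto intro!: holomorphic_intros)
  then show ?thesis
    unfolding Lambda_entire_def[abs_def] o_def by (intro holomorphic_on_add holomorphic_half_transform)
qed

text \<open>
  Riemann's argument. On \<open>u < 0\<close> the functional equation of theta replaces
  \<open>Omega u\<close> by a multiple of \<open>Omega (- u)\<close> and two exponentials; the first gives the half transform at \<open>1 - s\<close>,
  the exponentials give the polar part.
\<close>
lemma Omega_transform_continuation:
  assumes s: "Re s > 1"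
  shows "has_bochner_integral lborel (\<lambda>u. complex_of_real (Omega u) * exp (s * of_real u))
           (Lambda_entire s + 1 / (s - 1) - 1 / s)"
proof -
  let ?h = "\<lambda>s u. complex_of_real (indicator {0..} u * Omega u) * exp (s * of_real u)"
  let ?e = "\<lambda>z u. indicator {0..} u * exp (z * complex_of_real u)"
  have h: "has_bochner_integral lborel (?h s) (half_transform s)" for s
    using integrable_half_transform[of s] by (simp add: has_bochner_integral_iff half_transform_def)
  have "has_bochner_integral lborel (\<lambda>u. ?h (1 - s) u + (?e (1 - s) u - ?e (- s) u))
      (half_transform (1 - s) + (- 1 / (1 - s) - (- 1 / (- s))))"
    using s by (intro has_bochner_integral_add has_bochner_integral_diff h half_line_exp_integral) auto
  from lborel_has_bochner_integral_real_affine_iff[THEN iffD1, OF _ this, of "-1" 0]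
  have "has_bochner_integral lborel (\<lambda>u. ?h (1 - s) (- u) + (?e (1 - s) (- u) - ?e (- s) (- u)))
      (half_transform (1 - s) + (- 1 / (1 - s) - (- 1 / (- s))))" by simp
  from has_bochner_integral_add[OF h[of s] this]
  have 1: "has_bochner_integral lborel (\<lambda>u. ?h s u + (?h (1 - s) (- u) + (?e (1 - s) (- u) - ?e (- s) (- u))))
      (half_transform s + (half_transform (1 - s) + (- 1 / (1 - s) - (- 1 / (- s)))))" .
  have eq: "?h s u + (?h (1 - s) (- u) + (?e (1 - s) (- u) - ?e (- s) (- u))) =
     complex_of_real (Omega u) * exp (s * of_real u)" if "u \<noteq> 0" for u
  proof (cases "u > 0")
    case False
    then have u: "u < 0" using that by simp
    have "complex_of_real (Omega u) * exp (s * of_real u) =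
      (exp (- of_real u) * of_real (Omega (- u)) + exp (- of_real u) - 1) * exp (s * of_real u)"
      using Omega_minus[of "- u"] by (simp flip: exp_of_real)
    also have "\<dots> = of_real (Omega (- u)) * exp ((1 - s) * of_real (- u)) + (exp ((1 - s) * of_real (- u)) - exp (- s * of_real (- u)))"
      by (simp add: algebra_simps flip: exp_add)
    finally show ?thesis using u by simp
  qed simp
  \<comment> \<open>At \<open>u = 0\<close> both half-lines contribute, hence equality almost everywhere only.\<close>
  have "AE u in lborel. ?h s u + (?h (1 - s) (- u) + (?e (1 - s) (- u) - ?e (- s) (- u))) =
     complex_of_real (Omega u) * exp (s * of_real u)"
    using AE_lborel_singleton[of 0] by eventually_elim (rule eq)
  then have "has_bochner_integral lborel (\<lambda>u. complex_of_real (Omega u) * exp (s * of_real u))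
      (half_transform s + (half_transform (1 - s) + (- 1 / (1 - s) - (- 1 / (- s)))))"
    by (rule has_bochner_integral_cong_AE[THEN iffD1, OF _ _ _ 1, rotated 2]) measurable
  moreover have "- 1 / (1 - s) = 1 / (s - 1)"
    using minus_divide_divide[of 1 "s - 1"] by simp
  then have "half_transform s + (half_transform (1 - s) + (- 1 / (1 - s) - (- 1 / (- s)))) =
      Lambda_entire s + 1 / (s - 1) - 1 / s"
    by (simp only: Lambda_entire_def) simp
  ultimately show ?thesis by (simp only:)
qed

text \<open>
  The gamma integral at \<open>s / 2\<close> after the affine substitution \<open>v = ln (pi * (n + 1)\<^sup>2) + 2 * u\<close>.
\<close>
lemma gaussian_term_transform:
  assumes s: "Re s > 0"
  shows "has_bochner_integral lborel
     (\<lambda>u. complex_of_real (2 * exp (- pi * exp (2 * u) * (real (Suc n))\<^sup>2)) * exp (s * of_real u))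
     (of_real pi powr (- s / 2) * Gamma (s / 2) * (1 / of_nat (Suc n) powr s))"
proof -
  define L where "L = ln (pi * (real (Suc n))\<^sup>2)"
  have eL: "exp L = pi * (real (Suc n))\<^sup>2" by (simp add: L_def del: of_nat_Suc)
  have L: "L = ln pi + 2 * ln (real (Suc n))" by (simp add: L_def ln_mult ln_realpow del: of_nat_Suc)
  have "has_bochner_integral lborel (\<lambda>v. exp (s / 2 * of_real v - of_real (exp v))) (Gamma (s / 2))"
    by (rule Gamma_exp_integral) (use s in simp)
  from lborel_has_bochner_integral_real_affine_iff[THEN iffD1, OF _ this, of 2 L]
  have "has_bochner_integral lborel (\<lambda>u. exp (s / 2 * of_real (L + 2 * u) - of_real (exp (L + 2 * u)))) (Gamma (s / 2) / 2)"
    by (simp add: scaleR_conv_of_real)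
  from has_bochner_integral_mult_right[OF this, of "2 * exp (- (s / 2 * of_real L))"]
  have "has_bochner_integral lborel (\<lambda>u. 2 * exp (- (s / 2 * of_real L)) *
      exp (s / 2 * of_real (L + 2 * u) - of_real (exp (L + 2 * u)))) (exp (- (s / 2 * of_real L)) * Gamma (s / 2))"
    by simp
  also have "(\<lambda>u. 2 * exp (- (s / 2 * of_real L)) * exp (s / 2 * of_real (L + 2 * u) - of_real (exp (L + 2 * u)))) =
     (\<lambda>u. complex_of_real (2 * exp (- pi * exp (2 * u) * (real (Suc n))\<^sup>2)) * exp (s * of_real u))"
  proof
    fix u
    show "2 * exp (- (s / 2 * of_real L)) * exp (s / 2 * of_real (L + 2 * u) - of_real (exp (L + 2 * u))) =
     complex_of_real (2 * exp (- pi * exp (2 * u) * (real (Suc n))\<^sup>2)) * exp (s * of_real u)"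
    proof -
      have "exp (L + 2 * u) = pi * exp (2 * u) * (real (Suc n))\<^sup>2" by (simp add: exp_add eL del: of_nat_Suc)
      moreover have "complex_of_real (exp (- pi * exp (2 * u) * (real (Suc n))\<^sup>2)) =
          exp (- of_real (pi * exp (2 * u) * (real (Suc n))\<^sup>2))"
        by (simp add: exp_of_real[symmetric] del: of_nat_Suc)
      moreover have "exp (- (s / 2 * of_real L)) * exp (s / 2 * of_real (L + 2 * u) - w) = exp (- w) * exp (s * of_real u)" for w
      proof -
        have "s / 2 * of_real (L + 2 * u) = s / 2 * of_real L + s * of_real u" by (simp add: distrib_left)
        then have "- (s / 2 * of_real L) + (s / 2 * of_real (L + 2 * u) - w) = - w + s * of_real u"
          by (simp only:) simp
        then show ?thesis by (simp only: exp_add[symmetric])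
      qed
      ultimately show ?thesis by (simp only: of_real_mult of_real_numeral mult.assoc)
    qed
  qed
  also have "exp (- (s / 2 * of_real L)) = of_real pi powr (- s / 2) * (1 / of_nat (Suc n) powr s)"
  proof -
    have "complex_of_real (ln (real (Suc n))) = Ln (of_nat (Suc n))"
      using Ln_of_real[of "real (Suc n)"] by (simp del: of_nat_Suc)
    then have "- (s / 2 * of_real L) = (- s / 2) * Ln (of_real pi) + - (s * Ln (of_nat (Suc n)))"
      by (simp add: L Ln_of_real algebra_simps del: of_nat_Suc)
    then have "exp (- (s / 2 * of_real L)) = exp ((- s / 2) * Ln (of_real pi)) * exp (- (s * Ln (of_nat (Suc n))))"
      by (simp only: exp_add)
    also have "exp (- (s * Ln (of_nat (Suc n)))) = 1 / of_nat (Suc n) powr s"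
      by (simp add: powr_def exp_minus inverse_eq_divide del: of_nat_Suc)
    also have "exp ((- s / 2) * Ln (of_real pi)) = of_real pi powr (- s / 2)"
      by (simp add: powr_def)
    finally show ?thesis .
  qed
  finally show ?thesis by (simp only: mult_ac)
qed

lemma summable_Suc_powr:
  "\<sigma> > 1 \<Longrightarrow> summable (\<lambda>n. 1 / real (Suc n) powr \<sigma>)"
  using summable_real_powr_iff[of "-\<sigma>"] summable_Suc_iff[of "\<lambda>n. real n powr (-\<sigma>)"]
  by (simp add: powr_minus inverse_eq_divide del: of_nat_Suc)

lemma norm_nat_powr: "norm (complex_of_nat (Suc n) powr s) = real (Suc n) powr Re s"
  using norm_powr_real_powr[of "of_nat (Suc n)" s] by (simp add: norm_powr_real_powr' del: of_nat_Suc)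

lemma Omega_transform_zeta:
  assumes s: "Re s > 1"
  shows "(LINT u|lborel. complex_of_real (Omega u) * exp (s * of_real u)) =
           of_real pi powr (- s / 2) * Gamma (s / 2) * (\<Sum>n. 1 / of_nat (Suc n) powr s)"
proof -
  define f where "f = (\<lambda>n u. complex_of_real (2 * exp (- pi * exp (2 * u) * (real (Suc n))\<^sup>2)) * exp (s * of_real u))"
  have f: "has_bochner_integral lborel (f n) (of_real pi powr (- s / 2) * Gamma (s / 2) * (1 / of_nat (Suc n) powr s))" for n
    unfolding f_def using s by (intro gaussian_term_transform) auto
  have fi: "integrable lborel (f n)" for n using f[of n] by (simp add: has_bochner_integral_iff)
  have nf: "norm (f n u) = 2 * exp (- pi * exp (2 * u) * (real (Suc n))\<^sup>2) * exp (Re s * u)" for n u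
    by (simp add: f_def norm_mult)
  have nfi: "(LINT u|lborel. norm (f n u)) = norm (of_real pi powr (- of_real (Re s) / 2) * Gamma (of_real (Re s) / 2) :: complex) * (1 / real (Suc n) powr Re s)" for n
  proof -
    have "complex_of_real (LINT u|lborel. norm (f n u)) = (LINT u|lborel. complex_of_real (norm (f n u)))"
      by (rule integral_complex_of_real[symmetric])
    also have "\<dots> = of_real pi powr (- of_real (Re s) / 2) * Gamma (of_real (Re s) / 2) * (1 / of_nat (Suc n) powr of_real (Re s))"
      using has_bochner_integral_integral_eq[OF gaussian_term_transform[of "of_real (Re s)" n]] s
      by (simp add: nf exp_of_real[symmetric])
    finally have "norm (complex_of_real (LINT u|lborel. norm (f n u))) = norm \<dots>" by simp
    then show ?thesis by (simp add: norm_mult norm_divide norm_nat_powr del: of_nat_Suc)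
  qed
  have A: "AE u in lborel. summable (\<lambda>n. norm (f n u))"
    unfolding nf using summable_theta_tail
    by (intro AE_I2 summable_mult2 summable_mult) (auto simp del: of_nat_Suc)
  have B: "summable (\<lambda>n. LINT u|lborel. norm (f n u))"
    unfolding nfi using s by (intro summable_mult summable_Suc_powr)
  have sum_f: "(\<Sum>n. f n u) = complex_of_real (Omega u) * exp (s * of_real u)" for u
  proof -
    have "(\<lambda>n. 2 * exp (- pi * exp (2 * u) * (real (Suc n))\<^sup>2)) sums Omega u"
      unfolding Omega_def theta_tail_def by (intro sums_mult summable_sums summable_theta_tail) simp
    from sums_mult2[OF sums_of_real[OF this], of "exp (s * of_real u)"] show ?thesis
      by (simp add: f_def sums_iff)
  qed
  have "(\<lambda>n. of_real pi powr (- s / 2) * Gamma (s / 2) * (1 / of_nat (Suc n) powr s)) sums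
     (LINT u|lborel. complex_of_real (Omega u) * exp (s * of_real u))"
    using sums_integral[OF fi A B] by (simp only: sum_f has_bochner_integral_integral_eq[OF f])
  moreover have "summable (\<lambda>n. 1 / complex_of_nat (Suc n) powr s)"
    by (rule summable_norm_cancel) (use summable_Suc_powr[OF s] in \<open>simp add: norm_divide norm_nat_powr del: of_nat_Suc\<close>)
  from sums_mult[OF summable_sums[OF this]]
  have "(\<lambda>n. of_real pi powr (- s / 2) * Gamma (s / 2) * (1 / of_nat (Suc n) powr s)) sums
     (of_real pi powr (- s / 2) * Gamma (s / 2) * (\<Sum>n. 1 / of_nat (Suc n) powr s))" .
  ultimately show ?thesis by (rule sums_unique2)
qed


section \<open>The zeta function to the right of the imaginary axis\<close>

lemma norm_of_real_powr: "x > 0 \<Longrightarrow> norm (complex_of_real x powr s) = x powr Re s"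
  by (simp add: norm_powr_real_powr)

lemma of_real_Suc_neq_0: "complex_of_real (real n + 1) \<noteq> 0" "complex_of_real (real n + 2) \<noteq> 0"
  by (simp_all only: of_real_eq_0_iff)

lemma has_field_derivative_powr_reflect:
  assumes "w \<noteq> 0"
  shows "((\<lambda>z::complex. w powr (a - z)) has_field_derivative - (Ln w * w powr (a - s))) (at s)"
  unfolding powr_def using assms by (auto intro!: derivative_eq_intros)

text \<open>
  The Dirichlet term at \<open>n + 1\<close> times \<open>s - 1\<close>, minus the integral of \<open>(s - 1) * x powr (- s)\<close> over
  \<open>[n + 1, n + 2]\<close>. Multiplying by \<open>s - 1\<close> makes every term entire, also at \<open>s = 1\<close>.
\<close>
definition zeta_term :: "nat \<Rightarrow> complex \<Rightarrow> complex" where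
  "zeta_term n s = of_real (real n + 2) powr (1 - s) - of_real (real n + 1) powr (1 - s)
     - (1 - s) * of_real (real n + 1) powr (- s)"

text \<open>
  The term is the first-order Taylor remainder of \<open>x powr (1 - s)\<close> between \<open>n + 1\<close> and
  \<open>n + 2\<close>, so it is controlled by the second derivative.
\<close>
lemma norm_zeta_term_le:
  assumes s: "Re s > 0"
  shows "norm (zeta_term n s) \<le> norm s * norm (1 - s) * (1 / real (Suc n) powr (Re s + 1))"
proof -
  define S where "S = complex_of_real ` {real n + 1..real n + 2}"
  define f where "f = (\<lambda>(i::nat) z. if i = 0 then z powr (1 - s) else if i = 1 then (1 - s) * z powr (- s)
      else (1 - s) * (- s * z powr (- s - 1)))"
  have "convex S" unfolding S_def
    by (intro convex_linear_image convex_real_interval) (simp add: bounded_linear.linear bounded_linear_of_real)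
  moreover have "(f i has_field_derivative f (Suc i) x) (at x within S)" if "x \<in> S" "i \<le> 1" for i :: nat and x
  proof -
    have x: "x \<notin> \<real>\<^sub>\<le>\<^sub>0" using that by (auto simp: S_def complex_nonpos_Reals_iff)
    have "i = 0 \<or> i = 1" using that by auto
    then show ?thesis
    proof
      assume "i = 0"
      then show ?thesis using has_field_derivative_powr[OF x, of "1 - s"]
        by (auto simp: f_def intro: has_field_derivative_at_within)
    next
      assume "i = 1"
      then show ?thesis using DERIV_cmult[OF has_field_derivative_powr[OF x, of "- s"], of "1 - s"]
        by (auto simp: f_def intro: has_field_derivative_at_within)
    qed
  qed
  moreover have "norm (f (Suc 1) x) \<le> norm s * norm (1 - s) * (1 / real (Suc n) powr (Re s + 1))" if xS: "x \<in> S" for x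
  proof -
    obtain t where t: "x = of_real t" "real n + 1 \<le> t" using xS by (auto simp: S_def)
    have "norm (f (Suc 1) x) = norm s * norm (1 - s) * (t powr (- (Re s + 1)))"
      using t by (simp add: f_def norm_mult norm_of_real_powr)
    also have "\<dots> \<le> norm s * norm (1 - s) * (real (Suc n) powr (- (Re s + 1)))"
      using s t by (intro mult_left_mono powr_mono2') auto
    finally show ?thesis by (simp only: powr_minus inverse_eq_divide)
  qed
  moreover have "complex_of_real (real n + 1) \<in> S" "complex_of_real (real n + 2) \<in> S"
    unfolding S_def by (auto simp del: of_real_add)
  ultimately have "norm (f 0 (of_real (real n + 2)) - (\<Sum>i\<le>1. f i (of_real (real n + 1)) *
      (of_real (real n + 2) - of_real (real n + 1)) ^ i / fact i))
    \<le> norm s * norm (1 - s) * (1 / real (Suc n) powr (Re s + 1)) *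
      norm (complex_of_real (real n + 2) - of_real (real n + 1)) ^ Suc 1 / fact 1"
    by (intro complex_Taylor[of S 1 f])
  moreover have "complex_of_real (real n + 2) - of_real (real n + 1) = 1" by simp
  ultimately show ?thesis
    by (simp add: zeta_term_def f_def diff_diff_eq del: of_real_add)
qed

text \<open>
  The function \<open>(s - 1) * zeta s\<close> in the half-plane \<open>Re s > 0\<close>. It provides both the polynomial
  growth of zeta on vertical lines and its Laurent expansion at 1.
\<close>
definition zeta_reg :: "complex \<Rightarrow> complex" where
  "zeta_reg s = 1 + (\<Sum>n. zeta_term n s)"

lemma zeta_term_bound_local:
  assumes "Re s \<ge> \<sigma>" "\<sigma> > 0" "norm s \<le> K"
  shows "norm (zeta_term n s) \<le> K * (1 + K) * (1 / real (Suc n) powr (\<sigma> + 1))"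
proof -
  have K: "K \<ge> 0" using assms norm_ge_zero[of s] by linarith
  have "norm (1 - s) \<le> 1 + K" using norm_triangle_ineq4[of 1 s] assms by simp
  moreover have "1 / real (Suc n) powr (Re s + 1) \<le> 1 / real (Suc n) powr (\<sigma> + 1)"
    using assms by (intro divide_left_mono powr_mono mult_pos_pos) auto
  ultimately have "norm s * norm (1 - s) * (1 / real (Suc n) powr (Re s + 1)) \<le>
     K * (1 + K) * (1 / real (Suc n) powr (\<sigma> + 1))"
    using assms K by (intro mult_mono) auto
  with norm_zeta_term_le[of s n] assms show ?thesis by linarith
qed

lemma zeta_reg_derivative:
  "\<exists>g'. \<forall>s\<in>{s. Re s > 0}. (zeta_reg has_field_derivative g' s) (at s) \<and>
     (\<lambda>N. \<Sum>n<N. deriv (zeta_term n) s) \<longlonglongrightarrow> g' s"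
proof -
  have hol: "zeta_term n holomorphic_on UNIV" for n
    unfolding zeta_term_def[abs_def]
    by (intro holomorphic_on_diff holomorphic_on_mult holomorphic_on_powr_right holomorphic_intros)
  have op: "open {s. Re s > 0}" by (simp add: open_halfspace_Re_gt)
  have "\<exists>g'. \<forall>s\<in>{s. Re s > 0}. ((\<lambda>s. \<Sum>n. zeta_term n s) has_field_derivative g' s) (at s) \<and>
     (\<lambda>N. \<Sum>n<N. deriv (zeta_term n) s) \<longlonglongrightarrow> g' s"
  proof (rule has_complex_derivative_uniform_sequence[OF op, where f = "\<lambda>N s. \<Sum>n<N. zeta_term n s"])
    show "((\<lambda>s. \<Sum>n<N. zeta_term n s) has_field_derivative (\<Sum>n<N. deriv (zeta_term n) s)) (at s)" for N s
      using hol by (intro DERIV_sum holomorphic_derivI[OF hol]) auto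
    show "\<exists>d>0. cball s d \<subseteq> {s. Re s > 0} \<and>
       uniform_limit (cball s d) (\<lambda>N s. \<Sum>n<N. zeta_term n s) (\<lambda>s. \<Sum>n. zeta_term n s) sequentially"
      if "s \<in> {s. Re s > 0}" for s
    proof -
      define d where "d = Re s / 2"
      have d: "d > 0" using that by (simp add: d_def)
      have *: "Re w \<ge> d \<and> norm w \<le> norm s + d" if "w \<in> cball s d" for w
      proof -
        have "norm (s - w) \<le> d" using that by (simp add: dist_norm)
        moreover have "\<bar>Re (s - w)\<bar> \<le> norm (s - w)" by (rule abs_Re_le_cmod)
        moreover have "norm w \<le> norm s + norm (s - w)" by (metis norm_minus_commute norm_triangle_sub)
        ultimately show ?thesis by (auto simp: d_def)
      qed
      have "uniform_limit (cball s d) (\<lambda>N s. \<Sum>n<N. zeta_term n s) (\<lambda>s. \<Sum>n. zeta_term n s) sequentially"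
      proof (rule Weierstrass_m_test)
        show "summable (\<lambda>n. (norm s + d) * (1 + (norm s + d)) * (1 / real (Suc n) powr (d + 1)))"
          using d by (intro summable_mult summable_Suc_powr) auto
        show "norm (zeta_term n w) \<le> (norm s + d) * (1 + (norm s + d)) * (1 / real (Suc n) powr (d + 1))"
          if "w \<in> cball s d" for n w
          using *[OF that] d by (intro zeta_term_bound_local) auto
      qed
      then show ?thesis using d * by (intro exI[of _ d]) force
    qed
  qed
  then obtain g' where "\<forall>s\<in>{s. Re s > 0}. ((\<lambda>s. \<Sum>n. zeta_term n s) has_field_derivative g' s) (at s) \<and>
     (\<lambda>N. \<Sum>n<N. deriv (zeta_term n) s) \<longlonglongrightarrow> g' s" by blast
  then show ?thesis
    unfolding zeta_reg_def[abs_def] by (intro exI[of _ g']) (auto intro!: derivative_eq_intros)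
qed

lemma holomorphic_zeta_reg: "zeta_reg holomorphic_on {s. Re s > 0}"
proof -
  obtain g' where "\<forall>s\<in>{s. Re s > 0}. (zeta_reg has_field_derivative g' s) (at s) \<and>
     (\<lambda>N. \<Sum>n<N. deriv (zeta_term n) s) \<longlonglongrightarrow> g' s"
    using zeta_reg_derivative by blast
  then show ?thesis
    by (intro holomorphic_onI) (meson field_differentiable_def field_differentiable_at_within)
qed

text \<open>
  Differentiating termwise at 1 produces the terms \<open>1 / (n + 1) - ln ((n + 2) / (n + 1))\<close>, whose
  sum is Euler's constant.
\<close>
lemma zeta_reg_at_1: "zeta_reg 1 = 1" "(zeta_reg has_field_derivative of_real euler_mascheroni) (at 1)"
proof -
  have "zeta_term n 1 = 0" for n using of_real_Suc_neq_0[of n] by (simp add: zeta_term_def del: of_real_add)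
  then show "zeta_reg 1 = 1" by (simp add: zeta_reg_def)
  obtain g' where g': "\<forall>s\<in>{s. Re s > 0}. (zeta_reg has_field_derivative g' s) (at s) \<and>
     (\<lambda>N. \<Sum>n<N. deriv (zeta_term n) s) \<longlonglongrightarrow> g' s"
    using zeta_reg_derivative by blast
  have "deriv (zeta_term n) 1 = of_real (inverse (of_nat (n+1)) + ln (of_nat (n+1)) - ln (of_nat (n+2)))" for n
  proof (rule DERIV_imp_deriv)
    note nz = of_real_Suc_neq_0(2,1)[of n]
    have L: "Ln (complex_of_real (real n + 2)) = of_real (ln (real n + 2))"
       "Ln (complex_of_real (real n + 1)) = of_real (ln (real n + 1))"
      by (intro Ln_of_real; simp)+
    have p: "complex_of_real (real n + 1) powr (- 1) = inverse (of_real (real n + 1))"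
      using nz(2) by (simp only: powr_minus) (simp add: powr_to_1)
    have "((\<lambda>s. of_real (real n + 2) powr (1 - s) - of_real (real n + 1) powr (1 - s)
           - (1 - s) * of_real (real n + 1) powr (0 - s)) has_field_derivative
       (- (Ln (of_real (real n + 2)) * of_real (real n + 2) powr (1 - 1))
        - (- (Ln (of_real (real n + 1)) * of_real (real n + 1) powr (1 - 1)))
        - ((0 - 1) * of_real (real n + 1) powr (0 - 1) +
           - (Ln (of_real (real n + 1)) * of_real (real n + 1) powr (0 - 1)) * (1 - 1)))) (at (1 :: complex))"
      by (intro DERIV_diff DERIV_mult has_field_derivative_powr_reflect nz DERIV_const DERIV_ident)
    then show "(zeta_term n has_field_derivative of_real (inverse (of_nat (n+1)) + ln (of_nat (n+1)) - ln (of_nat (n+2)))) (at 1)"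
      unfolding L using nz p by (simp add: zeta_term_def[abs_def] add.commute[of 1] del: of_real_add) (simp add: algebra_simps)
  qed
  moreover have "(\<lambda>N. \<Sum>n<N. complex_of_real (inverse (of_nat (n+1)) + ln (of_nat (n+1)) - ln (of_nat (n+2))))
     \<longlonglongrightarrow> of_real euler_mascheroni"
    using euler_mascheroni_sum_real[THEN sums_of_real, where ?'a = complex] unfolding sums_def .
  ultimately have "(\<lambda>N. \<Sum>n<N. deriv (zeta_term n) 1) \<longlonglongrightarrow> of_real euler_mascheroni" by simp
  moreover have "(\<lambda>N. \<Sum>n<N. deriv (zeta_term n) 1) \<longlonglongrightarrow> g' 1" using g' by simp
  ultimately have "g' 1 = of_real euler_mascheroni" by (rule LIMSEQ_unique[rotated])
  moreover have "(zeta_reg has_field_derivative g' 1) (at 1)" using g' by simp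
  ultimately show "(zeta_reg has_field_derivative of_real euler_mascheroni) (at 1)" by simp
qed

text \<open>
  The differences of \<open>x powr (1 - s)\<close> telescope to \<open>- 1\<close>.
\<close>
lemma zeta_reg_eq_Dirichlet_series:
  assumes s: "Re s > 1"
  shows "zeta_reg s = (s - 1) * (\<Sum>n. 1 / of_nat (Suc n) powr s)"
proof -
  have sm: "summable (\<lambda>n. 1 / of_nat (Suc n) powr s)"
    by (rule summable_norm_cancel)
       (use summable_Suc_powr[OF s] in \<open>simp add: norm_divide norm_nat_powr del: of_nat_Suc\<close>)
  have "(\<lambda>n. complex_of_real (real n + 1) powr (1 - s)) \<longlonglongrightarrow> 0"
  proof (rule tendsto_norm_zero_cancel)
    have "(\<lambda>n. (real n + 1) powr (1 - Re s)) \<longlonglongrightarrow> 0" using s by real_asymp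
    then show "(\<lambda>n. norm (complex_of_real (real n + 1) powr (1 - s))) \<longlonglongrightarrow> 0"
      by (subst norm_of_real_powr) auto
  qed
  from telescope_sums[OF this]
  have "(\<lambda>n. complex_of_real (real n + 2) powr (1 - s) - of_real (real n + 1) powr (1 - s)) sums (- 1)"
    by (simp add: add.commute)
  from sums_add[OF this sums_mult[OF summable_sums[OF sm], of "s - 1"]]
  have "(\<lambda>n. of_real (real n + 2) powr (1 - s) - of_real (real n + 1) powr (1 - s) +
      (s - 1) * (1 / of_nat (Suc n) powr s)) sums (- 1 + (s - 1) * (\<Sum>n. 1 / of_nat (Suc n) powr s))" .
  also have "(\<lambda>n. of_real (real n + 2) powr (1 - s) - of_real (real n + 1) powr (1 - s) +
      (s - 1) * (1 / of_nat (Suc n) powr s)) = (\<lambda>n. zeta_term n s)"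
  proof
    fix n
    have "1 / of_nat (Suc n) powr s = complex_of_real (real n + 1) powr (- s)"
      by (simp add: powr_minus divide_inverse add.commute)
    then show "of_real (real n + 2) powr (1 - s) - of_real (real n + 1) powr (1 - s) +
      (s - 1) * (1 / of_nat (Suc n) powr s) = zeta_term n s"
      unfolding zeta_term_def by (simp only: left_diff_distrib) simp
  qed
  finally have "(\<lambda>n. zeta_term n s) sums (- 1 + (s - 1) * (\<Sum>n. 1 / of_nat (Suc n) powr s))" .
  then show ?thesis by (simp add: zeta_reg_def sums_iff)
qed

text \<open>
  Twice Riemann's xi function: the completed zeta function times \<open>s * (s - 1)\<close>, which removes both
  poles.
\<close>
definition xi_fun :: "complex \<Rightarrow> complex" where
  "xi_fun s = s * (s - 1) * Lambda_entire s + 1"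

lemma holomorphic_xi_fun: "xi_fun holomorphic_on A"
proof -
  have "xi_fun holomorphic_on UNIV"
    unfolding xi_fun_def[abs_def] by (intro holomorphic_intros holomorphic_Lambda_entire)
  then show ?thesis by (rule holomorphic_on_subset) auto
qed

lemma xi_fun_reflect: "xi_fun (1 - s) = xi_fun s"
  by (simp add: xi_fun_def Lambda_entire_reflect algebra_simps)

lemma Omega_transform_xi:
  assumes "Re s > 1"
  shows "has_bochner_integral lborel (\<lambda>u. complex_of_real (Omega u) * exp (s * of_real u))
           (xi_fun s / (s * (s - 1)))"
proof -
  have "s \<noteq> 0" "s \<noteq> 1" using assms by auto
  then have "xi_fun s / (s * (s - 1)) = Lambda_entire s + 1 / (s - 1) - 1 / s"
    by (simp add: xi_fun_def field_simps)
  then show ?thesis using Omega_transform_continuation[OF assms] by simp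
qed

lemma xi_fun_Dirichlet:
  assumes "Re s > 1"
  shows "xi_fun s = s * (s - 1) * (of_real pi powr (- s / 2) * Gamma (s / 2) * (\<Sum>n. 1 / of_nat (Suc n) powr s))"
proof -
  have "s \<noteq> 0" "s \<noteq> 1" using assms by auto
  then show ?thesis
    using has_bochner_integral_integral_eq[OF Omega_transform_xi[OF assms]] Omega_transform_zeta[OF assms]
    by (simp add: field_simps)
qed

text \<open>
  Both sides are holomorphic for \<open>Re s > 0\<close> and agree where the Dirichlet series converges.
\<close>
lemma xi_fun_eq:
  assumes "Re s > 0"
  shows "xi_fun s = s * of_real pi powr (- s / 2) * Gamma (s / 2) * zeta_reg s"
proof -
  define f where "f = (\<lambda>s. s * of_real pi powr (- s / 2) * Gamma (s / 2) * zeta_reg s)"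
  have "{s. Re s > 1} \<noteq> {}" using complex_Re_of_nat[of 2] by (metis (mono_tags) empty_Collect_eq of_nat_numeral one_less_numeral_iff semiring_norm(76))
  moreover have "connected {s. Re s > 0}" by (intro convex_connected convex_halfspace_Re_gt)
  moreover have "{s. Re s > 1} \<subseteq> {s. Re s > 0}" by auto
  moreover have "f holomorphic_on {s. Re s > 0}"
    unfolding f_def
    by (intro holomorphic_intros holomorphic_zeta_reg) (auto elim!: nonpos_Ints_cases')
  moreover have "xi_fun s = f s" if "s \<in> {s. Re s > 1}" for s
    using xi_fun_Dirichlet[of s] zeta_reg_eq_Dirichlet_series[of s] that by (simp add: f_def)
  moreover have "s \<in> {s. Re s > 0}" using assms by simp
  ultimately have "xi_fun s = f s"
    using analytic_continuation_open[OF open_halfspace_Re_gt open_halfspace_Re_gt] holomorphic_xi_fun by blast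
  then show ?thesis by (simp add: f_def)
qed

text \<open>
  The two leading Laurent coefficients of the completed zeta function at 1. The derivative collects
  Euler's constant from zeta, \<open>ln pi\<close> from the power of \<open>pi\<close>, and the value of the digamma function at \<open>1/2\<close>
  from the gamma factor; this is the source of the constant \<open>Q_const\<close>.
\<close>
lemma xi_fun_at_1:
  shows "xi_fun 1 = 1"
    and "(xi_fun has_field_derivative of_real (1 + (euler_mascheroni - ln (4 * pi)) / 2)) (at 1)"
proof -
  show 1: "xi_fun 1 = 1" by (simp add: xi_fun_def)
  define c where "c = complex_of_real pi powr (- 1 / 2)"
  have c: "c * Gamma (1 / 2) = 1"
    using xi_fun_eq[of 1] 1 zeta_reg_at_1(1) by (simp add: c_def)
  have L: "Ln (complex_of_real pi) = of_real (ln pi)" by (simp add: Ln_of_real)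
  have ninZ: "(1 / 2 :: complex) \<notin> \<int>\<^sub>\<le>\<^sub>0" by (auto elim!: nonpos_Ints_cases' simp: complex_eq_iff)
  have dp: "((\<lambda>s. of_real pi powr (- s / 2)) has_field_derivative - (1 / 2) * Ln (of_real pi) * c) (at 1)"
    unfolding c_def powr_def by (auto intro!: derivative_eq_intros)
  have dG: "((\<lambda>s. Gamma (s / 2)) has_field_derivative Gamma (1 / 2) * Digamma (1 / 2) * (1 / 2)) (at (1 :: complex))"
    using ninZ by (auto intro!: derivative_eq_intros)
  have "((\<lambda>s. s * of_real pi powr (- s / 2) * Gamma (s / 2) * zeta_reg s) has_field_derivative
     (((1 * of_real pi powr (- 1 / 2) + - (1 / 2) * Ln (of_real pi) * c * 1) * Gamma (1 / 2)
        + Gamma (1 / 2) * Digamma (1 / 2) * (1 / 2) * (1 * of_real pi powr (- 1 / 2))) * zeta_reg 1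
       + of_real euler_mascheroni * (1 * of_real pi powr (- 1 / 2) * Gamma (1 / 2)))) (at 1)"
    by (intro DERIV_mult DERIV_ident dp dG zeta_reg_at_1(2))
  also have "((1 * of_real pi powr (- 1 / 2) + - (1 / 2) * Ln (of_real pi) * c * 1) * Gamma (1 / 2)
        + Gamma (1 / 2) * Digamma (1 / 2) * (1 / 2) * (1 * of_real pi powr (- 1 / 2))) * zeta_reg 1
       + of_real euler_mascheroni * (1 * of_real pi powr (- 1 / 2) * Gamma (1 / 2)) =
       (c * Gamma (1 / 2)) * (1 - (1 / 2) * Ln (of_real pi) + Digamma (1 / 2) * (1 / 2) + of_real euler_mascheroni)"
    unfolding c_def zeta_reg_at_1(1) by (simp add: algebra_simps)
  also have "\<dots> = of_real (1 + (euler_mascheroni - ln (4 * pi)) / 2)"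
  proof -
    have "ln (4 * pi) = 2 * ln 2 + ln pi" using ln_realpow[of 2 2] by (simp add: ln_mult)
    then show ?thesis unfolding c L by (simp add: Digamma_one_half field_simps)
  qed
  finally have *: "((\<lambda>s. s * of_real pi powr (- s / 2) * Gamma (s / 2) * zeta_reg s) has_field_derivative
     of_real (1 + (euler_mascheroni - ln (4 * pi)) / 2)) (at 1)" .
  show "(xi_fun has_field_derivative of_real (1 + (euler_mascheroni - ln (4 * pi)) / 2)) (at 1)"
    by (rule has_field_derivative_transform_within_open[OF *, where S = "{s. Re s > 0}"])
       (auto simp: open_halfspace_Re_gt xi_fun_eq)
qed


section \<open>Decay on vertical strips and the completed zeta function\<close>

lemma norm_Gamma_le:
  assumes z: "Re z > 0"
  shows "norm (Gamma z) \<le> Gamma (Re z)"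
proof -
  have "norm (Gamma z) = norm (LINT v|lborel. exp (z * of_real v - of_real (exp v)))"
    using has_bochner_integral_integral_eq[OF Gamma_exp_integral[OF z]] by simp
  also have "\<dots> \<le> (LINT v|lborel. norm (exp (z * of_real v - of_real (exp v))))"
    by (rule integral_norm_bound)
  also have "\<dots> = (LINT v|lborel. Re (exp (of_real (Re z) * of_real v - of_real (exp v))))"
    by (rule Bochner_Integration.integral_cong) (simp_all add: Re_exp)
  also have "\<dots> = Re (Gamma (of_real (Re z)))"
    by (intro has_bochner_integral_integral_eq has_bochner_integral_bounded_linear[OF bounded_linear_Re]
          Gamma_exp_integral) (use z in simp)
  also have "\<dots> = Gamma (Re z)" by (simp add: Gamma_complex_of_real)
  finally show ?thesis .
qed

lemma norm_pochhammer_ge: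
  assumes "Re z \<ge> 0"
  shows "norm z ^ n \<le> norm (pochhammer z n)"
proof (induction n)
  case (Suc n)
  have "norm z \<le> norm (z + of_nat n)"
    using assms by (auto simp: cmod_def intro!: real_sqrt_le_mono power_mono)
  with Suc have "norm z ^ n * norm z \<le> norm (pochhammer z n) * norm (z + of_nat n)"
    by (intro mult_mono) auto
  then show ?case by (simp add: pochhammer_Suc norm_mult mult.commute)
qed simp

text \<open>
  Shifting the argument by \<open>n\<close> divides by a product of \<open>n\<close> factors, each at least as large as
  \<open>\<bar>z\<bar>\<close>. This yields arbitrary polynomial decay on vertical strips.
\<close>
lemma norm_Gamma_decay:
  assumes z: "Re z > 0"
  shows "norm (Gamma z) \<le> Gamma (Re z + real n) / norm z ^ n"
proof -
  have zn: "z \<notin> \<int>\<^sub>\<le>\<^sub>0" "z \<noteq> 0" using z by (auto elim!: nonpos_Ints_cases')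
  have "norm (Gamma z) * norm z ^ n \<le> norm (Gamma z) * norm (pochhammer z n)"
    using z by (intro mult_left_mono norm_pochhammer_ge) auto
  also have "\<dots> = norm (Gamma (z + of_nat n))"
    using zn by (simp add: pochhammer_Gamma Gamma_eq_zero_iff norm_divide)
  also have "\<dots> \<le> Gamma (Re z + real n)" using norm_Gamma_le[of "z + of_nat n"] z by simp
  finally show ?thesis using zn by (simp add: field_simps)
qed

lemma norm_zeta_reg_le:
  "\<exists>Z\<ge>0. \<forall>s. Re s \<ge> 1/2 \<longrightarrow> norm (zeta_reg s) \<le> 1 + norm s * norm (1 - s) * Z"
proof (intro exI conjI allI impI)
  define a where "a = (\<lambda>n. 1 / real (Suc n) powr (3/2))"
  have a: "summable a" unfolding a_def by (rule summable_Suc_powr) simp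
  show "0 \<le> suminf a" by (intro suminf_nonneg a) (simp add: a_def)
  fix s :: complex assume s: "Re s \<ge> 1/2"
  have le: "norm (zeta_term n s) \<le> norm s * norm (1 - s) * a n" for n
  proof -
    have "norm (zeta_term n s) \<le> norm s * norm (1 - s) * (1 / real (Suc n) powr (Re s + 1))"
      using s by (intro norm_zeta_term_le) auto
    also have "\<dots> \<le> norm s * norm (1 - s) * a n"
      unfolding a_def using s by (intro mult_left_mono divide_left_mono powr_mono mult_pos_pos) auto
    finally show ?thesis .
  qed
  have sm: "summable (\<lambda>n. norm (zeta_term n s))"
    by (rule summable_comparison_test'[OF summable_mult[OF a]]) (use le in auto)
  have "norm (\<Sum>n. zeta_term n s) \<le> (\<Sum>n. norm (zeta_term n s))" by (rule summable_norm[OF sm])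
  also have "\<dots> \<le> (\<Sum>n. norm s * norm (1 - s) * a n)" by (intro suminf_le le sm summable_mult a)
  also have "\<dots> = norm s * norm (1 - s) * suminf a" by (rule suminf_mult[OF a])
  finally show "norm (zeta_reg s) \<le> 1 + norm s * norm (1 - s) * suminf a"
    unfolding zeta_reg_def using norm_triangle_ineq[of 1 "\<Sum>n. zeta_term n s"] by simp
qed

text \<open>
  Zeta times \<open>s - 1\<close> grows at most quadratically for \<open>Re s \<ge> 1/2\<close>, and five shifts of the gamma function
  compensate this growth together with the factors \<open>s\<close> and \<open>1 + (Im s)\<^sup>2\<close>.
\<close>
lemma xi_fun_decay_right:
  "\<exists>C\<ge>0. \<forall>s. 1/2 \<le> Re s \<and> Re s \<le> B \<longrightarrow> norm (xi_fun s) * (1 + (Im s)\<^sup>2) \<le> C"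
proof -
  obtain Z where Z: "Z \<ge> 0" "\<And>s. Re s \<ge> 1/2 \<Longrightarrow> norm (zeta_reg s) \<le> 1 + norm s * norm (1 - s) * Z"
    using norm_zeta_reg_le by blast
  have "compact ((Gamma :: real \<Rightarrow> real) ` {5..5 + \<bar>B\<bar>})"
    by (intro compact_continuous_image continuous_on_Gamma) (auto elim!: nonpos_Ints_cases')
  then obtain G where "\<forall>y\<in>(Gamma :: real \<Rightarrow> real) ` {5..5 + \<bar>B\<bar>}. norm y \<le> G"
    using compact_imp_bounded bounded_iff by blast
  then have G: "\<bar>Gamma t\<bar> \<le> G" if "t \<in> {5..5 + \<bar>B\<bar>}" for t
    using that by auto
  have G0: "G \<ge> 0" using order.trans[OF abs_ge_zero G[of 5]] by auto
  have "norm (xi_fun s) * (1 + (Im s)\<^sup>2) \<le> 160 * G * (4 + 3 * Z)" if s: "1/2 \<le> Re s" "Re s \<le> B" for s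
  proof -
    define r where "r = norm s"
    have r: "1/2 \<le> r" using s(1) complex_Re_le_cmod[of s] by (simp add: r_def)
    have r0: "r > 0" using r by simp
    have one: "1 \<le> 4 * r\<^sup>2" using power_mono[OF r, of 2] by (simp add: power2_eq_square)
    have "norm (xi_fun s) = r * norm (complex_of_real pi powr (- s / 2)) * norm (Gamma (s / 2)) * norm (zeta_reg s)"
      using s by (simp add: xi_fun_eq norm_mult r_def)
    also have "\<dots> \<le> r * 1 * (G * 32 / r ^ 5) * (r\<^sup>2 * (4 + 3 * Z))"
    proof (intro mult_mono)
      show "norm (complex_of_real pi powr (- s / 2)) \<le> 1"
        using powr_mono[of "- Re s / 2" 0 pi] s pi_gt3 by (simp add: norm_of_real_powr)
      have "norm (Gamma (s / 2)) \<le> Gamma (Re (s / 2) + real 5) / norm (s / 2) ^ 5"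
        using s by (intro norm_Gamma_decay) auto
      also have "\<dots> \<le> G / norm (s / 2) ^ 5"
        using G[of "Re (s / 2) + real 5"] s by (intro divide_right_mono) auto
      also have "\<dots> = G * 32 / r ^ 5" by (simp add: r_def norm_divide power_divide)
      finally show "norm (Gamma (s / 2)) \<le> G * 32 / r ^ 5" .
      have "norm (1 - s) \<le> 1 + r" using norm_triangle_ineq4[of 1 s] by (simp add: r_def)
      also have "\<dots> \<le> 3 * r" using r by simp
      finally have "r * norm (1 - s) * Z \<le> r * (3 * r) * Z"
        using r Z by (intro mult_right_mono mult_left_mono) auto
      with Z(2)[OF s(1)] one show "norm (zeta_reg s) \<le> r\<^sup>2 * (4 + 3 * Z)"
        by (simp add: r_def[symmetric] power2_eq_square algebra_simps)
    qed (use r G0 Z in auto)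
    also have "\<dots> = 32 * G * (4 + 3 * Z) / r\<^sup>2" using r0 by (simp add: field_simps eval_nat_numeral)
    finally have "norm (xi_fun s) \<le> 32 * G * (4 + 3 * Z) / r\<^sup>2" .
    moreover have "1 + (Im s)\<^sup>2 \<le> 5 * r\<^sup>2"
      using one cmod_power2[of s] zero_le_power2[of "Re s"] unfolding r_def by linarith
    ultimately have "norm (xi_fun s) * (1 + (Im s)\<^sup>2) \<le> 32 * G * (4 + 3 * Z) / r\<^sup>2 * (5 * r\<^sup>2)"
      using G0 Z by (intro mult_mono) auto
    also have "\<dots> = 160 * G * (4 + 3 * Z)" using r0 by (simp add: field_simps)
    finally show ?thesis .
  qed
  moreover have "0 \<le> 160 * G * (4 + 3 * Z)" using G0 Z by simp
  ultimately show ?thesis by blast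
qed

text \<open>
  The reflection \<open>s \<mapsto> 1 - s\<close> carries the estimate to the left half of the strip.
\<close>
lemma xi_fun_decay:
  "\<exists>C\<ge>0. \<forall>s. \<bar>Re s\<bar> \<le> B \<longrightarrow> norm (xi_fun s) * (1 + (Im s)\<^sup>2) \<le> C"
proof -
  obtain C where C: "C \<ge> 0" "\<And>s. 1/2 \<le> Re s \<Longrightarrow> Re s \<le> 1 + B \<Longrightarrow> norm (xi_fun s) * (1 + (Im s)\<^sup>2) \<le> C"
    using xi_fun_decay_right[of "1 + B"] by blast
  have "norm (xi_fun s) * (1 + (Im s)\<^sup>2) \<le> C" if "\<bar>Re s\<bar> \<le> B" for s
  proof (cases "Re s \<ge> 1/2")
    case False
    then show ?thesis using C(2)[of "1 - s"] that by (simp add: xi_fun_reflect)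
  qed (use C(2)[of s] that in auto)
  with C(1) show ?thesis by blast
qed

text \<open>
  The continuation written with the entire function \<open>rGamma\<close>. The gamma factor is shifted by one so that
  the factor \<open>s\<close> of \<open>xi_fun\<close> cancels without leaving a spurious singularity at 0.
\<close>
definition zeta_continued :: "complex \<Rightarrow> complex" where
  "zeta_continued s = (if s = 1 then 0 else
     xi_fun s * of_real pi powr (s / 2) * rGamma (s / 2 + 1) / (2 * (s - 1)))"

lemma holomorphic_zeta_continued: "zeta_continued holomorphic_on - {1}"
proof -
  have "(\<lambda>s. xi_fun s * of_real pi powr (s / 2) * rGamma (s / 2 + 1) / (2 * (s - 1))) holomorphic_on - {1}"
    by (intro holomorphic_intros holomorphic_xi_fun) auto
  then show ?thesis by (rule holomorphic_transform) (simp add: zeta_continued_def)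
qed

lemma zeta_continued_Dirichlet:
  assumes s: "Re s > 1"
  shows "zeta_continued s = (\<Sum>n. 1 / of_nat (Suc n) powr s)"
proof -
  have nz: "s \<noteq> 0" "s \<noteq> 1" "s / 2 \<notin> \<int>\<^sub>\<le>\<^sub>0" using s by (auto elim!: nonpos_Ints_cases')
  have G: "Gamma (s / 2) \<noteq> 0" using nz by (simp add: Gamma_eq_zero_iff)
  have "s / 2 * rGamma (s / 2 + 1) = inverse (Gamma (s / 2))"
    using rGamma_plus1[of "s / 2"] by (simp only: rGamma_inverse_Gamma[of "s / 2"])
  then have "s * rGamma (s / 2 + 1) * Gamma (s / 2) = 2" using G by (simp add: field_simps)
  moreover have "of_real pi powr (- s / 2) * of_real pi powr (s / 2) = (1 :: complex)"
    by (simp flip: powr_add)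
  moreover have "zeta_continued s = (s * rGamma (s / 2 + 1) * Gamma (s / 2)) * (of_real pi powr (- s / 2) * of_real pi powr (s / 2))
       * (\<Sum>n. 1 / of_nat (Suc n) powr s) * ((s - 1) / (2 * (s - 1)))"
    unfolding zeta_continued_def xi_fun_Dirichlet[OF s] using nz by (simp add: mult_ac)
  moreover have "(s - 1) / (2 * (s - 1)) = 1 / 2"
    using nonzero_divide_mult_cancel_right[of "s - 1" 2] nz by simp
  ultimately show ?thesis by (simp only:) simp
qed

lemma riemann_zeta_eq: "riemann_zeta = zeta_continued"
  unfolding riemann_zeta_def
proof (rule the_equality)
  show "zeta_continued holomorphic_on - {1} \<and>
    (\<forall>s. Re s > 1 \<longrightarrow> zeta_continued s = (\<Sum>n. 1 / of_nat (Suc n) powr s)) \<and> zeta_continued 1 = 0"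
    by (simp add: holomorphic_zeta_continued zeta_continued_Dirichlet) (simp add: zeta_continued_def)
next
  fix f assume f: "f holomorphic_on - {1} \<and>
    (\<forall>s. Re s > 1 \<longrightarrow> f s = (\<Sum>n. 1 / of_nat (Suc n) powr s)) \<and> f 1 = 0"
  have ne: "{s. Re s > 1} \<noteq> {}" using complex_Re_of_nat[of 2] by (metis (mono_tags) empty_Collect_eq of_nat_numeral one_less_numeral_iff semiring_norm(76))
  have sub: "{s. Re s > 1} \<subseteq> - {1}" by auto
  have con: "connected (- {1 :: complex})" by (rule connected_punctured_universe) simp
  have op: "open (- {1 :: complex})" by auto
  show "f = zeta_continued"
  proof
    fix s
    show "f s = zeta_continued s"
    proof (cases "s = 1")
      case False
      show ?thesis
        by (rule analytic_continuation_open[OF open_halfspace_Re_gt op ne con sub])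
           (use f holomorphic_zeta_continued zeta_continued_Dirichlet False in auto)
    qed (use f in \<open>simp add: zeta_continued_def\<close>)
  qed
qed

text \<open>
  The poles of \<open>Gamma (s / 2)\<close> are isolated, so near any point the formula for the
  completed zeta function can be evaluated literally.
\<close>
lemma eventually_half_notin_nonpos_Ints:
  "eventually (\<lambda>z::complex. z / 2 \<notin> \<int>\<^sub>\<le>\<^sub>0) (at s)"
proof (cases "s / 2 \<in> \<int>\<^sub>\<le>\<^sub>0")
  case False
  have "open (- (\<int>\<^sub>\<le>\<^sub>0 :: complex set))" by auto
  then have "open ((\<lambda>z::complex. z / 2) -` (- \<int>\<^sub>\<le>\<^sub>0))" by (intro open_vimage continuous_intros) auto
  with False have "eventually (\<lambda>z. z \<in> (\<lambda>z. z / 2) -` (- \<int>\<^sub>\<le>\<^sub>0)) (nhds s)"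
    by (intro eventually_nhds_in_open) auto
  then show ?thesis by (auto simp: eventually_at_filter elim!: eventually_mono)
next
  case True
  then obtain m :: nat where m: "s / 2 = - of_nat m" by (auto elim!: nonpos_Ints_cases')
  have "eventually (\<lambda>z. z \<in> ball s 1 - {s}) (at s)" by (rule eventually_at_in_open) auto
  then show ?thesis
  proof eventually_elim
    case (elim z)
    show ?case
    proof
      assume "z / 2 \<in> \<int>\<^sub>\<le>\<^sub>0"
      then obtain k :: nat where k: "z / 2 = - of_nat k" by (auto elim!: nonpos_Ints_cases')
      have "z - s = of_int (2 * (int m - int k))" using m k by (simp add: field_simps)
      moreover have "norm (z - s) < 1" using elim by (simp add: dist_norm norm_minus_commute)
      ultimately have "\<bar>2 * (int m - int k)\<bar> < 1"
        by (metis norm_of_int of_int_abs of_int_less_1_iff)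
      then have "m = k" by arith
      with m k elim show False by simp
    qed
  qed
qed

lemma completed_zeta_eq:
  assumes s: "s \<noteq> 0" "s \<noteq> 1"
  shows "completed_zeta s = xi_fun s / (s * (s - 1))"
  unfolding completed_zeta_def
proof (rule remove_sings_eqI)
  have "isCont xi_fun s"
    using holomorphic_xi_fun[of UNIV] holomorphic_on_imp_continuous_on continuous_on_eq_continuous_at by blast
  then have "isCont (\<lambda>s. xi_fun s / (s * (s - 1))) s" using s by (intro continuous_intros) auto
  then have lim: "(\<lambda>s. xi_fun s / (s * (s - 1))) \<midarrow>s\<rightarrow> xi_fun s / (s * (s - 1))" by (rule isContD)
  have "eventually (\<lambda>z. z \<in> - {0, 1}) (at s)"
    using s by (intro eventually_at_in_open') auto
  with eventually_half_notin_nonpos_Ints[of s]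
  have "eventually (\<lambda>z. xi_fun z / (z * (z - 1)) = of_real pi powr (- z / 2) * Gamma (z / 2) * riemann_zeta z) (at s)"
  proof eventually_elim
    case (elim z)
    have nz: "z \<noteq> 0" "z \<noteq> 1" "Gamma (z / 2) \<noteq> 0" using elim by (auto simp: Gamma_eq_zero_iff)
    have "z / 2 * rGamma (z / 2 + 1) = inverse (Gamma (z / 2))"
      using rGamma_plus1[of "z / 2"] by (simp only: rGamma_inverse_Gamma[of "z / 2"])
    then have 1: "Gamma (z / 2) * rGamma (z / 2 + 1) = 2 / z" using nz by (simp add: field_simps)
    have 2: "of_real pi powr (- z / 2) * of_real pi powr (z / 2) = (1 :: complex)"
      by (simp flip: powr_add)
    have "of_real pi powr (- z / 2) * Gamma (z / 2) * riemann_zeta z =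
      (of_real pi powr (- z / 2) * of_real pi powr (z / 2)) * (Gamma (z / 2) * rGamma (z / 2 + 1)) * xi_fun z / (2 * (z - 1))"
      using nz by (simp add: riemann_zeta_eq zeta_continued_def mult_ac)
    also have "\<dots> = xi_fun z / (z * (z - 1))" unfolding 1 2 using nz by (simp add: divide_simps)
    finally show ?case by simp
  qed
  from Lim_transform_eventually[OF lim this]
  show "(\<lambda>s. of_real pi powr (- s / 2) * Gamma (s / 2) * riemann_zeta s) \<midarrow>s\<rightarrow> xi_fun s / (s * (s - 1))" .
qed


section \<open>Moving a vertical line across the double pole\<close>

lemma integral_symmetric_interval_tendsto:
  fixes f :: "real \<Rightarrow> complex"
  assumes f: "integrable lborel f"
  shows "(\<lambda>n. integral {- real (Suc n)..real (Suc n)} f) \<longlonglongrightarrow> (LINT t|lborel. f t)"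
proof -
  note [measurable] = borel_measurable_integrable[OF f]
  have "(\<lambda>n. LINT t|lborel. indicator {- real (Suc n)..real (Suc n)} t *\<^sub>R f t) \<longlonglongrightarrow> (LINT t|lborel. f t)"
  proof (rule integral_dominated_convergence)
    show "integrable lborel (\<lambda>t. norm (f t))" using f by simp
    show "AE t in lborel. (\<lambda>n. indicator {- real (Suc n)..real (Suc n)} t *\<^sub>R f t) \<longlonglongrightarrow> f t"
    proof (rule AE_I2)
      fix t
      obtain N :: nat where N: "\<bar>t\<bar> \<le> real N" using real_arch_simple by blast
      have "eventually (\<lambda>n. indicator {- real (Suc n)..real (Suc n)} t *\<^sub>R f t = f t) sequentially"
        using eventually_ge_at_top[of N] by eventually_elim (use N in \<open>auto simp: indicator_def abs_le_iff\<close>)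
      then show "(\<lambda>n. indicator {- real (Suc n)..real (Suc n)} t *\<^sub>R f t) \<longlonglongrightarrow> f t"
        by (rule tendsto_eventually)
    qed
    show "AE t in lborel. norm (indicator {- real (Suc n)..real (Suc n)} t *\<^sub>R f t) \<le> norm (f t)" for n
      by (auto simp: indicator_def)
  qed measurable
  moreover have "(LINT t|lborel. indicator {- real (Suc n)..real (Suc n)} t *\<^sub>R f t) =
      integral {- real (Suc n)..real (Suc n)} f" for n
  proof -
    have "set_integrable lborel {- real (Suc n)..real (Suc n)} f"
      unfolding set_integrable_def using f by (intro integrable_mult_indicator) auto
    from set_borel_integral_eq_integral(2)[OF this] show ?thesis
      by (simp add: set_lebesgue_integral_def)
  qed
  ultimately show ?thesis by simp
qed

text \<open>
  The residue theorem on the rectangle between the two lines, cut off at height \<open>T\<close>. The residue of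
  \<open>h s / (s - p)\<^sup>2\<close> at the double pole is the derivative of \<open>h\<close>, and the quadratic decay removes the horizontal
  sides as \<open>T\<close> grows.
\<close>
theorem vertical_line_shift:
  fixes h :: "complex \<Rightarrow> complex" and p :: complex and c1 c2 C :: real
  defines "f \<equiv> (\<lambda>s. h s / (s - p)\<^sup>2)"
  assumes h: "h holomorphic_on UNIV" and c: "c1 < Re p" "Re p < c2"
    and bound: "\<And>s. c1 \<le> Re s \<Longrightarrow> Re s \<le> c2 \<Longrightarrow> s \<noteq> p \<Longrightarrow> 1 \<le> \<bar>Im s - Im p\<bar> \<Longrightarrow> norm (f s) \<le> C / (1 + (Im s)\<^sup>2)"
    and int1: "integrable lborel (\<lambda>t. f (Complex c1 t))"
    and int2: "integrable lborel (\<lambda>t. f (Complex c2 t))"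
  shows "(LINT t|lborel. f (Complex c2 t)) - (LINT t|lborel. f (Complex c1 t)) = 2 * pi * deriv h p"
proof -
  have hol: "f holomorphic_on UNIV - {p}"
    unfolding f_def by (intro holomorphic_intros holomorphic_on_subset[OF h]) auto
  have op: "open (UNIV - {p})" by auto
  define T where "T = (\<lambda>n::nat. real (Suc n))"
  let ?I = "\<lambda>c n. integral {- T n..T n} (\<lambda>t. f (Complex c t))"
  let ?L = "\<lambda>c. LINT t|lborel. f (Complex c t)"
  define H where "H = (\<lambda>n. contour_integral (linepath (Complex c1 (- T n)) (Complex c2 (- T n))) f
     + contour_integral (linepath (Complex c2 (T n)) (Complex c1 (T n))) f)"
  obtain N :: nat where N: "\<bar>Im p\<bar> + 1 \<le> real N" using real_arch_simple by blast
  have Tn: "\<bar>Im p\<bar> + 1 \<le> T n" if "n \<ge> N" for n using N that by (simp add: T_def)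
  have rect: "H n + \<i> * ?I c2 n - \<i> * ?I c1 n
      = 2 * pi * \<i> * deriv h p" if "n \<ge> N" for n
  proof -
    have T: "T n > 0" "\<bar>Im p\<bar> < T n" using Tn[OF that] by auto
    define a1 a2 a3 a4 where a: "a1 = Complex c1 (- T n)" "a2 = Complex c2 (- T n)" "a3 = Complex c2 (T n)" "a4 = Complex c1 (T n)"
    have pbox: "p \<in> box a1 a3" using T c by (auto simp: a in_box_complex_iff)
    have img: "path_image (rectpath a1 a3) \<subseteq> UNIV - {p}"
      using pbox path_image_rectpath_inter_box[of a1 a3] T c by (auto simp: a)
    have "contour_integral (rectpath a1 a3) f = 2 * pi * \<i> * (\<Sum>q\<in>{p}. winding_number (rectpath a1 a3) q * residue f q)"
      by (rule Residue_theorem[where S = UNIV]) (use hol img in auto)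
    also have "\<dots> = 2 * pi * \<i> * deriv h p"
      using winding_number_rectpath[OF pbox] residue_holomorphic_over_power[of UNIV p h 1] h
      by (simp add: f_def numeral_2_eq_2)
    finally have res: "contour_integral (rectpath a1 a3) f = 2 * pi * \<i> * deriv h p" .
    have seg: "path_image (rectpath a1 a3) = closed_segment a1 a2 \<union> closed_segment a2 a3 \<union> closed_segment a3 a4 \<union> closed_segment a4 a1"
      by (simp add: rectpath_def Let_def path_image_join a Un_assoc)
    have ci: "f contour_integrable_on (linepath b b')" if "closed_segment b b' \<subseteq> path_image (rectpath a1 a3)" for b b'
      by (rule contour_integrable_holomorphic_simple[OF hol op]) (use that img in auto)
    have ci': "f contour_integrable_on (linepath a1 a2)" "f contour_integrable_on (linepath a2 a3)"
       "f contour_integrable_on (linepath a3 a4)" "f contour_integrable_on (linepath a4 a1)"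
      by (rule ci; simp add: seg Un_assoc; blast)+
    have "contour_integral (rectpath a1 a3) f = contour_integral (linepath a1 a2) f + (contour_integral (linepath a2 a3) f
        + (contour_integral (linepath a3 a4) f + contour_integral (linepath a4 a1) f))"
    proof -
      have "rectpath a1 a3 = linepath a1 a2 +++ linepath a2 a3 +++ linepath a3 a4 +++ linepath a4 a1"
        by (simp add: rectpath_def Let_def a)
      then show ?thesis using ci' by simp
    qed
    moreover have "contour_integral (linepath a2 a3) f = \<i> * ?I c2 n"
      by (rule contour_integral_linepath_same_Re) (use T in \<open>auto simp: a\<close>)
    moreover have "contour_integral (linepath a4 a1) f = - contour_integral (linepath a1 a4) f"
      using contour_integral_reversepath[of "linepath a1 a4" f] by simp
    moreover have "contour_integral (linepath a1 a4) f = \<i> * ?I c1 n"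
      by (rule contour_integral_linepath_same_Re) (use T in \<open>auto simp: a\<close>)
    ultimately show ?thesis using res by (simp add: H_def a algebra_simps)
  qed
  have horiz: "norm (contour_integral (linepath (Complex b y) (Complex b' y)) f) \<le> \<bar>C\<bar> / (1 + y\<^sup>2) * (c2 - c1)"
    if y: "1 \<le> \<bar>y - Im p\<bar>" and b: "{b, b'} = {c1, c2}" for b b' y
  proof -
    have seg: "c1 \<le> Re s \<and> Re s \<le> c2 \<and> Im s = y" if "s \<in> closed_segment (Complex b y) (Complex b' y)" for s
    proof -
      have "Im s = y" "Re s \<in> closed_segment b b'"
        using that by (simp_all add: closed_segment_same_Im)
      then show ?thesis using b c by (auto simp: doubleton_eq_iff closed_segment_eq_real_ivl split: if_splits)
    qed
    have "norm (contour_integral (linepath (Complex b y) (Complex b' y)) f) \<le> \<bar>C\<bar> / (1 + y\<^sup>2) * norm (Complex b' y - Complex b y)"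
    proof (rule contour_integral_bound_linepath)
      show "f contour_integrable_on linepath (Complex b y) (Complex b' y)"
        by (rule contour_integrable_holomorphic_simple[OF hol op]) (use seg y in auto)
      fix s assume "s \<in> closed_segment (Complex b y) (Complex b' y)"
      from seg[OF this] y have "norm (f s) \<le> C / (1 + (Im s)\<^sup>2)" and Im: "Im s = y" by (auto intro!: bound)
      note this(1)
      also have "C / (1 + (Im s)\<^sup>2) \<le> \<bar>C\<bar> / (1 + (Im s)\<^sup>2)" by (intro divide_right_mono) auto
      finally show "norm (f s) \<le> \<bar>C\<bar> / (1 + y\<^sup>2)" using Im by simp
    qed auto
    also have "norm (Complex b' y - Complex b y) = c2 - c1"
      using b c by (auto simp: doubleton_eq_iff complex_diff cmod_def)
    finally show ?thesis .
  qed
  have "H \<longlonglongrightarrow> 0"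
  proof (rule Lim_null_comparison)
    show "eventually (\<lambda>n. norm (H n) \<le> 2 * (\<bar>C\<bar> / (1 + (T n)\<^sup>2) * (c2 - c1))) sequentially"
      using eventually_ge_at_top[of N]
    proof eventually_elim
      case (elim n)
      note t = Tn[OF elim]
      have "norm (contour_integral (linepath (Complex c1 (- T n)) (Complex c2 (- T n))) f) \<le> \<bar>C\<bar> / (1 + (- T n)\<^sup>2) * (c2 - c1)"
        by (rule horiz) (use t in auto)
      moreover have "norm (contour_integral (linepath (Complex c2 (T n)) (Complex c1 (T n))) f) \<le> \<bar>C\<bar> / (1 + (T n)\<^sup>2) * (c2 - c1)"
        by (rule horiz) (use t in auto)
      ultimately show ?case unfolding H_def
        by (intro order.trans[OF norm_triangle_ineq]) simp
    qed
    show "(\<lambda>n. 2 * (\<bar>C\<bar> / (1 + (T n)\<^sup>2) * (c2 - c1))) \<longlonglongrightarrow> 0"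
      unfolding T_def by real_asymp
  qed
  then have "(\<lambda>n. H n + \<i> * ?I c2 n - \<i> * ?I c1 n)
      \<longlonglongrightarrow> 0 + \<i> * ?L c2 - \<i> * ?L c1"
    unfolding T_def
    by (intro tendsto_add tendsto_diff tendsto_mult tendsto_const integral_symmetric_interval_tendsto int1 int2)
  moreover have "eventually (\<lambda>n. H n + \<i> * ?I c2 n - \<i> * ?I c1 n
      = 2 * pi * \<i> * deriv h p) sequentially"
    using eventually_ge_at_top[of N] by eventually_elim (rule rect)
  then have "(\<lambda>n. H n + \<i> * ?I c2 n - \<i> * ?I c1 n)
      \<longlonglongrightarrow> 2 * pi * \<i> * deriv h p" by (rule tendsto_eventually)
  ultimately have "0 + \<i> * ?L c2 - \<i> * ?L c1 = 2 * pi * \<i> * deriv h p"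
    by (rule LIMSEQ_unique)
  then have "\<i> * (?L c2 - ?L c1) = \<i> * (2 * pi * deriv h p)"
    by (simp add: algebra_simps)
  then show ?thesis by (simp only: mult_cancel_left) simp
qed

text \<open>
  The factor \<open>(2 * s) ^ 4\<close> times the square of the completed zeta function. The double pole at 0
  is cancelled by the fourth power, which leaves a double pole at 1 only.
\<close>
definition R_kernel :: "complex \<Rightarrow> complex" where
  "R_kernel s = 16 * s\<^sup>2 * (xi_fun s)\<^sup>2 / (s - 1)\<^sup>2"

lemma R_kernel_eq:
  assumes "s \<noteq> 0" "s \<noteq> 1"
  shows "(2 * s) ^ 4 * (completed_zeta s)\<^sup>2 = R_kernel s"
proof -
  have "(2 * s) ^ 4 * (xi_fun s / (s * (s - 1)))\<^sup>2 = R_kernel s"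
    unfolding R_kernel_def power_divide power_mult_distrib using assms
    by (simp add: divide_simps)
  then show ?thesis by (simp add: completed_zeta_eq assms)
qed

lemma R_kernel_bound:
  assumes \<eta>: "\<eta> > 0"
  shows "\<exists>C\<ge>0. \<forall>s. \<bar>Re s\<bar> \<le> B \<and> \<eta> \<le> norm (s - 1) \<longrightarrow> norm (R_kernel s) \<le> C / (1 + (Im s)\<^sup>2)"
proof -
  obtain K where K: "K \<ge> 0" "\<And>s. \<bar>Re s\<bar> \<le> B \<Longrightarrow> norm (xi_fun s) * (1 + (Im s)\<^sup>2) \<le> K"
    using xi_fun_decay[of B] by blast
  \<comment> \<open>One of the two factors \<open>1 + (Im s)\<^sup>2\<close> from the decay of the square is spent on \<open>s\<^sup>2\<close>.\<close>
  define C where "C = 16 * (1 + B\<^sup>2) * K\<^sup>2 / \<eta>\<^sup>2"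
  have "norm (R_kernel s) \<le> C / (1 + (Im s)\<^sup>2)" if s: "\<bar>Re s\<bar> \<le> B" "\<eta> \<le> norm (s - 1)" for s
  proof -
    define q where "q = 1 + (Im s)\<^sup>2"
    have q: "q \<ge> 1" by (simp add: q_def)
    have "(Re s)\<^sup>2 \<le> B\<^sup>2" using power_mono[OF s(1), of 2] by simp
    moreover have "0 \<le> B\<^sup>2 * (Im s)\<^sup>2" by simp
    ultimately have "(norm s)\<^sup>2 \<le> (1 + B\<^sup>2) * q" unfolding q_def cmod_power2 distrib_left distrib_right by linarith
    moreover have "norm (xi_fun s) \<le> K / q" using K(2)[OF s(1)] q by (simp add: q_def[symmetric] pos_le_divide_eq)
    then have "(norm (xi_fun s))\<^sup>2 \<le> (K / q)\<^sup>2" by (intro power_mono) auto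
    moreover have "\<eta>\<^sup>2 \<le> (norm (s - 1))\<^sup>2" using \<eta> s by (intro power_mono) auto
    ultimately have "16 * (norm s)\<^sup>2 * (norm (xi_fun s))\<^sup>2 / (norm (s - 1))\<^sup>2 \<le> 16 * ((1 + B\<^sup>2) * q) * (K / q)\<^sup>2 / \<eta>\<^sup>2"
      using \<eta> q by (intro frac_le mult_mono) auto
    also have "\<dots> = C / q" using q \<eta> by (simp add: C_def field_simps power2_eq_square)
    finally show ?thesis by (simp add: R_kernel_def norm_mult norm_divide norm_power q_def)
  qed
  moreover have "C \<ge> 0" by (simp add: C_def)
  ultimately show ?thesis by blast
qed

lemma line_distance_from_1: "\<bar>c - 1\<bar> \<le> norm (Complex c t - 1)"
  using abs_Re_le_cmod[of "Complex c t - 1"] by simp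

lemma continuous_on_vertical_line: "continuous_on UNIV (\<lambda>t. Complex c t)"
  by (simp add: Complex_eq) (intro continuous_intros)

lemma continuous_on_kernel_line:
  assumes "c \<noteq> 1" "X > 0"
  shows "continuous_on UNIV (\<lambda>t. R_kernel (Complex c t) * of_real X powr Complex c t)"
proof -
  have xi: "continuous_on UNIV (\<lambda>t. xi_fun (Complex c t))"
    by (rule continuous_on_compose2[OF holomorphic_on_imp_continuous_on[OF holomorphic_xi_fun[of UNIV]] continuous_on_vertical_line]) auto
  have "(Complex c t - 1)\<^sup>2 \<noteq> 0" for t
    using assms line_distance_from_1[of c t] by auto
  then show ?thesis unfolding R_kernel_def using assms
    by (intro continuous_intros xi continuous_on_vertical_line) auto
qed

lemma integrable_kernel_line:
  assumes c: "c \<noteq> 1" and X: "X > 0"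
  shows "integrable lborel (\<lambda>t. R_kernel (Complex c t) * of_real X powr Complex c t)"
proof -
  obtain C where C: "C \<ge> 0" "\<And>s. \<bar>Re s\<bar> \<le> \<bar>c\<bar> \<Longrightarrow> \<bar>c - 1\<bar> \<le> norm (s - 1) \<Longrightarrow> norm (R_kernel s) \<le> C / (1 + (Im s)\<^sup>2)"
    using R_kernel_bound[of "\<bar>c - 1\<bar>" "\<bar>c\<bar>"] c by auto
  have [measurable]: "(\<lambda>t. R_kernel (Complex c t) * of_real X powr Complex c t) \<in> borel_measurable borel"
    by (intro borel_measurable_continuous_onI continuous_on_kernel_line c X)
  show ?thesis
  proof (rule Bochner_Integration.integrable_bound)
    show "integrable lborel (\<lambda>t. C * X powr c * (1 / (1 + t\<^sup>2)))"
      by (intro integrable_mult_right integrable_inverse_one_plus_square)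
    show "AE t in lborel. norm (R_kernel (Complex c t) * of_real X powr Complex c t) \<le> norm (C * X powr c * (1 / (1 + t\<^sup>2)))"
    proof (rule AE_I2)
      fix t
      have "norm (R_kernel (Complex c t)) \<le> C / (1 + t\<^sup>2)"
        using C(2)[of "Complex c t"] line_distance_from_1[of c t] by simp
      then have "norm (R_kernel (Complex c t)) * X powr c \<le> C / (1 + t\<^sup>2) * X powr c"
        by (intro mult_right_mono) auto
      then show "norm (R_kernel (Complex c t) * of_real X powr Complex c t) \<le> norm (C * X powr c * (1 / (1 + t\<^sup>2)))"
        using X C by (simp add: norm_mult norm_of_real_powr abs_mult mult_ac)
    qed
  qed measurable
qed

text \<open>
  The inverse Mellin transform of the kernel along the line \<open>Re s = c\<close>, in the variable \<open>1 / X\<close>.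
\<close>
definition line_mean :: "real \<Rightarrow> real \<Rightarrow> complex" where
  "line_mean c X = (LINT t|lborel. R_kernel (Complex c t) * of_real X powr Complex c t) / (2 * pi)"

text \<open>
  Crossing the pole at 1 adds the derivative there of \<open>16 * s\<^sup>2 * (xi_fun s)\<^sup>2 * X powr s\<close>. The
  power of \<open>s\<close> contributes 2, the square of \<open>xi_fun\<close> contributes twice its derivative, and \<open>X powr s\<close> contributes \<open>ln X\<close>.
\<close>
lemma line_mean_shift:
  assumes c: "c1 < 1" "1 < c2" and X: "X > 0"
  shows "line_mean c2 X - line_mean c1 X = of_real (16 * X * (4 + ln X + euler_mascheroni - ln (4 * pi)))"
proof -
  define h where "h = (\<lambda>s. 16 * s\<^sup>2 * (xi_fun s)\<^sup>2 * of_real X powr s)"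
  have kh: "R_kernel s * of_real X powr s = h s / (s - 1)\<^sup>2" for s
    by (simp add: R_kernel_def h_def)
  have hol: "h holomorphic_on UNIV"
    unfolding h_def by (intro holomorphic_intros holomorphic_xi_fun)
  define B where "B = \<bar>c1\<bar> + \<bar>c2\<bar>"
  obtain C where C: "C \<ge> 0" "\<And>s. \<bar>Re s\<bar> \<le> B \<Longrightarrow> 1 \<le> norm (s - 1) \<Longrightarrow> norm (R_kernel s) \<le> C / (1 + (Im s)\<^sup>2)"
    using R_kernel_bound[of 1 B] by auto
  define M where "M = X powr c1 + X powr c2"
  have bound: "norm (h s / (s - 1)\<^sup>2) \<le> C * M / (1 + (Im s)\<^sup>2)"
    if s: "c1 \<le> Re s" "Re s \<le> c2" "1 \<le> \<bar>Im s - Im 1\<bar>" for s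
  proof -
    have "1 \<le> norm (s - 1)" using abs_Im_le_cmod[of "s - 1"] s by simp
    moreover have "\<bar>Re s\<bar> \<le> B" using s by (auto simp: B_def)
    ultimately have "norm (R_kernel s) \<le> C / (1 + (Im s)\<^sup>2)" by (intro C)
    moreover have "X powr Re s \<le> M"
    proof (cases "X \<ge> 1")
      case True
      then have "X powr Re s \<le> X powr c2" using s by (intro powr_mono) auto
      then show ?thesis by (simp add: M_def add_increasing)
    next
      case False
      then have "X powr Re s \<le> X powr c1" using s X by (intro powr_mono') auto
      then show ?thesis by (simp add: M_def add_increasing2)
    qed
    ultimately have "norm (R_kernel s) * X powr Re s \<le> C / (1 + (Im s)\<^sup>2) * M"
      using C by (intro mult_mono) auto
    then show ?thesis unfolding kh[symmetric] using X by (simp add: norm_mult norm_of_real_powr)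
  qed
  have "(LINT t|lborel. h (Complex c2 t) / (Complex c2 t - 1)\<^sup>2) - (LINT t|lborel. h (Complex c1 t) / (Complex c1 t - 1)\<^sup>2)
     = 2 * pi * deriv h 1"
  proof (rule vertical_line_shift[OF hol, of c1 1 c2 "C * M"])
    show "integrable lborel (\<lambda>t. h (Complex c1 t) / (Complex c1 t - 1)\<^sup>2)"
         "integrable lborel (\<lambda>t. h (Complex c2 t) / (Complex c2 t - 1)\<^sup>2)"
      unfolding kh[symmetric] using c X by (auto intro!: integrable_kernel_line)
  qed (use c bound in auto)
  moreover have "deriv h 1 = of_real (16 * X * (4 + ln X + euler_mascheroni - ln (4 * pi)))"
  proof (rule DERIV_imp_deriv)
    define e where "e = (of_real (1 + (euler_mascheroni - ln (4 * pi)) / 2) :: complex)"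
    have dX: "((\<lambda>s. of_real X powr s) has_field_derivative Ln (of_real X) * of_real X powr 1) (at 1)"
      using X by (intro has_field_derivative_powr_right) auto
    have "(h has_field_derivative (16 * (2 * 1) * (xi_fun 1)\<^sup>2 + 2 * xi_fun 1 * e * (16 * 1\<^sup>2)) * of_real X powr 1
        + Ln (of_real X) * of_real X powr 1 * (16 * 1\<^sup>2 * (xi_fun 1)\<^sup>2)) (at 1)"
      unfolding h_def
      by (rule DERIV_mult[OF DERIV_mult dX])
         (auto intro!: derivative_eq_intros xi_fun_at_1(2)[folded e_def])
    then show "(h has_field_derivative of_real (16 * X * (4 + ln X + euler_mascheroni - ln (4 * pi)))) (at 1)"
      by (rule DERIV_cong) (use X in \<open>simp add: xi_fun_at_1(1) e_def Ln_of_real powr_to_1 field_simps\<close>)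
  qed
  ultimately show ?thesis
    unfolding line_mean_def kh by (simp add: field_simps)
qed


section \<open>V as an integral over a vertical line\<close>

text \<open>
  The completed zeta function away from its poles; \<open>completed_zeta_eq\<close> is the link.
\<close>
definition zhat :: "complex \<Rightarrow> complex" where
  "zhat s = xi_fun s / (s * (s - 1))"

lemma zhat_reflect: "zhat (1 - s) = zhat s"
  unfolding zhat_def xi_fun_reflect by (simp add: algebra_simps)

lemma zhat_line_bound:
  assumes c: "c > 1"
  shows "\<exists>C\<ge>0. \<forall>t. norm (zhat (Complex c t)) \<le> C / (1 + t\<^sup>2)"
proof -
  obtain K where K: "K \<ge> 0" "\<And>s. \<bar>Re s\<bar> \<le> c \<Longrightarrow> norm (xi_fun s) * (1 + (Im s)\<^sup>2) \<le> K"
    using xi_fun_decay[of c] by blast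
  have "norm (zhat (Complex c t)) \<le> (K / (c - 1)) / (1 + t\<^sup>2)" for t
  proof -
    have q: "1 + t\<^sup>2 > 0" by (simp add: add_pos_nonneg)
    have "norm (xi_fun (Complex c t)) \<le> K / (1 + t\<^sup>2)"
      using K(2)[of "Complex c t"] c q by (simp add: pos_le_divide_eq)
    moreover have "1 \<le> norm (Complex c t)" using abs_Re_le_cmod[of "Complex c t"] c by simp
    moreover have "c - 1 \<le> norm (Complex c t - 1)" using line_distance_from_1[of c t] c by simp
    ultimately have "norm (xi_fun (Complex c t)) / (norm (Complex c t) * norm (Complex c t - 1))
        \<le> K / (1 + t\<^sup>2) / (1 * (c - 1))"
      using c K by (intro frac_le mult_mono mult_pos_pos) auto
    then show ?thesis by (simp add: zhat_def norm_divide norm_mult mult.commute)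
  qed
  moreover have "K / (c - 1) \<ge> 0" using K c by simp
  ultimately show ?thesis by blast
qed

lemma continuous_on_zhat_line:
  assumes c: "c > 1"
  shows "continuous_on UNIV (\<lambda>t. zhat (Complex c t))"
proof -
  have xi: "continuous_on UNIV (\<lambda>t. xi_fun (Complex c t))"
    by (rule continuous_on_compose2[OF holomorphic_on_imp_continuous_on[OF holomorphic_xi_fun[of UNIV]] continuous_on_vertical_line]) auto
  have "Complex c t \<noteq> 0" "Complex c t - 1 \<noteq> 0" for t
    using c line_distance_from_1[of c t] by (auto simp: complex_eq_iff)
  then have "Complex c t * (Complex c t - 1) \<noteq> 0" for t by simp
  then show ?thesis unfolding zhat_def
    by (intro continuous_intros xi continuous_on_vertical_line) auto
qed

lemma integrable_zhat_line:
  assumes c: "c > 1"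
  shows "integrable lborel (\<lambda>t. zhat (Complex c t))"
proof -
  obtain C where C: "C \<ge> 0" "\<And>t. norm (zhat (Complex c t)) \<le> C / (1 + t\<^sup>2)"
    using zhat_line_bound[OF c] by blast
  show ?thesis
  proof (rule Bochner_Integration.integrable_bound)
    show "integrable lborel (\<lambda>t. C * (1 / (1 + t\<^sup>2)))"
      by (intro integrable_mult_right integrable_inverse_one_plus_square)
    show "(\<lambda>t. zhat (Complex c t)) \<in> borel_measurable lborel"
      using borel_measurable_continuous_onI[OF continuous_on_zhat_line[OF c]] by simp
  qed (use C in \<open>auto simp: abs_mult\<close>)
qed

lemma Complex_times_real: "Complex c t * of_real u = of_real (c * u) + \<i> * of_real (t * u)"
  by (simp add: complex_eq_iff)

text \<open>
  Mellin inversion for theta, as Fourier inversion of \<open>Omega u * exp (c * u)\<close>. For \<open>c > 1\<close> this function is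
  bounded and integrable, and its transform decays quadratically.
\<close>
lemma Omega_line_integral:
  assumes c: "c > 1"
  shows "(LINT t|lborel. zhat (Complex c t) * exp (- (Complex c t * of_real x))) = 2 * pi * Omega x"
proof -
  define g where "g = (\<lambda>u. complex_of_real (Omega u) * exp (of_real c * of_real u))"
  have hat: "(LINT u|lborel. g u * iexp (t * u)) = zhat (Complex c t)" for t
  proof -
    have "g u * iexp (t * u) = complex_of_real (Omega u) * exp (Complex c t * of_real u)" for u
      by (simp add: g_def Complex_times_real exp_add)
    then show ?thesis
      using has_bochner_integral_integral_eq[OF Omega_transform_xi[of "Complex c t"]] c
      by (simp add: zhat_def)
  qed
  obtain C where C: "C \<ge> 0" "\<And>u. Omega u * exp (c * u) \<le> C * exp (- (c - 1) * \<bar>u\<bar>)"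
    using Omega_weighted_bound[OF c] by blast
  have bdd: "norm (g u) \<le> C" for u
  proof -
    have "norm (g u) = Omega u * exp (c * u)" using Omega_nonneg by (simp add: g_def norm_mult)
    also have "\<dots> \<le> C * exp (- (c - 1) * \<bar>u\<bar>)" by (rule C)
    also have "\<dots> \<le> C * 1" using c C by (intro mult_left_mono) (auto simp: mult_nonpos_nonneg)
    finally show ?thesis by simp
  qed
  have "(LINT t|lborel. (LINT u|lborel. g u * iexp (t * u)) * iexp (- t * x)) = 2 * pi * g x"
  proof (rule fourier_inversion)
    show "continuous_on UNIV g" unfolding g_def
      by (intro continuous_intros continuous_on_Omega)
    show "integrable lborel g" unfolding g_def using integrable_Omega_exp[of "of_real c"] c by simp
    show "integrable lborel (\<lambda>t. LINT u|lborel. g u * iexp (t * u))"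
      unfolding hat by (rule integrable_zhat_line[OF c])
  qed (rule bdd)
  then have "(LINT t|lborel. zhat (Complex c t) * iexp (- t * x)) = 2 * pi * g x" unfolding hat .
  note * = this
  have eq: "zhat (Complex c t) * exp (- (Complex c t * of_real x)) =
     zhat (Complex c t) * iexp (- t * x) * exp (- (of_real c * of_real x))" for t
    by (simp add: Complex_times_real mult.assoc minus_diff_commute flip: exp_add)
  have "(LINT t|lborel. zhat (Complex c t) * exp (- (Complex c t * of_real x))) =
     2 * pi * g x * exp (- (of_real c * of_real x))"
    unfolding eq integral_mult_left_zero * ..
  then show ?thesis by (simp add: g_def exp_minus)
qed

text \<open>
  The Mellin convolution of \<open>theta (a\<^sup>2) - 1\<close> with itself at the point \<open>exp y\<close>.
\<close>
definition Omega_conv :: "real \<Rightarrow> real" where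
  "Omega_conv y = (LINT v|lborel. Omega v * Omega (y - v))"

text \<open>
  The transform of a convolution is the square of the transform. The proof writes one of the two factors \<open>zhat\<close> as an
  integral over \<open>v\<close>, exchanges the order, and inverts the other factor. The exchange also shows that the convolution integral
  converges.
\<close>
lemma Omega_conv_line_integral:
  assumes c: "c > 1"
  shows "integrable lborel (\<lambda>v. Omega v * Omega (y - v))"
    and "(LINT t|lborel. (zhat (Complex c t))\<^sup>2 * exp (- (Complex c t * of_real y))) = 2 * pi * Omega_conv y"
proof -
  define F where "F = (\<lambda>v t. zhat (Complex c t) * exp (- (Complex c t * of_real y)) * (complex_of_real (Omega v) * exp (Complex c t * of_real v)))"
  have [measurable]: "(\<lambda>t. zhat (Complex c t)) \<in> borel_measurable borel" "(\<lambda>t. Complex c t) \<in> borel_measurable borel"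
    using borel_measurable_continuous_onI[OF continuous_on_zhat_line[OF c]]
      borel_measurable_continuous_onI[OF continuous_on_vertical_line] by auto
  have Fi: "integrable (lborel \<Otimes>\<^sub>M lborel) (\<lambda>(v, t). F v t)"
  proof (rule Bochner_Integration.integrable_bound)
    show "integrable (lborel \<Otimes>\<^sub>M lborel) (\<lambda>(v, t). (complex_of_real (Omega v) * exp (of_real c * of_real v)) *
       (exp (- (of_real c * of_real y)) * zhat (Complex c t)))"
      by (intro integrable_product integrable_mult_right integrable_zhat_line integrable_Omega_exp c) (use c in simp)
    show "(\<lambda>(v, t). F v t) \<in> borel_measurable (lborel \<Otimes>\<^sub>M lborel)"
      unfolding F_def by measurable
  qed (auto simp: F_def norm_mult mult_ac)
  have inner: "(LINT t|lborel. F v t) = 2 * pi * of_real (Omega v * Omega (y - v))" for v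
  proof -
    have "F v t = complex_of_real (Omega v) * (zhat (Complex c t) * exp (- (Complex c t * of_real (y - v))))" for t
      by (simp add: F_def right_diff_distrib exp_diff exp_minus field_simps)
    then have "(LINT t|lborel. F v t) = complex_of_real (Omega v) * (2 * pi * Omega (y - v))"
      by (simp only: integral_mult_right_zero Omega_line_integral[OF c])
    then show ?thesis by simp
  qed
  have "integrable lborel (\<lambda>v. LINT t|lborel. F v t)"
    using lborel_pair.integrable_fst'[OF Fi] by simp
  then have "integrable lborel (\<lambda>v. 2 * pi * complex_of_real (Omega v * Omega (y - v)))"
    unfolding inner by (simp add: mult.assoc)
  from integrable_Re[OF this] show "integrable lborel (\<lambda>v. Omega v * Omega (y - v))" by simp
  have inner2: "(LINT v|lborel. F v t) = (zhat (Complex c t))\<^sup>2 * exp (- (Complex c t * of_real y))" for t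
    using has_bochner_integral_integral_eq[OF Omega_transform_xi[of "Complex c t"]] c
    by (simp add: F_def zhat_def[symmetric] power2_eq_square)
  have "(LINT t|lborel. (zhat (Complex c t))\<^sup>2 * exp (- (Complex c t * of_real y))) = (LINT t|lborel. LINT v|lborel. F v t)"
    by (simp add: inner2)
  also have "\<dots> = (LINT v|lborel. LINT t|lborel. F v t)"
    by (rule lborel_pair.Fubini_integral[OF Fi])
  also have "\<dots> = (LINT v|lborel. 2 * pi * complex_of_real (Omega v * Omega (y - v)))"
    by (simp add: inner)
  also have "\<dots> = 2 * pi * Omega_conv y"
    unfolding Omega_conv_def by (subst integral_mult_right_zero) (simp only: integral_complex_of_real, simp)
  finally show "(LINT t|lborel. (zhat (Complex c t))\<^sup>2 * exp (- (Complex c t * of_real y))) = 2 * pi * Omega_conv y" .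
qed

text \<open>
  With \<open>a = exp u\<close> and \<open>b = \<nu> / a\<close>, both products of theta functions in \<open>w_fun\<close> become products
  \<open>Omega v * Omega (y - v)\<close> after a translation of \<open>u\<close> by \<open>ln x\<close>; only \<open>y\<close> differs.
\<close>
lemma V_fun_eq_Omega_conv:
  assumes x: "x > 0" and \<nu>: "\<nu> > 0"
  shows "set_integrable lborel {0<..} (V_integrand x \<nu>)"
    and "V_fun x \<nu> = Omega_conv (ln \<nu> - 2 * ln x) - x\<^sup>2 * Omega_conv (ln \<nu> + 2 * ln x)"
proof -
  define G where "G = (\<lambda>u. Omega (u - ln x) * Omega (ln \<nu> - u - ln x) - x\<^sup>2 * (Omega (u + ln x) * Omega (ln \<nu> - u + ln x)))"
  define f where "f = (\<lambda>a. G (ln a) / a)"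
  have i: "integrable lborel (\<lambda>v. Omega v * Omega (y - v))" for y
    by (rule Omega_conv_line_integral(1)[of 2]) simp
  have 1: "integrable lborel (\<lambda>u. Omega (u - ln x) * Omega (ln \<nu> - u - ln x))"
      "(LINT u|lborel. Omega (u - ln x) * Omega (ln \<nu> - u - ln x)) = Omega_conv (ln \<nu> - 2 * ln x)"
    using lborel_integrable_real_affine[OF i[of "ln \<nu> - 2 * ln x"], of 1 "- ln x"]
      lborel_integral_real_affine[of 1 "\<lambda>v. Omega v * Omega (ln \<nu> - 2 * ln x - v)" "- ln x"]
    by (simp_all add: Omega_conv_def algebra_simps)
  have 2: "integrable lborel (\<lambda>u. Omega (u + ln x) * Omega (ln \<nu> - u + ln x))"
      "(LINT u|lborel. Omega (u + ln x) * Omega (ln \<nu> - u + ln x)) = Omega_conv (ln \<nu> + 2 * ln x)"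
    using lborel_integrable_real_affine[OF i[of "ln \<nu> + 2 * ln x"], of 1 "ln x"]
      lborel_integral_real_affine[of 1 "\<lambda>v. Omega v * Omega (ln \<nu> + 2 * ln x - v)" "ln x"]
    by (simp_all add: Omega_conv_def algebra_simps)
  have G: "integrable lborel G" "(LINT u|lborel. G u) = Omega_conv (ln \<nu> - 2 * ln x) - x\<^sup>2 * Omega_conv (ln \<nu> + 2 * ln x)"
    unfolding G_def using 1 2 by auto
  have fm: "f \<in> borel_measurable borel" unfolding f_def G_def by measurable
  have fe: "(\<lambda>u. exp u * f (exp u)) = G" by (auto simp: f_def)
  have eq: "V_integrand x \<nu> a = f a" if a: "a \<in> {0<..}" for a
  proof -
    have e1: "theta (b\<^sup>2 * x powi (-2)) - 1 = Omega (ln b - ln x)" if "b > 0" for b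
      using theta_square_eq_Omega[of "b / x"] x that
      by (simp add: power_int_minus divide_inverse power_mult_distrib power_inverse ln_mult ln_inverse)
    have e2: "theta (b\<^sup>2 * x\<^sup>2) - 1 = Omega (ln b + ln x)" if "b > 0" for b
      using theta_square_eq_Omega[of "b * x"] x that by (simp add: power_mult_distrib ln_mult)
    have b: "\<nu> * inverse a > 0" "ln (\<nu> * inverse a) = ln \<nu> - ln a"
      using a \<nu> by (simp_all add: ln_mult ln_inverse)
    show ?thesis unfolding V_integrand_def w_fun_def f_def G_def
      using a b by (simp add: e1 e2 mult.assoc)
  qed
  have "set_integrable lborel {0<..} f" "(LINT a:{0<..}|lborel. f a) = (LINT u|lborel. G u)"
    using exp_substitution[OF fm] G(1) unfolding fe by auto
  moreover have "set_integrable lborel {0<..} (V_integrand x \<nu>) = set_integrable lborel {0<..} f"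
    by (rule set_integrable_cong) (use eq in auto)
  moreover have "(LINT a:{0<..}|lborel. V_integrand x \<nu> a) = (LINT a:{0<..}|lborel. f a)"
    by (rule set_lebesgue_integral_cong) (use eq in auto)
  ultimately show "set_integrable lborel {0<..} (V_integrand x \<nu>)"
    "V_fun x \<nu> = Omega_conv (ln \<nu> - 2 * ln x) - x\<^sup>2 * Omega_conv (ln \<nu> + 2 * ln x)"
    using G(2) by (simp_all add: V_fun_def)
qed

lemma norm_exp_diff_le:
  fixes w z :: complex
  assumes "Re w \<le> K" "Re z \<le> K"
  shows "norm (exp w - exp z) \<le> exp K * norm (w - z)"
proof (rule field_differentiable_bound[where f' = exp])
  show "convex {s. Re s \<le> K}" by (rule convex_halfspace_Re_le)
qed (use assms in \<open>auto intro!: derivative_eq_intros\<close>)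

text \<open>
  Differentiation under the integral sign by dominated convergence of the difference quotients. It is
  done for real parts, where the derivative is a limit of quotients of real numbers; multiplying \<open>h\<close> by \<open>- \<i>\<close>
  then gives imaginary parts.
\<close>
lemma Re_exp_integral_derivative:
  fixes h l :: "real \<Rightarrow> complex"
  assumes h: "integrable lborel h" and hl: "integrable lborel (\<lambda>t. h t * l t)"
    and [measurable]: "l \<in> borel_measurable borel" and M: "\<And>t. \<bar>Re (l t)\<bar> \<le> M"
  shows "((\<lambda>y. Re (LINT t|lborel. h t * exp (l t * of_real y))) has_real_derivative
           Re (LINT t|lborel. h t * l t * exp (l t * of_real y))) (at y)"
proof -
  let ?I = "\<lambda>y. LINT t|lborel. h t * exp (l t * of_real y)"
  let ?D = "LINT t|lborel. h t * l t * exp (l t * of_real y)"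
  note [measurable] = borel_measurable_integrable[OF h]
  have ReM: "Re (l t * of_real y') \<le> M * b" if "\<bar>y'\<bar> \<le> b" for t y' b
  proof -
    have "Re (l t * of_real y') \<le> \<bar>Re (l t)\<bar> * \<bar>y'\<bar>" by (simp add: abs_mult[symmetric])
    also have "\<dots> \<le> M * b" using M[of t] that by (intro mult_mono) auto
    finally show ?thesis .
  qed
  have int: "integrable lborel (\<lambda>t. h t * exp (l t * of_real y'))" for y'
  proof (rule Bochner_Integration.integrable_bound)
    show "integrable lborel (\<lambda>t. exp (M * \<bar>y'\<bar>) * norm (h t))"
      using h by (intro integrable_mult_right integrable_norm)
    show "AE t in lborel. norm (h t * exp (l t * of_real y')) \<le> norm (exp (M * \<bar>y'\<bar>) * norm (h t))"
      using ReM[OF order.refl] by (auto simp: norm_mult mult.commute intro!: mult_left_mono)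
  qed measurable
  have "((\<lambda>\<delta>. (Re (?I (y + \<delta>)) - Re (?I y)) / \<delta>)
     \<longlongrightarrow> Re ?D) (at 0)"
    unfolding tendsto_at_iff_sequentially
  proof (intro allI impI)
    fix X :: "nat \<Rightarrow> real" assume X: "\<forall>i. X i \<in> UNIV - {0}" "X \<longlonglongrightarrow> 0"
    \<comment> \<open>A bounded sequence of increments gives one dominating function for all quotients.\<close>
    from X(2) have "Bseq X" by (intro convergent_imp_Bseq) (auto simp: convergent_def)
    then obtain K where K: "K > 0" "\<And>n. \<bar>X n\<bar> \<le> K" by (auto simp: Bseq_def)
    define q where "q = (\<lambda>n t. h t * ((exp (l t * of_real (y + X n)) - exp (l t * of_real y)) / of_real (X n)))"
    have "(\<lambda>n. LINT t|lborel. q n t) \<longlonglongrightarrow> ?D"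
    proof (rule integral_dominated_convergence)
      show "integrable lborel (\<lambda>t. exp (M * (\<bar>y\<bar> + K)) * norm (h t * l t))"
        using hl by (intro integrable_mult_right integrable_norm)
      show "AE t in lborel. norm (q n t) \<le> exp (M * (\<bar>y\<bar> + K)) * norm (h t * l t)" for n
      proof (rule AE_I2)
        fix t
        have X0: "X n \<noteq> 0" using X by auto
        have "norm (exp (l t * of_real (y + X n)) - exp (l t * of_real y)) \<le>
            exp (M * (\<bar>y\<bar> + K)) * norm (l t * of_real (y + X n) - l t * of_real y)"
          using K(2)[of n] K(1) by (intro norm_exp_diff_le ReM) auto
        also have "l t * of_real (y + X n) - l t * of_real y = l t * of_real (X n)" by (simp add: algebra_simps)
        finally have "norm ((exp (l t * of_real (y + X n)) - exp (l t * of_real y)) / of_real (X n)) \<le> exp (M * (\<bar>y\<bar> + K)) * norm (l t)"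
          using X0 by (simp add: norm_divide norm_mult field_simps)
        then have "norm (h t) * norm ((exp (l t * of_real (y + X n)) - exp (l t * of_real y)) / of_real (X n)) \<le>
            norm (h t) * (exp (M * (\<bar>y\<bar> + K)) * norm (l t))"
          by (rule mult_left_mono) simp
        then show "norm (q n t) \<le> exp (M * (\<bar>y\<bar> + K)) * norm (h t * l t)"
          unfolding q_def norm_mult by (simp only: mult_ac)
      qed
      show "AE t in lborel. (\<lambda>n. q n t) \<longlonglongrightarrow> h t * l t * exp (l t * of_real y)"
      proof (rule AE_I2)
        fix t
        have "((\<lambda>z. exp (l t * z)) has_field_derivative l t * exp (l t * of_real y)) (at (of_real y))"
          by (auto intro!: derivative_eq_intros)
        then have lim: "(\<lambda>z. (exp (l t * (of_real y + z)) - exp (l t * of_real y)) / z) \<midarrow>0\<rightarrow> l t * exp (l t * of_real y)"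
          by (simp add: DERIV_def)
        have "(\<lambda>n. complex_of_real (X n)) \<longlonglongrightarrow> 0" using tendsto_of_real[OF X(2)] by simp
        then have "filterlim (\<lambda>n. complex_of_real (X n)) (at 0) sequentially"
          using X(1) by (intro filterlim_atI) auto
        from filterlim_compose[OF lim this]
        have "(\<lambda>n. h t * ((exp (l t * (of_real y + of_real (X n))) - exp (l t * of_real y)) / of_real (X n))) \<longlonglongrightarrow> h t * (l t * exp (l t * of_real y))"
          by (rule tendsto_mult_left)
        then show "(\<lambda>n. q n t) \<longlonglongrightarrow> h t * l t * exp (l t * of_real y)"
          by (simp add: q_def mult.assoc)
      qed
    qed (simp_all add: q_def)
    moreover have "(LINT t|lborel. q n t) = (?I (y + X n) - (?I y)) / of_real (X n)" for n
    proof -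
      have "q n t = (h t * exp (l t * of_real (y + X n)) - h t * exp (l t * of_real y)) / of_real (X n)" for t
        by (simp add: q_def right_diff_distrib)
      then show ?thesis using int[of "y + X n"] int[of y] by (simp del: of_real_add)
    qed
    ultimately have "(\<lambda>n. (?I (y + X n) - (?I y)) / of_real (X n))
      \<longlonglongrightarrow> ?D" by simp
    from tendsto_Re[OF this]
    show "((\<lambda>\<delta>. (Re (?I (y + \<delta>)) - Re (?I y)) / \<delta>) \<circ> X)
       \<longlonglongrightarrow> Re ?D"
      by (simp add: o_def Re_divide_of_real)
  qed
  then show ?thesis unfolding DERIV_def by simp
qed

lemma exp_integral_vector_derivative:
  fixes h l :: "real \<Rightarrow> complex"
  assumes h: "integrable lborel h" and hl: "integrable lborel (\<lambda>t. h t * l t)"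
    and l: "l \<in> borel_measurable borel" and M: "\<And>t. \<bar>Re (l t)\<bar> \<le> M"
  shows "((\<lambda>y. LINT t|lborel. h t * exp (l t * of_real y)) has_vector_derivative
           (LINT t|lborel. h t * l t * exp (l t * of_real y))) (at y)"
proof -
  let ?I = "\<lambda>y. LINT t|lborel. h t * exp (l t * of_real y)"
  let ?D = "LINT t|lborel. h t * l t * exp (l t * of_real y)"
  have R: "((\<lambda>y. Re (?I y)) has_real_derivative
           Re ?D) (at y)"
    by (rule Re_exp_integral_derivative[OF h hl l M])
  have "((\<lambda>y. Re (LINT t|lborel. (- \<i> * h t) * exp (l t * of_real y))) has_real_derivative
           Re (LINT t|lborel. (- \<i> * h t) * l t * exp (l t * of_real y))) (at y)"
    by (rule Re_exp_integral_derivative[of "\<lambda>t. - \<i> * h t" l M y]) (use h hl l M in \<open>simp_all add: mult.assoc\<close>)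
  then have I: "((\<lambda>y. Im (?I y)) has_real_derivative
           Im ?D) (at y)"
    by (simp add: mult.assoc)
  have "((\<lambda>y. of_real (Re (?I y)) + \<i> * of_real (Im (?I y))) has_vector_derivative
           (of_real (Re ?D) + \<i> * of_real (Im ?D))) (at y)"
    by (intro has_vector_derivative_add has_vector_derivative_mult_right has_vector_derivative_of_real R I)
  then show ?thesis by (simp flip: complex_eq)
qed


section \<open>Applying the Euler operator\<close>

text \<open>
  In the variable \<open>y = ln x\<close> the operator \<open>- x d/dx\<close> is \<open>- d/dy\<close>. The function \<open>f\<close> is real but \<open>Q\<close> is
  complex; the imaginary part of \<open>Q\<close> vanishes identically, so that of \<open>Q'\<close> does too.
\<close>
lemma euler_op_has_transform:
  fixes f :: "real \<Rightarrow> real" and Q Q' :: "real \<Rightarrow> complex"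
  assumes f: "\<And>x. x > 0 \<Longrightarrow> complex_of_real (f x) = Q (ln x)"
    and Q: "\<And>y. (Q has_vector_derivative - Q' y) (at y)" and x: "x > 0"
  shows "f differentiable at x" and "complex_of_real (euler_op f x) = Q' (ln x)"
proof -
  define D where "D = (1 / x) *\<^sub>R (- Q' (ln x))"
  have "(ln has_vector_derivative 1 / x) (at x)"
    using x by (auto intro!: derivative_eq_intros simp: has_real_derivative_iff_has_vector_derivative[symmetric] divide_inverse)
  from vector_diff_chain_at[OF this Q[of "ln x"]]
  have "((\<lambda>x. Q (ln x)) has_vector_derivative D) (at x)" by (simp add: D_def o_def)
  then have D: "((\<lambda>x. complex_of_real (f x)) has_vector_derivative D) (at x)"
    by (rule has_vector_derivative_transform_within_open[where S = "{0<..}"]) (use x f in auto)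
  from bounded_linear.has_vector_derivative[OF bounded_linear_Re D]
  have Re: "(f has_real_derivative Re D) (at x)" by (simp add: has_real_derivative_iff_has_vector_derivative)
  then show "f differentiable at x" by (auto simp: real_differentiable_def)
  from bounded_linear.has_vector_derivative[OF bounded_linear_Im D]
  have "((\<lambda>x. 0 :: real) has_vector_derivative Im D) (at x)" by simp
  then have "Im D = 0" using vector_derivative_unique_at has_vector_derivative_const by blast
  then have "Im (Q' (ln x)) = 0" using x by (simp add: D_def)
  moreover have "euler_op f x = Re (Q' (ln x))"
    unfolding euler_op_def DERIV_imp_deriv[OF Re] using x by (simp add: D_def)
  ultimately show "complex_of_real (euler_op f x) = Q' (ln x)" by (simp add: complex_eq_iff)
qed

lemma euler_op_iterate:
  fixes V :: "real \<Rightarrow> real" and Q :: "nat \<Rightarrow> real \<Rightarrow> complex"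
  assumes V: "\<And>x. x > 0 \<Longrightarrow> complex_of_real (V x) = Q 0 (ln x)"
    and Q: "\<And>k y. k < n \<Longrightarrow> (Q k has_vector_derivative - Q (Suc k) y) (at y)"
  shows "k \<le> n \<Longrightarrow> x > 0 \<Longrightarrow> complex_of_real ((euler_op ^^ k) V x) = Q k (ln x)"
    and "k < n \<Longrightarrow> x > 0 \<Longrightarrow> (euler_op ^^ k) V differentiable at x"
proof -
  have *: "k \<le> n \<Longrightarrow> \<forall>x>0. complex_of_real ((euler_op ^^ k) V x) = Q k (ln x)" for k
  proof (induction k)
    case (Suc k)
    then show ?case
      using euler_op_has_transform(2)[of "(euler_op ^^ k) V" "Q k" "Q (Suc k)"] Q[of k] by auto
  qed (use V in auto)
  then show "k \<le> n \<Longrightarrow> x > 0 \<Longrightarrow> complex_of_real ((euler_op ^^ k) V x) = Q k (ln x)" by blast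
  show "k < n \<Longrightarrow> x > 0 \<Longrightarrow> (euler_op ^^ k) V differentiable at x"
    using euler_op_has_transform(1)[of "(euler_op ^^ k) V" "Q k" "Q (Suc k)" x] Q[of k] *[of k] by auto
qed

text \<open>
  On the line \<open>Re s = 2\<close> the denominator of the square of \<open>zhat\<close> has degree four in \<open>s\<close>. It absorbs the
  fourth power of a linear function, and the decay of \<open>xi_fun\<close> provides integrability.
\<close>
lemma integrable_zhat_square_power:
  fixes l :: "real \<Rightarrow> complex"
  assumes l: "continuous_on UNIV l" and l1: "\<And>t. 1 \<le> norm (l t)" and l2: "\<And>t. (norm (l t))\<^sup>2 \<le> 4 * (4 + t\<^sup>2)"
    and k: "k \<le> 4"
  shows "integrable lborel (\<lambda>t. (zhat (Complex 2 t))\<^sup>2 * l t ^ k)"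
proof -
  obtain K where K: "K \<ge> 0" "\<And>s. \<bar>Re s\<bar> \<le> 2 \<Longrightarrow> norm (xi_fun s) * (1 + (Im s)\<^sup>2) \<le> K"
    using xi_fun_decay[of 2] by blast
  have bound: "norm ((zhat (Complex 2 t))\<^sup>2 * l t ^ k) \<le> 64 * K\<^sup>2 * (1 / (1 + t\<^sup>2))" for t
  proof -
    define q where "q = 1 + t\<^sup>2"
    have q: "q \<ge> 1" by (simp add: q_def)
    have s: "(norm (Complex 2 t))\<^sup>2 = 3 + q" "(norm (Complex 2 t - 1))\<^sup>2 = q"
      by (simp_all add: cmod_power2 q_def)
    have "norm (xi_fun (Complex 2 t)) \<le> K / q"
      using K(2)[of "Complex 2 t"] q by (simp add: q_def[symmetric] pos_le_divide_eq)
    then have xi: "(norm (xi_fun (Complex 2 t)))\<^sup>2 \<le> (K / q)\<^sup>2" by (intro power_mono) auto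
    have "norm (l t) ^ k \<le> norm (l t) ^ 4" using k l1 by (intro power_increasing) auto
    also have "\<dots> = ((norm (l t))\<^sup>2)\<^sup>2" by simp
    also have "\<dots> \<le> (4 * (3 + q))\<^sup>2" using l2[of t] by (intro power_mono) (auto simp: q_def)
    finally have lk: "norm (l t) ^ k \<le> (4 * (3 + q))\<^sup>2" .
    have "norm ((zhat (Complex 2 t))\<^sup>2 * l t ^ k) = (norm (xi_fun (Complex 2 t)))\<^sup>2 / ((3 + q) * q) * norm (l t) ^ k"
      by (simp add: zhat_def norm_mult norm_divide norm_power power_divide power_mult_distrib s)
    also have "\<dots> \<le> (K / q)\<^sup>2 / ((3 + q) * q) * (4 * (3 + q))\<^sup>2"
      using q by (intro mult_mono divide_right_mono xi lk) auto
    also have "\<dots> = 16 * K\<^sup>2 * (3 + q) / (q * q * q)"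
    proof -
      have *: "(K / q)\<^sup>2 / (p * q) * (4 * p)\<^sup>2 = 16 * K\<^sup>2 * p / (q * q * q)" if "p > 0" for p
        using q that by (simp add: field_simps power2_eq_square)
      show ?thesis by (rule *) (use q in simp)
    qed
    also have "\<dots> \<le> 16 * K\<^sup>2 * (4 * q) / (q * q * 1)"
      using q by (intro frac_le mult_left_mono mult_mono) auto
    also have "\<dots> = 64 * K\<^sup>2 * (1 / q)" using q by (simp add: field_simps)
    finally show ?thesis by (simp add: q_def)
  qed
  have meas: "(\<lambda>t. (zhat (Complex 2 t))\<^sup>2 * l t ^ k) \<in> borel_measurable borel"
    by (intro borel_measurable_continuous_onI continuous_intros continuous_on_zhat_line l) simp
  show ?thesis
  proof (rule Bochner_Integration.integrable_bound)
    show "integrable lborel (\<lambda>t. 64 * K\<^sup>2 * (1 / (1 + t\<^sup>2)))"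
      by (intro integrable_mult_right integrable_inverse_one_plus_square)
    show "AE t in lborel. norm ((zhat (Complex 2 t))\<^sup>2 * l t ^ k) \<le> norm (64 * K\<^sup>2 * (1 / (1 + t\<^sup>2)))"
      using bound by (intro AE_I2 order.trans[OF bound]) simp
  qed (use meas in simp)
qed

text \<open>
  The common factor of the integrands of both parts of \<open>V_fun\<close> on the line \<open>Re s = 2\<close>.
\<close>
definition V_density :: "real \<Rightarrow> real \<Rightarrow> complex" where
  "V_density \<nu> t = (zhat (Complex 2 t))\<^sup>2 * exp (- (Complex 2 t * of_real (ln \<nu>)))"

definition V_transform :: "real \<Rightarrow> (real \<Rightarrow> complex) \<Rightarrow> nat \<Rightarrow> real \<Rightarrow> complex" where
  "V_transform \<nu> l k y = (LINT t|lborel. V_density \<nu> t * l t ^ k * exp (l t * of_real y))"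

lemma integrable_V_density:
  assumes l: "continuous_on UNIV l" and l1: "\<And>t. 1 \<le> norm (l t)" and l2: "\<And>t. (norm (l t))\<^sup>2 \<le> 4 * (4 + t\<^sup>2)"
    and k: "k \<le> 4"
  shows "integrable lborel (\<lambda>t. V_density \<nu> t * l t ^ k)"
proof -
  have meas: "(\<lambda>t. V_density \<nu> t * l t ^ k) \<in> borel_measurable borel" unfolding V_density_def
    by (intro borel_measurable_continuous_onI continuous_intros continuous_on_zhat_line continuous_on_vertical_line l) simp
  show ?thesis
  proof (rule Bochner_Integration.integrable_bound)
    show "integrable lborel (\<lambda>t. exp (- (2 * ln \<nu>)) * norm ((zhat (Complex 2 t))\<^sup>2 * l t ^ k))"
      by (intro integrable_mult_right integrable_norm integrable_zhat_square_power assms)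
  qed (use meas in \<open>auto simp: V_density_def norm_mult\<close>)
qed

lemma V_transform_derivative:
  assumes l: "continuous_on UNIV l" and l1: "\<And>t. 1 \<le> norm (l t)" and l2: "\<And>t. (norm (l t))\<^sup>2 \<le> 4 * (4 + t\<^sup>2)"
    and M: "\<And>t. \<bar>Re (l t)\<bar> \<le> M" and k: "k < 4"
  shows "(V_transform \<nu> l k has_vector_derivative V_transform \<nu> l (Suc k) y) (at y)"
proof -
  have "integrable lborel (\<lambda>t. V_density \<nu> t * l t ^ k)" "integrable lborel (\<lambda>t. V_density \<nu> t * l t ^ k * l t)"
    using integrable_V_density[OF l l1 l2, of k \<nu>] integrable_V_density[OF l l1 l2, of "Suc k" \<nu>] k
    by (simp_all add: mult.assoc mult.commute[of "l _"])
  from exp_integral_vector_derivative[OF this borel_measurable_continuous_onI[OF l] M]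
  show ?thesis unfolding V_transform_def[abs_def] by (simp add: mult_ac)
qed

text \<open>
  The exponents of \<open>x\<close> in the two parts of \<open>V_fun\<close>, namely \<open>2 * s\<close> and \<open>2 - 2 * s\<close> at \<open>s = 2 + \<i> * t\<close>;
  the first part is a superposition of \<open>x powr (2 * s)\<close>, the second one of \<open>x\<^sup>2 * x powr (- 2 * s)\<close>.
\<close>
definition exponent1 :: "real \<Rightarrow> complex" where "exponent1 t = 2 * Complex 2 t"
definition exponent2 :: "real \<Rightarrow> complex" where "exponent2 t = 2 - 2 * Complex 2 t"

lemma exponent1:
  "continuous_on UNIV exponent1" "1 \<le> norm (exponent1 t)" "(norm (exponent1 t))\<^sup>2 \<le> 4 * (4 + t\<^sup>2)" "\<bar>Re (exponent1 t)\<bar> \<le> 4"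
proof -
  show "continuous_on UNIV exponent1" unfolding exponent1_def[abs_def]
    by (intro continuous_intros continuous_on_vertical_line)
  show "1 \<le> norm (exponent1 t)" using abs_Re_le_cmod[of "exponent1 t"] by (simp add: exponent1_def)
qed (simp_all add: exponent1_def cmod_power2 power_mult_distrib)

lemma exponent2:
  "continuous_on UNIV exponent2" "1 \<le> norm (exponent2 t)" "(norm (exponent2 t))\<^sup>2 \<le> 4 * (4 + t\<^sup>2)" "\<bar>Re (exponent2 t)\<bar> \<le> 4"
proof -
  show "continuous_on UNIV exponent2" unfolding exponent2_def[abs_def]
    by (intro continuous_intros continuous_on_vertical_line)
  show "1 \<le> norm (exponent2 t)" using abs_Re_le_cmod[of "exponent2 t"] by (simp add: exponent2_def)
qed (simp_all add: exponent2_def cmod_power2 power_mult_distrib)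

text \<open>
  The \<open>k\<close>-th iterate of the Euler operator on \<open>V_fun\<close>, as a function of \<open>ln x\<close>.
\<close>
definition V_stage :: "real \<Rightarrow> nat \<Rightarrow> real \<Rightarrow> complex" where
  "V_stage \<nu> k y = (- 1) ^ k / (2 * pi) * (V_transform \<nu> exponent1 k y - V_transform \<nu> exponent2 k y)"

lemma V_stage_derivative:
  assumes "k < 4"
  shows "(V_stage \<nu> k has_vector_derivative - V_stage \<nu> (Suc k) y) (at y)"
proof -
  have "(V_stage \<nu> k has_vector_derivative (- 1) ^ k / (2 * pi) * (V_transform \<nu> exponent1 (Suc k) y - V_transform \<nu> exponent2 (Suc k) y)) (at y)"
    unfolding V_stage_def[abs_def]
    by (intro has_vector_derivative_mult_right has_vector_derivative_diff V_transform_derivative[where M = 4] exponent1 exponent2 assms)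
  then show ?thesis by (simp add: V_stage_def)
qed

lemma V_fun_eq_stage:
  assumes x: "x > 0" and \<nu>: "\<nu> > 0"
  shows "complex_of_real (V_fun x \<nu>) = V_stage \<nu> 0 (ln x)"
proof -
  have 1: "V_transform \<nu> exponent1 0 (ln x) = 2 * pi * Omega_conv (ln \<nu> - 2 * ln x)"
  proof -
    have "V_transform \<nu> exponent1 0 (ln x) = (LINT t|lborel. (zhat (Complex 2 t))\<^sup>2 * exp (- (Complex 2 t * of_real (ln \<nu> - 2 * ln x))))"
      unfolding V_transform_def
      by (rule Bochner_Integration.integral_cong)
         (simp_all add: V_density_def exponent1_def mult.assoc algebra_simps flip: exp_add)
    also have "\<dots> = 2 * pi * Omega_conv (ln \<nu> - 2 * ln x)"
      by (rule Omega_conv_line_integral(2)) simp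
    finally show ?thesis .
  qed
  have "V_transform \<nu> exponent2 0 (ln x) = (LINT t|lborel. of_real (x\<^sup>2) * ((zhat (Complex 2 t))\<^sup>2 * exp (- (Complex 2 t * of_real (ln \<nu> + 2 * ln x)))))"
    unfolding V_transform_def
  proof (rule Bochner_Integration.integral_cong)
    fix t
    have "complex_of_real (x\<^sup>2) = exp (2 * of_real (ln x))"
      using x by (simp add: exp_double exp_of_real)
    then show "V_density \<nu> t * exponent2 t ^ 0 * exp (exponent2 t * of_real (ln x)) =
        of_real (x\<^sup>2) * ((zhat (Complex 2 t))\<^sup>2 * exp (- (Complex 2 t * of_real (ln \<nu> + 2 * ln x))))"
      by (simp add: V_density_def exponent2_def mult.left_commute algebra_simps del: of_real_power flip: exp_add)
  qed simp
  also have "\<dots> = of_real (x\<^sup>2) * (2 * pi * Omega_conv (ln \<nu> + 2 * ln x))"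
    by (simp only: integral_mult_right_zero) (subst Omega_conv_line_integral(2); simp)
  finally have 2: "V_transform \<nu> exponent2 0 (ln x) = of_real (x\<^sup>2) * (2 * pi * Omega_conv (ln \<nu> + 2 * ln x))" .
  show ?thesis unfolding V_stage_def 1 2 V_fun_eq_Omega_conv(2)[OF x \<nu>] by (simp add: field_simps)
qed

lemma R_kernel_zhat:
  assumes "s \<noteq> 0" "s \<noteq> 1"
  shows "(2 * s) ^ 4 * (zhat s)\<^sup>2 = R_kernel s"
  using R_kernel_eq[OF assms] completed_zeta_eq[OF assms] by (simp add: zhat_def)

lemma of_real_powr_exp_ln: "X > 0 \<Longrightarrow> complex_of_real X powr s = exp (s * of_real (ln X))"
  by (simp add: powr_def Ln_of_real)

text \<open>
  The second part carries \<open>(2 - 2 * s) ^ 4\<close>. The functional equation and the reflection \<open>s \<mapsto> 1 - s\<close>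
  bring it to the same kernel as the first part, on the line \<open>Re s = - 1\<close> instead of \<open>Re s = 2\<close>.
\<close>
lemma V_stage_4:
  assumes x: "x > 0" and \<nu>: "\<nu> > 0"
  shows "V_stage \<nu> 4 (ln x) = line_mean 2 (x\<^sup>2 / \<nu>) - of_real (1 / \<nu>) * line_mean (- 1) (\<nu> * x\<^sup>2)"
proof -
  have nz: "Complex c t \<noteq> 0" "Complex c t \<noteq> 1" if "c \<noteq> 0" "c \<noteq> 1" for c t
    using that by (auto simp: complex_eq_iff)
  have ln1: "ln (x\<^sup>2 / \<nu>) = 2 * ln x - ln \<nu>" and ln2: "ln (\<nu> * x\<^sup>2) = ln \<nu> + 2 * ln x"
    using x \<nu> by (simp_all add: ln_div ln_mult ln_realpow)
  have pos: "x\<^sup>2 / \<nu> > 0" "\<nu> * x\<^sup>2 > 0" using x \<nu> by auto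
  have 1: "V_transform \<nu> exponent1 4 (ln x) = 2 * pi * line_mean 2 (x\<^sup>2 / \<nu>)"
  proof -
    have "V_transform \<nu> exponent1 4 (ln x) = (LINT t|lborel. R_kernel (Complex 2 t) * of_real (x\<^sup>2 / \<nu>) powr Complex 2 t)"
      unfolding V_transform_def
    proof (rule Bochner_Integration.integral_cong)
      fix t
      define s where "s = Complex 2 t"
      have "V_density \<nu> t * exponent1 t ^ 4 * exp (exponent1 t * of_real (ln x)) =
         ((2 * s) ^ 4 * (zhat s)\<^sup>2) * (exp (- (s * of_real (ln \<nu>))) * exp (2 * s * of_real (ln x)))"
        by (simp only: V_density_def exponent1_def s_def mult_ac)
      also have "exp (- (s * of_real (ln \<nu>))) * exp (2 * s * of_real (ln x)) = of_real (x\<^sup>2 / \<nu>) powr s"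
        unfolding of_real_powr_exp_ln[OF pos(1)] ln1 by (simp add: algebra_simps flip: exp_add)
      also have "(2 * s) ^ 4 * (zhat s)\<^sup>2 = R_kernel s"
        unfolding s_def by (rule R_kernel_zhat) (use nz[of 2] in auto)
      finally show "V_density \<nu> t * exponent1 t ^ 4 * exp (exponent1 t * of_real (ln x)) =
         R_kernel (Complex 2 t) * of_real (x\<^sup>2 / \<nu>) powr Complex 2 t" by (simp only: s_def)
    qed simp
    then show ?thesis by (simp add: line_mean_def)
  qed
  have 2: "V_transform \<nu> exponent2 4 (ln x) = 2 * pi * (of_real (1 / \<nu>) * line_mean (- 1) (\<nu> * x\<^sup>2))"
  proof -
    have "V_transform \<nu> exponent2 4 (ln x) = (LINT t|lborel. of_real (1 / \<nu>) * (R_kernel (Complex (- 1) (- t)) * of_real (\<nu> * x\<^sup>2) powr Complex (- 1) (- t)))"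
      unfolding V_transform_def
    proof (rule Bochner_Integration.integral_cong)
      fix t
      \<comment> \<open>The reflection of \<open>2 + \<i> * t\<close>; the sign of \<open>t\<close> is undone by a substitution afterwards.\<close>
      define s where "s = Complex (- 1) (- t)"
      have s: "Complex 2 t = 1 - s" by (simp add: s_def complex_eq_iff)
      have \<nu>': "complex_of_real (1 / \<nu>) = exp (- of_real (ln \<nu>))"
        using \<nu> by (simp add: exp_minus exp_of_real divide_inverse)
      have "V_density \<nu> t * exponent2 t ^ 4 * exp (exponent2 t * of_real (ln x)) =
         ((2 * s) ^ 4 * (zhat s)\<^sup>2) * (exp (- ((1 - s) * of_real (ln \<nu>))) * exp (2 * s * of_real (ln x)))"
        unfolding V_density_def exponent2_def s zhat_reflect by (simp add: algebra_simps)
      also have "exp (- ((1 - s) * of_real (ln \<nu>))) * exp (2 * s * of_real (ln x)) = of_real (1 / \<nu>) * of_real (\<nu> * x\<^sup>2) powr s"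
        unfolding of_real_powr_exp_ln[OF pos(2)] ln2 \<nu>' by (simp add: algebra_simps flip: exp_add)
      also have "(2 * s) ^ 4 * (zhat s)\<^sup>2 = R_kernel s"
        unfolding s_def by (rule R_kernel_zhat) (use nz[of "-1"] in auto)
      finally show "V_density \<nu> t * exponent2 t ^ 4 * exp (exponent2 t * of_real (ln x)) =
         of_real (1 / \<nu>) * (R_kernel (Complex (- 1) (- t)) * of_real (\<nu> * x\<^sup>2) powr Complex (- 1) (- t))"
        by (simp only: s_def mult_ac)
    qed simp
    also have "\<dots> = of_real (1 / \<nu>) * (LINT t|lborel. R_kernel (Complex (- 1) t) * of_real (\<nu> * x\<^sup>2) powr Complex (- 1) t)"
      unfolding integral_mult_right_zero
      using lborel_integral_real_affine[of "-1" "\<lambda>t. R_kernel (Complex (- 1) t) * of_real (\<nu> * x\<^sup>2) powr Complex (- 1) t" 0]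
      by simp
    finally show ?thesis by (simp add: line_mean_def)
  qed
  show ?thesis unfolding V_stage_def 1 2 by (simp add: field_simps)
qed

lemma Z_fun_line_mean:
  assumes x: "x > 0" and \<nu>: "\<nu> > 0"
  shows "complex_of_real (Z_fun x \<nu>) = line_mean 2 (x\<^sup>2 / \<nu>) - of_real (1 / \<nu>) * line_mean (- 1) (\<nu> * x\<^sup>2)"
    and "k < 4 \<Longrightarrow> (euler_op ^^ k) (\<lambda>y. V_fun y \<nu>) differentiable at x"
  using euler_op_iterate(1)[of "\<lambda>y. V_fun y \<nu>" "V_stage \<nu>" 4 4 x] euler_op_iterate(2)[of "\<lambda>y. V_fun y \<nu>" "V_stage \<nu>" 4 k x]
    V_fun_eq_stage[OF _ \<nu>] V_stage_derivative V_stage_4[OF x \<nu>] x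
  by (simp_all add: Z_fun_def)

section \<open>The two expansions of Z and the size of the remainders\<close>

lemma R_integrand_eq:
  assumes c: "c \<noteq> 0" "c \<noteq> 1"
  shows "R_integrand x \<nu> (Complex c t) = R_kernel (Complex c t) * of_real (x\<^sup>2 / \<nu>) powr Complex c t
    - of_real (1 / \<nu>) * (R_kernel (Complex c t) * of_real (\<nu> * x\<^sup>2) powr Complex c t)"
proof -
  have nz: "Complex c t \<noteq> 0" "Complex c t \<noteq> 1" using c by (auto simp: complex_eq_iff)
  have "R_integrand x \<nu> (Complex c t) = ((2 * Complex c t) ^ 4 * (completed_zeta (Complex c t))\<^sup>2) *
     (of_real (inverse \<nu> * x\<^sup>2) powr Complex c t - of_real (inverse \<nu>) * of_real (\<nu> * x\<^sup>2) powr Complex c t)"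
    by (simp only: R_integrand_def mult_ac)
  also have "inverse \<nu> * x\<^sup>2 = x\<^sup>2 / \<nu>" by (simp add: field_simps)
  also have "inverse \<nu> = 1 / \<nu>" by (simp add: field_simps)
  finally show ?thesis unfolding R_kernel_eq[OF nz] by (simp only: right_diff_distrib mult_ac)
qed

lemma R_line_eq:
  assumes c: "c \<noteq> 0" "c \<noteq> 1" and x: "x > 0" and \<nu>: "\<nu> > 0"
  shows "vline_integrable c (R_integrand x \<nu>)"
    and "R_line c x \<nu> = line_mean c (x\<^sup>2 / \<nu>) - of_real (1 / \<nu>) * line_mean c (\<nu> * x\<^sup>2)"
proof -
  have pos: "x\<^sup>2 / \<nu> > 0" "\<nu> * x\<^sup>2 > 0" using x \<nu> by auto
  note int = integrable_kernel_line[OF c(2) pos(1)] integrable_kernel_line[OF c(2) pos(2)]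
  show "vline_integrable c (R_integrand x \<nu>)"
    unfolding vline_integrable_def R_integrand_eq[OF c]
    by (intro integrable_mult_left Bochner_Integration.integrable_diff integrable_mult_right int)
  have "vline_integral c (R_integrand x \<nu>) =
     ((LINT t|lborel. R_kernel (Complex c t) * of_real (x\<^sup>2 / \<nu>) powr Complex c t) -
      of_real (1 / \<nu>) * (LINT t|lborel. R_kernel (Complex c t) * of_real (\<nu> * x\<^sup>2) powr Complex c t)) * \<i>"
    unfolding vline_integral_def R_integrand_eq[OF c] integral_mult_left_zero
    by (subst Bochner_Integration.integral_diff[OF int(1) integrable_mult_right[OF int(2)]]) simp
  also have "\<dots> = (2 * pi * \<i>) * (line_mean c (x\<^sup>2 / \<nu>) - of_real (1 / \<nu>) * line_mean c (\<nu> * x\<^sup>2))"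
    by (simp add: line_mean_def field_simps)
  finally show "R_line c x \<nu> = line_mean c (x\<^sup>2 / \<nu>) - of_real (1 / \<nu>) * line_mean c (\<nu> * x\<^sup>2)"
    by (simp add: R_line_def)
qed

lemma line_mean_right:
  assumes "1 < c" "1 < c'" "X > 0"
  shows "line_mean c X = line_mean c' X"
proof -
  have "line_mean c X - line_mean 0 X = line_mean c' X - line_mean 0 X"
    by (rule trans[OF line_mean_shift line_mean_shift[symmetric]]) (use assms in auto)
  then show ?thesis by simp
qed

lemma line_mean_left:
  assumes "c < 1" "c' < 1" "X > 0"
  shows "line_mean c X = line_mean c' X"
proof -
  have "line_mean 2 X - line_mean c X = line_mean 2 X - line_mean c' X"
    by (rule trans[OF line_mean_shift line_mean_shift[symmetric]]) (use assms in auto)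
  then show ?thesis by simp
qed

lemma line_mean_bound:
  assumes c: "c \<noteq> 1"
  shows "\<exists>K\<ge>0. \<forall>X>0. norm (line_mean c X) \<le> K * X powr c"
proof -
  obtain C where C: "C \<ge> 0" "\<And>s. \<bar>Re s\<bar> \<le> \<bar>c\<bar> \<Longrightarrow> \<bar>c - 1\<bar> \<le> norm (s - 1) \<Longrightarrow> norm (R_kernel s) \<le> C / (1 + (Im s)\<^sup>2)"
    using R_kernel_bound[of "\<bar>c - 1\<bar>" "\<bar>c\<bar>"] c by auto
  define I where "I = (LINT t|lborel. 1 / (1 + t\<^sup>2 :: real))"
  have I: "I \<ge> 0" unfolding I_def by (intro Bochner_Integration.integral_nonneg) auto
  have "norm (line_mean c X) \<le> C * I / (2 * pi) * X powr c" if X: "X > 0" for X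
  proof -
    have "norm (LINT t|lborel. R_kernel (Complex c t) * of_real X powr Complex c t) \<le>
       (LINT t|lborel. norm (R_kernel (Complex c t) * of_real X powr Complex c t))"
      by (rule integral_norm_bound)
    also have "\<dots> \<le> (LINT t|lborel. C * X powr c * (1 / (1 + t\<^sup>2)))"
    proof (rule integral_mono)
      show "integrable lborel (\<lambda>t. norm (R_kernel (Complex c t) * of_real X powr Complex c t))"
        by (intro integrable_norm integrable_kernel_line c X)
      show "integrable lborel (\<lambda>t. C * X powr c * (1 / (1 + t\<^sup>2)))"
        by (intro integrable_mult_right integrable_inverse_one_plus_square)
      fix t
      have "norm (R_kernel (Complex c t)) \<le> C / (1 + t\<^sup>2)"
        using C(2)[of "Complex c t"] line_distance_from_1[of c t] by simp
      then have "norm (R_kernel (Complex c t)) * X powr c \<le> C / (1 + t\<^sup>2) * X powr c"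
        by (intro mult_right_mono) auto
      then show "norm (R_kernel (Complex c t) * of_real X powr Complex c t) \<le> C * X powr c * (1 / (1 + t\<^sup>2))"
        using X by (simp add: norm_mult norm_of_real_powr mult_ac)
    qed
    also have "\<dots> = C * X powr c * I" by (simp only: integral_mult_right_zero I_def)
    finally have "norm (line_mean c X) \<le> C * X powr c * I / (2 * pi)"
      unfolding line_mean_def norm_divide by (simp add: divide_right_mono)
    then show ?thesis by (simp add: mult_ac)
  qed
  moreover have "C * I / (2 * pi) \<ge> 0" using C I by simp
  ultimately show ?thesis by blast
qed

lemma R_line_bound:
  assumes c: "c \<noteq> 0" "c \<noteq> 1"
  shows "\<exists>K\<ge>0. \<forall>x>0. \<forall>\<nu>>0. norm (R_line c x \<nu>) \<le> K * ((\<nu> powr (- c) + \<nu> powr (c - 1)) * x powr (2 * c))"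
proof -
  obtain K where K: "K \<ge> 0" "\<And>X. X > 0 \<Longrightarrow> norm (line_mean c X) \<le> K * X powr c"
    using line_mean_bound[OF c(2)] by blast
  have "norm (R_line c x \<nu>) \<le> K * ((\<nu> powr (- c) + \<nu> powr (c - 1)) * x powr (2 * c))" if x: "x > 0" and \<nu>: "\<nu> > 0" for x \<nu>
  proof -
    have xc: "(x\<^sup>2) powr c = x powr (2 * c)" using x by (simp add: powr_powr flip: powr_numeral)
    have "norm (R_line c x \<nu>) \<le> norm (line_mean c (x\<^sup>2 / \<nu>)) + 1 / \<nu> * norm (line_mean c (\<nu> * x\<^sup>2))"
      unfolding R_line_eq(2)[OF c x \<nu>] using \<nu> by (intro order.trans[OF norm_triangle_ineq4]) (simp add: norm_mult norm_divide)
    also have "\<dots> \<le> K * (x\<^sup>2 / \<nu>) powr c + 1 / \<nu> * (K * (\<nu> * x\<^sup>2) powr c)"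
      using x \<nu> by (intro add_mono mult_left_mono K) auto
    also have "(x\<^sup>2 / \<nu>) powr c = \<nu> powr (- c) * x powr (2 * c)"
      using x \<nu> by (simp add: powr_divide powr_minus xc) (simp add: field_simps)
    also have "1 / \<nu> * (K * (\<nu> * x\<^sup>2) powr c) = K * (\<nu> powr (c - 1) * x powr (2 * c))"
      using x \<nu> by (simp add: powr_mult powr_diff xc)
    finally show ?thesis by (simp add: algebra_simps)
  qed
  with K(1) show ?thesis by blast
qed

lemma Q_const_facts: "Q_const \<noteq> 0" "ln Q_const = euler_mascheroni - ln (4 * pi)"
proof -
  show "Q_const \<noteq> 0" by (simp add: Q_const_def)
  show "ln Q_const = euler_mascheroni - ln (4 * pi)"
    unfolding Q_const_def by (subst ln_mult) (simp_all add: ln_inverse del: inverse_mult_distrib)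
qed

text \<open>
  The second part of \<open>Z_fun\<close> has to cross the pole to reach the line \<open>Re s = c\<close>; its residue is the main term.
\<close>
lemma Z_fun_right:
  assumes x: "x > 0" and \<nu>: "\<nu> > 0" and c: "c > 1"
  shows "complex_of_real (Z_fun x \<nu>) =
    of_real (16 * x\<^sup>2 * ln (x\<^sup>2) + 16 * x\<^sup>2 * ln (Q_const * exp 4 * \<nu>)) + R_line c x \<nu>"
proof -
  have pos: "x\<^sup>2 / \<nu> > 0" "\<nu> * x\<^sup>2 > 0" using x \<nu> by auto
  have 1: "line_mean 2 (x\<^sup>2 / \<nu>) = line_mean c (x\<^sup>2 / \<nu>)" using c pos by (intro line_mean_right) auto
  have 2: "line_mean (- 1) (\<nu> * x\<^sup>2) = line_mean c (\<nu> * x\<^sup>2)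
      - of_real (16 * (\<nu> * x\<^sup>2) * (4 + ln (\<nu> * x\<^sup>2) + euler_mascheroni - ln (4 * pi)))"
    using line_mean_shift[of "-1" c "\<nu> * x\<^sup>2"] c pos by (simp add: algebra_simps)
  have ln: "ln (\<nu> * x\<^sup>2) = ln \<nu> + ln (x\<^sup>2)" "ln (Q_const * exp 4 * \<nu>) = euler_mascheroni - ln (4 * pi) + 4 + ln \<nu>"
    using x \<nu> by (simp_all add: Q_const_facts ln_mult)
  have "complex_of_real (Z_fun x \<nu>) = R_line c x \<nu> + of_real (1 / \<nu> * (16 * (\<nu> * x\<^sup>2) * (4 + ln (\<nu> * x\<^sup>2) + euler_mascheroni - ln (4 * pi))))"
    unfolding Z_fun_line_mean(1)[OF x \<nu>] 1 2 using c by (subst R_line_eq(2)[OF _ _ x \<nu>]) (auto simp: right_diff_distrib)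
  also have "1 / \<nu> * (16 * (\<nu> * x\<^sup>2) * (4 + ln (\<nu> * x\<^sup>2) + euler_mascheroni - ln (4 * pi))) =
     16 * x\<^sup>2 * ln (x\<^sup>2) + 16 * x\<^sup>2 * ln (Q_const * exp 4 * \<nu>)"
    unfolding ln using \<nu> by (simp add: field_simps)
  finally show ?thesis by (simp only: add.commute)
qed

text \<open>
  Here the first part of \<open>Z_fun\<close> crosses the pole.
\<close>
lemma Z_fun_left:
  assumes x: "x > 0" and \<nu>: "\<nu> > 0" and c: "c < 0"
  shows "complex_of_real (Z_fun x \<nu>) =
    of_real (16 / \<nu> * x\<^sup>2 * ln (x\<^sup>2) + 16 / \<nu> * x\<^sup>2 * ln (Q_const * exp 4 / \<nu>)) + R_line c x \<nu>"
proof -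
  have pos: "x\<^sup>2 / \<nu> > 0" "\<nu> * x\<^sup>2 > 0" using x \<nu> by auto
  have 1: "line_mean (- 1) (\<nu> * x\<^sup>2) = line_mean c (\<nu> * x\<^sup>2)" using c pos by (intro line_mean_left) auto
  have 2: "line_mean 2 (x\<^sup>2 / \<nu>) = line_mean c (x\<^sup>2 / \<nu>)
      + of_real (16 * (x\<^sup>2 / \<nu>) * (4 + ln (x\<^sup>2 / \<nu>) + euler_mascheroni - ln (4 * pi)))"
    using line_mean_shift[of c 2 "x\<^sup>2 / \<nu>"] c pos by (simp add: algebra_simps)
  have ln: "ln (x\<^sup>2 / \<nu>) = ln (x\<^sup>2) - ln \<nu>" "ln (Q_const * exp 4 / \<nu>) = euler_mascheroni - ln (4 * pi) + 4 - ln \<nu>"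
    using x \<nu> by (simp_all add: Q_const_facts ln_mult ln_div)
  have "complex_of_real (Z_fun x \<nu>) = R_line c x \<nu> + of_real (16 * (x\<^sup>2 / \<nu>) * (4 + ln (x\<^sup>2 / \<nu>) + euler_mascheroni - ln (4 * pi)))"
    unfolding Z_fun_line_mean(1)[OF x \<nu>] 1 2 using c by (subst R_line_eq(2)[OF _ _ x \<nu>]) auto
  also have "16 * (x\<^sup>2 / \<nu>) * (4 + ln (x\<^sup>2 / \<nu>) + euler_mascheroni - ln (4 * pi)) =
     16 / \<nu> * x\<^sup>2 * ln (x\<^sup>2) + 16 / \<nu> * x\<^sup>2 * ln (Q_const * exp 4 / \<nu>)"
    unfolding ln using \<nu> by (simp add: field_simps)
  finally show ?thesis by (simp only: add.commute)
qed

lemma R_line_right: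
  assumes "x > 0" "\<nu> > 0" "c > 1" "c' > 1" shows "R_line c x \<nu> = R_line c' x \<nu>"
  using Z_fun_right[OF assms(1,2,3)] Z_fun_right[OF assms(1,2,4)] by simp

lemma R_line_left:
  assumes "x > 0" "\<nu> > 0" "c < 0" "c' < 0" shows "R_line c x \<nu> = R_line c' x \<nu>"
  using Z_fun_left[OF assms(1,2,3)] Z_fun_left[OF assms(1,2,4)] by simp

text \<open>
  Divided by \<open>x\<^sup>2\<close>, the main term is \<open>32 * ln x\<close> plus a constant, while the remainder on the line
  \<open>Re s = 2\<close> is of order \<open>x\<^sup>2\<close>.
\<close>
lemma Z_fun_negative_near_0:
  assumes \<nu>: "\<nu> > 0"
  shows "\<exists>x\<^sub>\<nu>>0. \<forall>x. 0 < x \<and> x < x\<^sub>\<nu> \<longrightarrow> Z_fun x \<nu> < 0"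
proof -
  obtain K where K: "\<And>x \<nu>. x > 0 \<Longrightarrow> \<nu> > 0 \<Longrightarrow> norm (R_line 2 x \<nu>) \<le> K * ((\<nu> powr (- 2) + \<nu> powr (2 - 1)) * x powr (2 * 2))"
    using R_line_bound[of 2] by auto
  define L where "L = ln (Q_const * exp 4 * \<nu>)"
  define B where "B = K * (\<nu> powr (- 2) + \<nu> powr (2 - 1))"
  have "eventually (\<lambda>x::real. 32 * ln x + 16 * L + B * x\<^sup>2 < 0) (at_right 0)" by real_asymp
  then obtain x0 where x0: "x0 > 0" "\<And>x. 0 < x \<Longrightarrow> x < x0 \<Longrightarrow> 32 * ln x + 16 * L + B * x\<^sup>2 < 0"
    by (auto simp: eventually_at_right_field)
  have "Z_fun x \<nu> < 0" if x: "0 < x" "x < x0" for x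
  proof -
    have "Z_fun x \<nu> = 16 * x\<^sup>2 * ln (x\<^sup>2) + 16 * x\<^sup>2 * L + Re (R_line 2 x \<nu>)"
      using arg_cong[OF Z_fun_right[OF x(1) \<nu>, of 2], of Re] by (simp add: L_def)
    also have "Re (R_line 2 x \<nu>) \<le> B * x powr 4"
      using complex_Re_le_cmod[of "R_line 2 x \<nu>"] K[OF x(1) \<nu>] by (simp add: B_def mult.assoc)
    also have "x powr 4 = x\<^sup>2 * x\<^sup>2" using x by (simp add: powr_numeral eval_nat_numeral)
    also have "16 * x\<^sup>2 * ln (x\<^sup>2) + 16 * x\<^sup>2 * L + B * (x\<^sup>2 * x\<^sup>2) = x\<^sup>2 * (32 * ln x + 16 * L + B * x\<^sup>2)"
      using x by (simp add: ln_realpow algebra_simps)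
    also have "\<dots> < 0" using x0(2)[OF x] x by (simp add: mult_pos_neg)
    finally show ?thesis by simp
  qed
  with x0(1) show ?thesis by blast
qed

text \<open>
  On the line \<open>Re s = - 1\<close> the remainder tends to 0, while the main term grows like \<open>x\<^sup>2 * ln x\<close>.
\<close>
lemma Z_fun_positive_at_top:
  assumes \<nu>: "\<nu> > 0"
  shows "\<exists>x\<^sub>\<nu>>0. \<forall>x>x\<^sub>\<nu>. Z_fun x \<nu> > 0"
proof -
  obtain K where K: "\<And>x \<nu>. x > 0 \<Longrightarrow> \<nu> > 0 \<Longrightarrow> norm (R_line (- 1) x \<nu>) \<le> K * ((\<nu> powr (- (- 1)) + \<nu> powr (- 1 - 1)) * x powr (2 * - 1))"
    using R_line_bound[of "-1"] by auto
  define L where "L = ln (Q_const * exp 4 / \<nu>)"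
  define B where "B = K * (\<nu> powr (- (- 1)) + \<nu> powr (- 1 - 1))"
  have "eventually (\<lambda>x::real. 16 / \<nu> * x\<^sup>2 * (2 * ln x + L) - B * x powr (- 2) > 0) at_top"
    using \<nu> by real_asymp
  then obtain x0 where x0: "\<And>x. x \<ge> x0 \<Longrightarrow> 16 / \<nu> * x\<^sup>2 * (2 * ln x + L) - B * x powr (- 2) > 0"
    by (auto simp: eventually_at_top_linorder)
  have "Z_fun x \<nu> > 0" if x: "x > max x0 1" for x
  proof -
    have x': "x > 0" using x by simp
    have "16 / \<nu> * x\<^sup>2 * (2 * ln x + L) - B * x powr (- 2) > 0" using x by (intro x0) simp
    also have "16 / \<nu> * x\<^sup>2 * (2 * ln x + L) = 16 / \<nu> * x\<^sup>2 * ln (x\<^sup>2) + 16 / \<nu> * x\<^sup>2 * L"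
      using x' by (simp add: ln_realpow algebra_simps add_divide_distrib)
    also have "16 / \<nu> * x\<^sup>2 * ln (x\<^sup>2) + 16 / \<nu> * x\<^sup>2 * L - B * x powr (- 2) \<le>
       16 / \<nu> * x\<^sup>2 * ln (x\<^sup>2) + 16 / \<nu> * x\<^sup>2 * L + Re (R_line (- 1) x \<nu>)"
      using abs_Re_le_cmod[of "R_line (- 1) x \<nu>"] K[OF x' \<nu>] by (simp add: B_def mult.assoc)
    also have "\<dots> = Z_fun x \<nu>"
      using arg_cong[OF Z_fun_left[OF x' \<nu>, of "-1"], of Re] by (simp add: L_def)
    finally show ?thesis .
  qed
  then show ?thesis by (intro exI[of _ "max x0 1"]) auto
qed

text \<open>
  The bounds on the remainders are uniform in \<open>c\<close> because the remainder does not depend on \<open>c\<close> on either side of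
  the strip. They are obtained on the lines \<open>Re s = 1 + \<delta>\<close> and \<open>Re s = - \<delta>\<close>.
\<close>
theorem proposition6:
  shows
    "(\<forall>x>0. \<forall>\<nu>>0.
        set_integrable lborel {0<..} (V_integrand x \<nu>) \<and>
        (\<forall>k<4. (euler_op ^^ k) (\<lambda>y. V_fun y \<nu>) differentiable at x))
   \<and> (\<forall>x>0. \<forall>\<nu>>0. \<forall>c>1.
        vline_integrable c (R_integrand x \<nu>) \<and>
        complex_of_real (Z_fun x \<nu>) =
          of_real (16 * x\<^sup>2 * ln (x\<^sup>2) + 16 * x\<^sup>2 * ln (Q_const * exp 4 * \<nu>)) + R_line c x \<nu>)
   \<and> (\<forall>x>0. \<forall>\<nu>>0. \<forall>c<0.
        vline_integrable c (R_integrand x \<nu>) \<and>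
        complex_of_real (Z_fun x \<nu>) =
          of_real (16 / \<nu> * x\<^sup>2 * ln (x\<^sup>2) + 16 / \<nu> * x\<^sup>2 * ln (Q_const * exp 4 / \<nu>)) + R_line c x \<nu>)
   \<and> (\<forall>\<delta>>0. \<exists>C. \<forall>\<nu>>0. \<forall>x. \<forall>c>1. 0 < x \<and> x \<le> 1 \<longrightarrow>
        norm (R_line c x \<nu>) \<le> C * ((\<nu> powr (- 1 - \<delta>) + \<nu> powr \<delta>) * x powr (2 * (1 + \<delta>))))
   \<and> (\<forall>\<delta>>0. \<exists>C. \<forall>\<nu>>0. \<forall>x. \<forall>c<0. x \<ge> 1 \<longrightarrow>
        norm (R_line c x \<nu>) \<le> C * ((\<nu> powr (- 1 - \<delta>) + \<nu> powr \<delta>) * x powr (- 2 * \<delta>)))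
   \<and> (\<forall>\<nu>>0. (\<exists>x\<^sub>\<nu>>0. \<forall>x. 0 < x \<and> x < x\<^sub>\<nu> \<longrightarrow> Z_fun x \<nu> < 0) \<and>
             (\<exists>x\<^sub>\<nu>'>0. \<forall>x>x\<^sub>\<nu>'. Z_fun x \<nu> > 0))"
proof (intro conjI allI impI)
  fix \<delta> :: real assume \<delta>: "\<delta> > 0"
  obtain K where K: "\<And>x \<nu>. x > 0 \<Longrightarrow> \<nu> > 0 \<Longrightarrow>
     norm (R_line (1 + \<delta>) x \<nu>) \<le> K * ((\<nu> powr (- (1 + \<delta>)) + \<nu> powr (1 + \<delta> - 1)) * x powr (2 * (1 + \<delta>)))"
    using R_line_bound[of "1 + \<delta>"] \<delta> by auto
  show "\<exists>C. \<forall>\<nu>>0. \<forall>x. \<forall>c>1. 0 < x \<and> x \<le> 1 \<longrightarrow>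
        norm (R_line c x \<nu>) \<le> C * ((\<nu> powr (- 1 - \<delta>) + \<nu> powr \<delta>) * x powr (2 * (1 + \<delta>)))"
  proof (intro exI allI impI)
    fix \<nu> x c :: real assume *: "\<nu> > 0" "c > 1" "0 < x \<and> x \<le> 1"
    have "R_line c x \<nu> = R_line (1 + \<delta>) x \<nu>" using * \<delta> by (intro R_line_right) auto
    then show "norm (R_line c x \<nu>) \<le> K * ((\<nu> powr (- 1 - \<delta>) + \<nu> powr \<delta>) * x powr (2 * (1 + \<delta>)))"
      using K[of x \<nu>] * by simp
  qed
next
  fix \<delta> :: real assume \<delta>: "\<delta> > 0"
  obtain K where K: "\<And>x \<nu>. x > 0 \<Longrightarrow> \<nu> > 0 \<Longrightarrow>
     norm (R_line (- \<delta>) x \<nu>) \<le> K * ((\<nu> powr (- (- \<delta>)) + \<nu> powr (- \<delta> - 1)) * x powr (2 * - \<delta>))"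
    using R_line_bound[of "- \<delta>"] \<delta> by auto
  show "\<exists>C. \<forall>\<nu>>0. \<forall>x. \<forall>c<0. x \<ge> 1 \<longrightarrow>
        norm (R_line c x \<nu>) \<le> C * ((\<nu> powr (- 1 - \<delta>) + \<nu> powr \<delta>) * x powr (- 2 * \<delta>))"
  proof (intro exI allI impI)
    fix \<nu> x c :: real assume *: "\<nu> > 0" "c < 0" "x \<ge> 1"
    have "R_line c x \<nu> = R_line (- \<delta>) x \<nu>" using * \<delta> by (intro R_line_left) auto
    moreover have "- \<delta> - 1 = - 1 - \<delta>" "2 * - \<delta> = - 2 * \<delta>" by simp_all
    ultimately show "norm (R_line c x \<nu>) \<le> K * ((\<nu> powr (- 1 - \<delta>) + \<nu> powr \<delta>) * x powr (- 2 * \<delta>))"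
      using K[of x \<nu>] * by (simp add: add.commute minus_diff_commute)
  qed
qed ((rule V_fun_eq_Omega_conv(1) Z_fun_line_mean(2) R_line_eq(1) Z_fun_right Z_fun_left
       Z_fun_negative_near_0 Z_fun_positive_at_top; simp)+)

end
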